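(* Let $\alpha\in(0,1)$. For any constant $\gamma>0$ there exists a pair $(u,s)$ which satisfies, with $U=\{(x,t)\in\mathbb{R}\times(0,\infty):0<x<s(t)\}$, $$D^{\alpha}_{s^{-1}(x)}u(x,t)=u_{xx}(x,t)-\frac1{\Gamma(1-\alpha)}(t-s^{-1}(x))^{-\alpha}\quad\text{in } U,$$ $$u(s(t),t)=0,\qquad u(0,t)=\gamma,$$ $$\dot s(t)=-\frac1{\Gamma(\alpha)}\lim_{a\nearrow s(t)}\frac{d}{dt}\left[\int_{s^{-1}(a)}^t(t-\tau)^{\alpha-1}u_x(a,\tau)\,d\tau\right]$$ for all $t>0$. Furthermore, the solution is given by $$s(t)=c_1t^{\alpha/2},\qquad u(x,t)=\int_{xt^{-\alpha/2}}^{c_1}H(p,xt^{-\alpha/2})\,G_{c_1}(p)\,dp\ \text{ in } U,$$ where $c_1=c_1(\alpha,\gamma)>0$ and $G_{c_1}$, $H$, and $M_n$, $N$ are defined in the context. For every $R>0$ the series $N(p,y)=\sum_{n=1}^\infty M_n(p,y)$ converges uniformly on $W_R=\{(p,y):0\le y\le p\le R\}$. The functions $M_n$ and $N$ are positive on $\{(p,y):0\le y<p\}$, hence $u$ is positive in $U$. For every $a,\lambda>0$ the function $u$ satisfies the scaling property $u(x,t)=u(\lambda^a x,\lambda^{2a/\alpha}t)$, and $u_x(s(t),t)=0$ for $t>0$. Furthermore, for every $t>0$ there holds $u(\cdot,t)\in W^{2,1}(0,s(t))$, and $u_t(x,\cdot)\in C([s^{-1}(x),\infty))$ for every $x>0$.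 Finally, $u_x(x,\cdot)\in L^\infty(s^{-1}(x),\infty)\cap AC_{loc}([s^{-1}(x),\infty))$ for every $x>0$, and $u_t(\cdot,t)\in L^1(0,s(t))$, $D^\alpha_{s^{-1}(\cdot)}u(\cdot,t)\in L^1(0,s(t))$ for every $t>0$. In particular, the pair $(u,s)$ satisfies the assumptions (A1)--(A3) listed in the context.
   Context: The interface satisfies $s(0)=0$, and $$D^{\alpha}_{s^{-1}(x)}u(x,t)=\frac1{\Gamma(1-\alpha)}\int_{s^{-1}(x)}^t(t-\tau)^{-\alpha}u_t(x,\tau)\,d\tau.$$ Definitions: $$G_{c_1}(y)=\frac1{\Gamma(1-\alpha)}\int_y^{c_1}\big(1-c_1^{-2/\alpha}\mu^{2/\alpha}\big)^{-\alpha}d\mu,\quad 0\le y\le c_1,$$ $$M_1(p,y)=\frac1{\Gamma(1-\alpha)}\int_y^{p}\big(1-p^{-2/\alpha}\mu^{2/\alpha}\big)^{-\alpha}d\mu,\quad 0\le y\le p$$ (with $M_1(0,0)=0$), $$M_n(p,y)=\int_y^pM_1(a,y)M_{n-1}(p,a)\,da,\quad 0\le y\le p,\ n\ge2,$$ $$N(p,y)=\sum_{n=1}^\infty M_n(p,y),\quad 0\le y\le p,\qquad H(p,x)=1+\int_x^pN(p,y)\,dy,\quad 0\le x\le p.$$ $AC$ denotes absolutely continuous functions. Assumptions (A1)--(A3), for a pair $(u,s)$ with $s(0)=0$ and any $t^*>0$: (A1) $\dot s(t)>0$ for $t\in(0,t^* )$. (A2) $s\in AC[0,t^*]$; $u_x(x,\cdot)\in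 AC[s^{-1}(x),t^*]$ for every $x\in(0,s(t^* ))$; $u_x(\cdot,t)\in AC[0,s(t)-\varepsilon]$ for every $\varepsilon>0$ (with $\varepsilon<s(t)$) and every $t\in(0,t^* )$; $u_t(\cdot,t)\in L^1(0,s(t))$ for each $t\in(0,t^* )$. (A3) $\dot s\in L^\infty_{loc}((0,t^*])$ and $D^{\alpha}_{s^{-1}(\cdot)}u(\cdot,t)\in L^1(0,s(t))$ for $t\in(0,t^* )$. *)

theory Defs
  imports "HOL-Analysis.Analysis"
begin

definition AC_on :: "real set \<Rightarrow> (real \<Rightarrow> real) \<Rightarrow> bool" where
  "AC_on S f \<longleftrightarrow>
     (\<forall>\<epsilon>>0. \<exists>\<delta>>0. \<forall>D :: (real \<times> real) set.
        finite D \<longrightarrow>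
        (\<forall>(a, b)\<in>D. a \<le> b \<and> {a..b} \<subseteq> S) \<longrightarrow>
        pairwise (\<lambda>I J. disjnt {fst I<..<snd I} {fst J<..<snd J}) D \<longrightarrow>
        (\<Sum>(a, b)\<in>D. b - a) < \<delta> \<longrightarrow>
        (\<Sum>(a, b)\<in>D. \<bar>f b - f a\<bar>) < \<epsilon>)"

definition L_inf :: "real set \<Rightarrow> (real \<Rightarrow> real) \<Rightarrow> bool" where
  "L_inf S f \<longleftrightarrow>
     f \<in> borel_measurable (lebesgue_on S) \<and>
     (\<exists>C. AE x in lebesgue_on S. \<bar>f x\<bar> \<le> C)"

text \<open>Test functions: the class C_c^infinity(S) for an open set S.\<close>

definition test_function :: "real set \<Rightarrow> (real \<Rightarrow> real) \<Rightarrow> bool" where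
  "test_function S \<phi> \<longleftrightarrow>
     (\<forall>n x. (deriv ^^ n) \<phi> field_differentiable (at x)) \<and>
     (\<exists>K. compact K \<and> K \<subseteq> S \<and> (\<forall>x. x \<notin> K \<longrightarrow> \<phi> x = 0))"

definition weak_derivative ::
    "nat \<Rightarrow> real set \<Rightarrow> (real \<Rightarrow> real) \<Rightarrow> (real \<Rightarrow> real) \<Rightarrow> bool" where
  "weak_derivative k S f g \<longleftrightarrow>
     (\<forall>\<phi>. test_function S \<phi> \<longrightarrow>
        (LINT x:S|lebesgue. f x * (deriv ^^ k) \<phi> x)
          = (- 1) ^ k * (LINT x:S|lebesgue. g x * \<phi> x))"

text \<open>The Sobolev space W^{k,1}(S), S open.\<close>

definition sobolev_W1 :: "nat \<Rightarrow> real set \<Rightarrow> (real \<Rightarrow> real) \<Rightarrow> bool" where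
  "sobolev_W1 k S f \<longleftrightarrow>
     f absolutely_integrable_on S \<and>
     (\<forall>j\<in>{1..k}. \<exists>g. g absolutely_integrable_on S \<and> weak_derivative j S f g)"

text \<open>
  Since 0 powr r = 0, the singular integrand takes the value 0 at the single point where it
  is undefined, which does not affect the integrals. The convention M_1(0,0) = 0 holds because
  the domain of integration is then a single point.
\<close>

definition G :: "real \<Rightarrow> real \<Rightarrow> real \<Rightarrow> real" where
  "G \<alpha> c y = 1 / Gamma (1 - \<alpha>) *
     (LINT \<mu>:{y..c}|lebesgue. (1 - c powr (- 2 / \<alpha>) * \<mu> powr (2 / \<alpha>)) powr (- \<alpha>))"

definition M1 :: "real \<Rightarrow> real \<Rightarrow> real \<Rightarrow> real" where
  "M1 \<alpha> p y = 1 / Gamma (1 - \<alpha>) *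
     (LINT \<mu>:{y..p}|lebesgue. (1 - p powr (- 2 / \<alpha>) * \<mu> powr (2 / \<alpha>)) powr (- \<alpha>))"

text \<open>The index 0 is a dummy; all uses below have index at least 1.\<close>

fun M :: "real \<Rightarrow> nat \<Rightarrow> real \<Rightarrow> real \<Rightarrow> real" where
  "M \<alpha> 0 p y = 0"
| "M \<alpha> (Suc 0) p y = M1 \<alpha> p y"
| "M \<alpha> (Suc (Suc n)) p y = (LINT a:{y..p}|lebesgue. M1 \<alpha> a y * M \<alpha> (Suc n) p a)"

definition N :: "real \<Rightarrow> real \<Rightarrow> real \<Rightarrow> real" where
  "N \<alpha> p y = (\<Sum>n. M \<alpha> (Suc n) p y)"

definition H :: "real \<Rightarrow> real \<Rightarrow> real \<Rightarrow> real" where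
  "H \<alpha> p x = 1 + (LINT y:{x..p}|lebesgue. N \<alpha> p y)"

text \<open>
  A pair (u, s) is represented by total functions; only the values of s on [0,\<infinity>) and of u on
  the points (x,t) with 0 < t and 0 \<le> x \<le> s(t) are relevant. Accordingly the partial
  derivatives are taken relative to the slices [0, s(t)] and [s^{-1}(x), \<infinity>): they are ordinary
  derivatives in the interior and one-sided ones at the end points.
\<close>

definition Udom :: "(real \<Rightarrow> real) \<Rightarrow> (real \<times> real) set" where
  "Udom s = {(x, t). 0 < t \<and> 0 < x \<and> x < s t}"

definition s_inv :: "(real \<Rightarrow> real) \<Rightarrow> real \<Rightarrow> real" where
  "s_inv s x = inv_into {0..} s x"

definition x_diff :: "(real \<Rightarrow> real) \<Rightarrow> (real \<Rightarrow> real \<Rightarrow> real) \<Rightarrow> real \<Rightarrow> real \<Rightarrow> bool" where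
  "x_diff s u x t \<longleftrightarrow> (\<lambda>y. u y t) differentiable (at x within {0..s t})"

definition u_x :: "(real \<Rightarrow> real) \<Rightarrow> (real \<Rightarrow> real \<Rightarrow> real) \<Rightarrow> real \<Rightarrow> real \<Rightarrow> real" where
  "u_x s u x t = vector_derivative (\<lambda>y. u y t) (at x within {0..s t})"

definition t_diff :: "(real \<Rightarrow> real) \<Rightarrow> (real \<Rightarrow> real \<Rightarrow> real) \<Rightarrow> real \<Rightarrow> real \<Rightarrow> bool" where
  "t_diff s u x t \<longleftrightarrow> (\<lambda>\<tau>. u x \<tau>) differentiable (at t within {s_inv s x..})"

definition u_t :: "(real \<Rightarrow> real) \<Rightarrow> (real \<Rightarrow> real \<Rightarrow> real) \<Rightarrow> real \<Rightarrow> real \<Rightarrow> real" where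
  "u_t s u x t = vector_derivative (\<lambda>\<tau>. u x \<tau>) (at t within {s_inv s x..})"

text \<open>Used in the open set U only, where the ordinary derivative is the right notion.\<close>

definition u_xx :: "(real \<Rightarrow> real) \<Rightarrow> (real \<Rightarrow> real \<Rightarrow> real) \<Rightarrow> real \<Rightarrow> real \<Rightarrow> real" where
  "u_xx s u x t = deriv (\<lambda>y. u_x s u y t) x"

definition caputo_integrand ::
    "real \<Rightarrow> (real \<Rightarrow> real) \<Rightarrow> (real \<Rightarrow> real \<Rightarrow> real) \<Rightarrow> real \<Rightarrow> real \<Rightarrow> real \<Rightarrow> real" where
  "caputo_integrand \<alpha> s u x t \<tau> = (t - \<tau>) powr (- \<alpha>) * u_t s u x \<tau>"

definition caputo ::
    "real \<Rightarrow> (real \<Rightarrow> real) \<Rightarrow> (real \<Rightarrow> real \<Rightarrow> real) \<Rightarrow> real \<Rightarrow> real \<Rightarrow> real" where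
  "caputo \<alpha> s u x t =
     1 / Gamma (1 - \<alpha>) * (LINT \<tau>:{s_inv s x..t}|lebesgue. caputo_integrand \<alpha> s u x t \<tau>)"

definition flux_integrand ::
    "real \<Rightarrow> (real \<Rightarrow> real) \<Rightarrow> (real \<Rightarrow> real \<Rightarrow> real) \<Rightarrow> real \<Rightarrow> real \<Rightarrow> real \<Rightarrow> real" where
  "flux_integrand \<alpha> s u a t \<tau> = (t - \<tau>) powr (\<alpha> - 1) * u_x s u a \<tau>"

definition flux_integral ::
    "real \<Rightarrow> (real \<Rightarrow> real) \<Rightarrow> (real \<Rightarrow> real \<Rightarrow> real) \<Rightarrow> real \<Rightarrow> real \<Rightarrow> real" where
  "flux_integral \<alpha> s u a t = (LINT \<tau>:{s_inv s a..t}|lebesgue. flux_integrand \<alpha> s u a t \<tau>)"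

text \<open>
  The clauses on differentiability and integrability state that all expressions in the system
  exist, so that no default value of a derivative or an integral is ever used. Continuity up to
  the boundary gives the conditions u(s(t),t) = 0 and u(0,t) = \<gamma> their meaning. The time
  derivative in the Stefan condition is taken for fixed a.
\<close>

definition stefan_solution ::
    "real \<Rightarrow> real \<Rightarrow> (real \<Rightarrow> real \<Rightarrow> real) \<Rightarrow> (real \<Rightarrow> real) \<Rightarrow> bool" where
  "stefan_solution \<alpha> \<gamma> u s \<longleftrightarrow>
     s 0 = 0 \<and> bij_betw s {0..} {0..} \<and>
     continuous_on {(x, t). 0 < t \<and> 0 \<le> x \<and> x \<le> s t} (\<lambda>(x, t). u x t) \<and>
     (\<forall>t>0. \<forall>x\<in>{0..s t}. x_diff s u x t) \<and>
     (\<forall>x>0. \<forall>t\<ge>s_inv s x. t_diff s u x t) \<and>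
     (\<forall>(x, t)\<in>Udom s.
        (\<lambda>y. u_x s u y t) field_differentiable (at x) \<and>
        set_integrable lebesgue {s_inv s x..t} (caputo_integrand \<alpha> s u x t) \<and>
        caputo \<alpha> s u x t =
          u_xx s u x t - 1 / Gamma (1 - \<alpha>) * (t - s_inv s x) powr (- \<alpha>)) \<and>
     (\<forall>t>0. u (s t) t = 0 \<and> u 0 t = \<gamma>) \<and>
     (\<forall>t>0. s field_differentiable (at t) \<and>
        (\<forall>a\<in>{0<..<s t}.
           set_integrable lebesgue {s_inv s a..t} (flux_integrand \<alpha> s u a t) \<and>
           (\<lambda>r. flux_integral \<alpha> s u a r) field_differentiable (at t)) \<and>
        (\<exists>L. ((\<lambda>a. deriv (\<lambda>r. flux_integral \<alpha> s u a r) t) \<longlongrightarrow> L) (at_left (s t)) \<and>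
             deriv s t = - (1 / Gamma \<alpha>) * L))"

definition A1 :: "(real \<Rightarrow> real) \<Rightarrow> real \<Rightarrow> bool" where
  "A1 s T \<longleftrightarrow> (\<forall>t\<in>{0<..<T}. s field_differentiable (at t) \<and> deriv s t > 0)"

definition A2 :: "(real \<Rightarrow> real \<Rightarrow> real) \<Rightarrow> (real \<Rightarrow> real) \<Rightarrow> real \<Rightarrow> bool" where
  "A2 u s T \<longleftrightarrow>
     AC_on {0..T} s \<and>
     (\<forall>x\<in>{0<..<s T}.
        (\<forall>t\<in>{s_inv s x..T}. x_diff s u x t) \<and> AC_on {s_inv s x..T} (u_x s u x)) \<and>
     (\<forall>t\<in>{0<..<T}. \<forall>\<epsilon>\<in>{0<..<s t}.
        (\<forall>x\<in>{0..s t - \<epsilon>}. x_diff s u x t) \<and> AC_on {0..s t - \<epsilon>} (\<lambda>x. u_x s u x t)) \<and>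
     (\<forall>t\<in>{0<..<T}.
        (\<forall>x\<in>{0<..<s t}. t_diff s u x t) \<and> (\<lambda>x. u_t s u x t) absolutely_integrable_on {0<..<s t})"

text \<open>L^infinity_loc((0,T]) amounts to L^infinity on every [\<epsilon>,T].\<close>

definition A3 :: "real \<Rightarrow> (real \<Rightarrow> real \<Rightarrow> real) \<Rightarrow> (real \<Rightarrow> real) \<Rightarrow> real \<Rightarrow> bool" where
  "A3 \<alpha> u s T \<longleftrightarrow>
     (\<forall>\<epsilon>\<in>{0<..<T}. L_inf {\<epsilon>..T} (deriv s)) \<and>
     (\<forall>t\<in>{0<..<T}.
        (\<forall>x\<in>{0<..<s t}. set_integrable lebesgue {s_inv s x..t} (caputo_integrand \<alpha> s u x t)) \<and>
        (\<lambda>x. caputo \<alpha> s u x t) absolutely_integrable_on {0<..<s t})"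

end

theory Submission
  imports Defs
begin

text \<open>
  A self-similar temperature $u(x,t) = F(x t^{-\alpha/2})$ turns the equation into a Volterra equation
  of the second kind for the negative slope $v = -F'$, namely
  $v(y) = M_1(c,y) + \int_y^c M_1(p,y) v(p)\,dp$ on $[0,c]$. Its solution is the resolvent itself,
  $v = N(c,\cdot)$, and Fubini's theorem on a triangle rewrites $F = \int_y^c N(c,q)\,dq$ in terms of
  $H$ and $G_c$. The condition at $x = 0$ reads $\int_0^c N(c,q)\,dq = \gamma$ and is solved for $c$ by
  the intermediate value theorem, the left side being at least $c^2 / (2 \Gamma(1-\alpha))$.

  The Stefan condition follows from an exact identity: applying the fractional integral of order
  $\alpha$ to the equation gives
  $-\frac1{\Gamma(\alpha)} \int_{s^{-1}(a)}^t (t-\tau)^{\alpha-1} u_x(a,\tau)\,d\tau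
    = \int_a^{s(t)} (1 + u(x,t))\,dx$,
  whose time derivative tends to $\dot s(t)$ as $a$ tends to $s(t)$, since $u$ vanishes on the interface.
\<close>

section \<open>Integration on the real line\<close>

text \<open>The kernel of the equation is singular on the diagonal like (p - m)^(-\<alpha>), so F''
  = -v' blows up at the front. The argument therefore runs on integral identities between
  nonnegative functions: the Volterra equation is F'' = \<open>kern c\<close> +
  \<open>memory\<close> integrated from y to c with v(c) = 0, and F'' is recovered pointwise only in
  the open interval. Nonnegativity makes each exchange of two integrals an instance of Tonelli.

  The inhomogeneity M_1(c,.) is the kernel itself frozen at p = c; this is why the Neumann series
  sums to the resolvent kernel. The bound c^2 / (2 Gamma(1-\<alpha>)) is the integral of (c - y) /
  Gamma(1-\<alpha>) \<le> M_1(c,y) \<le> N(c,y).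

  Behind the flux identity is one computation: the fractional integral of order \<alpha> of
  \<tau>^(-\<alpha>/2) M_1(p, a \<tau>^(-\<alpha>/2)) is affine in a, namely p t^(\<alpha>/2) - a.
  The Volterra equation superposes these with weight v(p): the inhomogeneity p = c gives s(t) - a,
  the rest gives the integral of u.\<close>

lemma set_integral_nonneg_eq_integral:
  fixes f :: "real \<Rightarrow> real"
  assumes "f integrable_on S" "\<And>x. x \<in> S \<Longrightarrow> 0 \<le> f x"
  shows "set_integrable lebesgue S f" "(LINT x:S|lebesgue. f x) = integral S f"
proof -
  show *: "set_integrable lebesgue S f"
    using nonnegative_absolutely_integrable_1[OF assms] .
  show "(LINT x:S|lebesgue. f x) = integral S f"
    using set_lebesgue_integral_eq_integral(2)[OF *] .
qed

text \<open>Nonnegativity allows the passage to \<open>nn_integral\<close> over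
  \<open>lborel\<close>, where the order is exchanged, and back. The measurability of
  \<open>I\<close> and \<open>K\<close> comes from that of the inner \<open>nn_integral\<close>.
  Integrability of \<open>K\<close> is part of the conclusion.\<close>

lemma tonelli_has_integral:
  fixes f :: "real \<Rightarrow> real \<Rightarrow> real"
  assumes meas: "(\<lambda>z. f (fst z) (snd z)) \<in> borel_measurable borel"
    and nonneg: "\<And>x y. 0 \<le> f x y"
    and I: "\<And>x. (f x has_integral I x) UNIV"
    and K: "\<And>y. ((\<lambda>x. f x y) has_integral K y) UNIV"
    and J: "(I has_integral J) UNIV"
  shows "(K has_integral J) UNIV"
proof -
  have [measurable]: "(\<lambda>z. f (fst z) (snd z)) \<in> borel_measurable (lborel \<Otimes>\<^sub>M lborel)"
    using meas by (simp add: lborel_prod)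
  have [measurable]: "(\<lambda>z. f (snd z) (fst z)) \<in> borel_measurable (borel \<Otimes>\<^sub>M borel)"
  proof -
    have "(\<lambda>z :: real \<times> real. (snd z, fst z)) \<in> borel_measurable borel"
      by (intro borel_measurable_continuous_onI continuous_intros)
    from measurable_compose[OF this meas] show ?thesis by (simp add: borel_prod)
  qed
  have m1[measurable]: "f x \<in> borel_measurable borel" for x
    using measurable_compose[OF _ meas, of "\<lambda>y. (x, y)" borel] by simp
  have m2[measurable]: "(\<lambda>x. f x y) \<in> borel_measurable borel" for y
    using measurable_compose[OF _ meas, of "\<lambda>x. (x, y)" borel] by simp
  have I0: "0 \<le> I x" for x
    using has_integral_nonneg[OF I] nonneg by blast
  have K0: "0 \<le> K y" for y
    using has_integral_nonneg[OF K] nonneg by blast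
  have J0: "0 \<le> J"
    using has_integral_nonneg[OF J] I0 by blast
  have nI: "(\<integral>\<^sup>+y. ennreal (f x y) \<partial>lborel) = ennreal (I x)" for x
    using nn_integral_has_integral_lborel[OF m1 _ I] nonneg by simp
  have nK: "(\<integral>\<^sup>+x. ennreal (f x y) \<partial>lborel) = ennreal (K y)" for y
    using nn_integral_has_integral_lborel[OF m2 _ K] nonneg by simp
  have swap: "(\<integral>\<^sup>+x. (\<integral>\<^sup>+y. ennreal (f x y) \<partial>lborel) \<partial>lborel)
      = (\<integral>\<^sup>+y. (\<integral>\<^sup>+x. ennreal (f x y) \<partial>lborel) \<partial>lborel)"
    by (rule lborel_pair.Fubini'[symmetric]) (auto simp: case_prod_beta')
  have mi: "(\<lambda>x. enn2real (\<integral>\<^sup>+y. ennreal (f x y) \<partial>lborel)) \<in> borel_measurable lborel"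
    by measurable
  have mI: "I \<in> borel_measurable borel"
    using mi I0 by (simp add: nI)
  have mk: "(\<lambda>y. enn2real (\<integral>\<^sup>+x. ennreal (f x y) \<partial>lborel)) \<in> borel_measurable lborel"
    by measurable
  have mK: "K \<in> borel_measurable borel"
    using mk K0 by (simp add: nK)
  have "(\<integral>\<^sup>+y. ennreal (K y) \<partial>lborel) = (\<integral>\<^sup>+x. ennreal (I x) \<partial>lborel)"
    using swap by (simp add: nI nK)
  also have "\<dots> = ennreal J"
    using nn_integral_has_integral_lborel[OF mI _ J] I0 by simp
  finally show ?thesis
    by (intro nn_integral_has_integral mK K0 J0)
qed

text \<open>The triangle is put into the integrand, which vanishes outside, so that both orders
  become integrals over the whole line.\<close>

lemma tonelli_triangle:
  fixes f :: "real \<Rightarrow> real \<Rightarrow> real"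
  assumes meas: "(\<lambda>z. if a \<le> snd z \<and> snd z \<le> fst z \<and> fst z \<le> b then f (fst z) (snd z) else 0)
      \<in> borel_measurable borel"
    and nonneg: "\<And>p m. a \<le> m \<Longrightarrow> m \<le> p \<Longrightarrow> p \<le> b \<Longrightarrow> 0 \<le> f p m"
    and I: "\<And>p. a \<le> p \<Longrightarrow> p \<le> b \<Longrightarrow> (f p has_integral I p) {a..p}"
    and K: "\<And>m. a \<le> m \<Longrightarrow> m \<le> b \<Longrightarrow> ((\<lambda>p. f p m) has_integral K m) {m..b}"
    and J: "(I has_integral J) {a..b}"
  shows "(K has_integral J) {a..b}"
proof -
  let ?f = "\<lambda>p m. if a \<le> m \<and> m \<le> p \<and> p \<le> b then f p m else 0"
  have "((\<lambda>m. if m \<in> {a..b} then K m else 0) has_integral J) UNIV"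
  proof (rule tonelli_has_integral[of ?f "\<lambda>p. if p \<in> {a..b} then I p else 0"])
    show "(\<lambda>z. ?f (fst z) (snd z)) \<in> borel_measurable borel" by (rule meas)
    show "0 \<le> ?f x y" for x y using nonneg by auto
    show "(?f p has_integral (if p \<in> {a..b} then I p else 0)) UNIV" for p
    proof (cases "p \<in> {a..b}")
      case True
      have "((\<lambda>m. if m \<in> {a..p} then f p m else 0) has_integral I p) UNIV"
        by (subst has_integral_restrict_UNIV) (use I True in auto)
      moreover have "?f p = (\<lambda>m. if m \<in> {a..p} then f p m else 0)"
        using True by (auto simp: fun_eq_iff)
      ultimately show ?thesis
        using True by simp
    next
      case False
      then have "?f p = (\<lambda>m. 0)" by fastforce
      with False show ?thesis by auto
    qed
    show "((\<lambda>p. ?f p m) has_integral (if m \<in> {a..b} then K m else 0)) UNIV" for m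
    proof (cases "m \<in> {a..b}")
      case True
      have "((\<lambda>p. if p \<in> {m..b} then f p m else 0) has_integral K m) UNIV"
        by (subst has_integral_restrict_UNIV) (use K True in auto)
      moreover have "(\<lambda>p. ?f p m) = (\<lambda>p. if p \<in> {m..b} then f p m else 0)"
        using True by (auto simp: fun_eq_iff)
      ultimately show ?thesis
        using True by simp
    next
      case False
      then have "(\<lambda>p. ?f p m) = (\<lambda>m. 0)" by fastforce
      with False show ?thesis by auto
    qed
    show "((\<lambda>p. if p \<in> {a..b} then I p else 0) has_integral J) UNIV"
      using J by (simp only: has_integral_restrict_UNIV)
  qed
  then show ?thesis by (simp only: has_integral_restrict_UNIV)
qed

text \<open>The substitution a = y + (p - y) \<theta> moves the interval to [0,1] and puts the
  parameters into the integrand, where continuity of integrals over a fixed compact interval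
  applies.\<close>

lemma integral_moving_interval_continuous_on:
  fixes f :: "real \<Rightarrow> real \<Rightarrow> real \<Rightarrow> real"
  assumes "continuous_on {(p, y, a). 0 \<le> y \<and> y \<le> a \<and> a \<le> p} (\<lambda>(p, y, a). f p y a)"
  shows "continuous_on {(p, y). 0 \<le> y \<and> y \<le> p} (\<lambda>(p, y). integral {y..p} (f p y))"
proof -
  let ?W = "{(p, y). 0 \<le> y \<and> y \<le> (p::real)}"
  have eq: "integral {y..p} (f p y) = (p - y) * integral {0..1} (\<lambda>\<theta>. f p y (y + (p - y) * \<theta>))"
    if "0 \<le> y" "y \<le> p" for p y
  \<comment> \<open>The substitution degenerates for y = p; there both sides are 0.\<close>
  proof (cases "y = p")
    case False
    then have "y < p" using that by simp
    have "continuous_on {y..p} (f p y)"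
      using continuous_on_compose2[OF assms, of "{y..p}" "\<lambda>a. (p, y, a)"] that
      by (force intro: continuous_intros)
    then have "(f p y has_integral integral {y..p} (f p y)) (cbox y p)"
      using integrable_continuous_real integrable_integral by fastforce
    from has_integral_affinity[OF this, of "p - y" y] \<open>y < p\<close>
    have "((\<lambda>x. f p y (y + (p - y) * x)) has_integral (1 / (p - y)) * integral {y..p} (f p y))
       ((\<lambda>x. (1 / (p - y)) *\<^sub>R x + -((1 / (p - y)) *\<^sub>R y)) ` {y..p})"
      by (simp add: add.commute)
    moreover have "(\<lambda>x. (1 / (p - y)) *\<^sub>R x + -((1 / (p - y)) *\<^sub>R y)) ` {y..p} = {0..1}"
    proof -
      have "(\<lambda>x. (1 / (p - y)) *\<^sub>R x + -((1 / (p - y)) *\<^sub>R y)) = (\<lambda>x. (1 / (p - y)) * x + (- y / (p - y)))"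
        by (auto simp: fun_eq_iff)
      moreover have "1 / (p - y) * p + - y / (p - y) = 1" "1 / (p - y) * y + - y / (p - y) = 0"
        using \<open>y < p\<close> by (simp_all add: divide_simps)
      ultimately show ?thesis using \<open>y < p\<close>
        by (simp only: image_affinity_atLeastAtMost) simp
    qed
    ultimately have "integral {0..1} (\<lambda>x. f p y (y + (p - y) * x)) = (1 / (p - y)) * integral {y..p} (f p y)"
      by (simp add: integral_unique)
    then show ?thesis using \<open>y < p\<close> by simp
  qed auto
  have "continuous_on (?W \<times> cbox 0 1) (\<lambda>(z, \<theta>). f (fst z) (snd z) (snd z + (fst z - snd z) * \<theta>))"
  proof -
    have "continuous_on (?W \<times> cbox 0 1)
        ((\<lambda>(p, y, a). f p y a) \<circ> (\<lambda>(z, \<theta>). (fst z, snd z, snd z + (fst z - snd z) * \<theta>)))"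
    proof (rule continuous_on_compose)
      show "continuous_on (?W \<times> cbox 0 1) (\<lambda>(z, \<theta>). (fst z, snd z, snd z + (fst z - snd z) * \<theta>))"
        by (auto simp: case_prod_beta' intro!: continuous_intros)
      have le: "y + (p - y) * \<theta> \<le> p" if "y \<le> p" "\<theta> \<le> 1" for p y \<theta> :: real
        using mult_left_mono[OF that(2), of "p - y"] that by simp
      have "(\<lambda>(z, \<theta>). (fst z, snd z, snd z + (fst z - snd z) * \<theta>)) ` (?W \<times> cbox 0 1)
          \<subseteq> {(p, y, a). 0 \<le> y \<and> y \<le> a \<and> a \<le> p}"
        using le by auto
      then show "continuous_on ((\<lambda>(z, \<theta>). (fst z, snd z, snd z + (fst z - snd z) * \<theta>)) ` (?W \<times> cbox 0 1))
          (\<lambda>(p, y, a). f p y a)"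
        using assms continuous_on_subset by blast
    qed
    then show ?thesis by (simp add: o_def case_prod_beta')
  qed
  from integral_continuous_on_param[OF this]
  have "continuous_on ?W (\<lambda>z. (fst z - snd z) *
      integral {0..1} (\<lambda>\<theta>. f (fst z) (snd z) (snd z + (fst z - snd z) * \<theta>)))"
    by (auto intro!: continuous_intros)
  then show ?thesis
    by (rule continuous_on_eq) (auto simp: eq)
qed

lemma has_integral_powr_right_end:
  fixes a :: real
  assumes "a > -1" "y \<le> p"
  shows "((\<lambda>x. (p - x) powr a) has_integral ((p - y) powr (a + 1) / (a + 1))) {y..p}"
proof -
  have "((\<lambda>x. x powr a) has_integral ((p - y) powr (a + 1) / (a + 1))) (cbox 0 (p - y))"
    using has_integral_powr_from_0[of a "p - y"] assms by simp
  from has_integral_affinity[OF this, of "-1" p]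
  have "((\<lambda>x. (p - x) powr a) has_integral ((p - y) powr (a + 1) / (a + 1)))
      ((\<lambda>x. - x + p) ` {0..p - y})"
    by (simp add: add.commute)
  moreover have "(\<lambda>x. - x + p) ` {0..p - y} = {y..p}"
    using image_affinity_atLeastAtMost[of "-1" p 0 "p - y"] assms(2) by simp
  ultimately show ?thesis by simp
qed

lemma has_integral_powr_left_end:
  fixes a :: real
  assumes "a > -1" "y \<le> p"
  shows "((\<lambda>x. (x - y) powr a) has_integral ((p - y) powr (a + 1) / (a + 1))) {y..p}"
proof -
  have "((\<lambda>x. x powr a) has_integral ((p - y) powr (a + 1) / (a + 1))) (cbox 0 (p - y))"
    using has_integral_powr_from_0[of a "p - y"] assms by simp
  from has_integral_affinity[OF this, of 1 "-y"]
  have "((\<lambda>x. (x - y) powr a) has_integral ((p - y) powr (a + 1) / (a + 1)))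
      ((\<lambda>x. x + y) ` {0..p - y})"
    by simp
  moreover have "(\<lambda>x. x + y) ` {0..p - y} = {y..p}"
    using image_affinity_atLeastAtMost[of 1 y 0 "p - y"] assms(2) by (simp add: add.commute)
  ultimately show ?thesis by simp
qed

lemma integrable_on_Icc_bound:
  fixes f g :: "real \<Rightarrow> real"
  assumes "f \<in> borel_measurable borel" "g integrable_on {a..b}"
    and "\<And>x. a \<le> x \<Longrightarrow> x \<le> b \<Longrightarrow> \<bar>f x\<bar> \<le> g x"
  shows "f integrable_on {a..b}"
proof (rule measurable_bounded_by_integrable_imp_integrable[of f "{a..b}" g])
  have "f \<in> borel_measurable lborel" using assms(1) by simp
  then have "f \<in> borel_measurable lebesgue" by (rule measurable_completion)
  then show "f \<in> borel_measurable (lebesgue_on {a..b})"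
    by (rule measurable_restrict_space1)
qed (use assms in auto)

text \<open>Continuity on slices gives the inner integrals; measurability in the plane holds because
  the triangle is closed.\<close>

lemma triangle_swap_continuous:
  fixes f :: "real \<Rightarrow> real \<Rightarrow> real"
  assumes cont: "continuous_on {(p, m). a \<le> m \<and> m \<le> p \<and> p \<le> b} (\<lambda>(p, m). f p m)"
    and nonneg: "\<And>p m. a \<le> m \<Longrightarrow> m \<le> p \<Longrightarrow> p \<le> b \<Longrightarrow> 0 \<le> f p m"
    and I: "(\<lambda>p. integral {a..p} (f p)) integrable_on {a..b}"
  shows "((\<lambda>m. integral {m..b} (\<lambda>p. f p m)) has_integral
    integral {a..b} (\<lambda>p. integral {a..p} (f p))) {a..b}"
proof (rule tonelli_triangle[OF _ nonneg])
  let ?T = "{(p, m). a \<le> m \<and> m \<le> p \<and> p \<le> b}"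
  have eqT: "?T = {z. a \<le> snd z} \<inter> {z. snd z \<le> fst z} \<inter> {z. fst z \<le> b}" by auto
  have "closed ?T"
    unfolding eqT by (intro closed_Int closed_Collect_le continuous_intros)
  then have "(\<lambda>z. indicator ?T z *\<^sub>R (\<lambda>(p, m). f p m) z) \<in> borel_measurable borel"
    by (intro borel_measurable_continuous_on_indicator cont borel_closed)
  also have "(\<lambda>z. indicator ?T z *\<^sub>R (\<lambda>(p, m). f p m) z)
      = (\<lambda>z. if a \<le> snd z \<and> snd z \<le> fst z \<and> fst z \<le> b then f (fst z) (snd z) else 0)"
    by (auto simp: fun_eq_iff indicator_def)
  finally show "\<dots> \<in> borel_measurable borel" .
  show "(f p has_integral integral {a..p} (f p)) {a..p}" if "a \<le> p" "p \<le> b" for p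
  proof (intro integrable_integral integrable_continuous_real)
    show "continuous_on {a..p} (f p)"
      using continuous_on_compose2[OF cont, of "{a..p}" "\<lambda>m. (p, m)"] that
      by (force intro: continuous_intros)
  qed
  show "((\<lambda>p. f p m) has_integral integral {m..b} (\<lambda>p. f p m)) {m..b}" if "a \<le> m" "m \<le> b" for m
  proof (intro integrable_integral integrable_continuous_real)
    show "continuous_on {m..b} (\<lambda>p. f p m)"
      using continuous_on_compose2[OF cont, of "{m..b}" "\<lambda>p. (p, m)"] that
      by (force intro: continuous_intros)
  qed
  show "((\<lambda>p. integral {a..p} (f p)) has_integral integral {a..b} (\<lambda>p. integral {a..p} (f p))) {a..b}"
    using I by (rule integrable_integral)
qed

lemma continuous_on_W_fst:
  fixes f :: "real \<Rightarrow> real \<Rightarrow> real"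
  assumes "continuous_on {(p, y). 0 \<le> y \<and> y \<le> p} (\<lambda>(p, y). f p y)" "0 \<le> y"
  shows "continuous_on {y..c} (\<lambda>p. f p y)"
  using continuous_on_compose2[OF assms(1), of "{y..c}" "\<lambda>p. (p, y)"] assms(2)
  by (force intro: continuous_intros)

lemma continuous_on_W_snd:
  fixes f :: "real \<Rightarrow> real \<Rightarrow> real"
  assumes "continuous_on {(p, y). 0 \<le> y \<and> y \<le> p} (\<lambda>(p, y). f p y)" "0 \<le> y"
  shows "continuous_on {y..p} (f p)"
  using continuous_on_compose2[OF assms(1), of "{y..p}" "\<lambda>a. (p, a)"] assms(2)
  by (force intro: continuous_intros)

lemma continuous_on_W_compose:
  fixes f :: "real \<Rightarrow> real \<Rightarrow> real"
  assumes "continuous_on {(p, y). 0 \<le> y \<and> y \<le> p} (\<lambda>(p, y). f p y)"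
    and "continuous_on S g" "continuous_on S h" "\<And>x. x \<in> S \<Longrightarrow> 0 \<le> h x \<and> h x \<le> g x"
  shows "continuous_on S (\<lambda>x. f (g x) (h x))"
proof -
  have "continuous_on S (\<lambda>x. (\<lambda>(p, y). f p y) (g x, h x))"
    by (rule continuous_on_compose2[OF assms(1)])
      (use assms in \<open>auto intro!: continuous_intros\<close>)
  then show ?thesis by simp
qed

text \<open>Positivity is asked only inside because the kernels vanish on the diagonal. The middle
  third is compact, so \<open>f\<close> has a positive minimum there, and \<open>f\<close> is
  nonnegative at the ends by continuity.\<close>

lemma integral_pos_continuous:
  fixes f :: "real \<Rightarrow> real"
  assumes "a < b" "continuous_on {a..b} f" "\<And>x. a < x \<Longrightarrow> x < b \<Longrightarrow> 0 < f x"
  shows "0 < integral {a..b} f"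
proof -
  define c d where "c = a + (b - a) / 3" and "d = a + 2 * (b - a) / 3"
  have cd: "a < c" "c < d" "d < b" using assms(1) by (auto simp: c_def d_def field_simps)
  have Icc: "0 \<le> f x" if "x \<in> {a..b}" for x
  proof -
    have "x \<in> closure {a<..<b}" using that assms(1) by simp
    moreover have "continuous_on (closure {a<..<b}) f" using assms(1,2) by simp
    ultimately show ?thesis
      using continuous_ge_on_closure[of "{a<..<b}" f x 0] assms(3) by (simp add: less_imp_le)
  qed
  have "compact (f ` {c..d})"
    using assms(2) cd by (intro compact_continuous_image continuous_on_subset[OF assms(2)]) auto
  then obtain m where m: "m \<in> f ` {c..d}" "\<And>t. t \<in> f ` {c..d} \<Longrightarrow> m \<le> t"
    using compact_attains_inf[of "f ` {c..d}"] cd by auto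
  have "0 < m" using m(1) assms(3) cd by auto
  have fi: "f integrable_on {a..b}" using assms(2) by (rule integrable_continuous_real)
  have "0 < m * (d - c)" using \<open>0 < m\<close> cd by simp
  also have "\<dots> = integral {c..d} (\<lambda>x. m)" using cd by simp
  also have "\<dots> \<le> integral {c..d} f"
    using m(2) cd integrable_on_subinterval[OF fi, of c d] by (intro integral_le) auto
  also have "\<dots> \<le> integral {a..b} f"
    using cd Icc integrable_on_subinterval[OF fi, of c d] fi by (intro integral_subset_le) auto
  finally show ?thesis .
qed

lemma has_integral_scale:
  fixes f :: "real \<Rightarrow> real"
  assumes "(f has_integral i) {r * x..r * y}" "0 < r"
  shows "((\<lambda>z. f (r * z)) has_integral (i / r)) {x..y}"
proof -
  have "(f has_integral i) (cbox (r * x) (r * y))" using assms(1) by simp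
  from has_integral_affinity[OF this, of r 0] assms(2)
  have "((\<lambda>z. f (r * z)) has_integral (i / r)) ((\<lambda>z. (1 / r) * z) ` {r * x..r * y})"
    by simp
  moreover have "(\<lambda>z. (1 / r) * z) ` {r * x..r * y} = {x..y}"
    using image_mult_atLeastAtMost[of "1 / r" "r * x" "r * y"] assms(2) by simp
  ultimately show ?thesis by simp
qed

section \<open>Absolute continuity, essential boundedness and weak derivatives\<close>

text \<open>The intervals may share end points, so the sum is taken as the integral over the union
  of the open intervals, whose overlaps are negligible and which lies in the whole interval.\<close>

lemma sum_integral_disjoint_intervals_le:
  fixes q :: "real \<Rightarrow> real"
  assumes "q integrable_on {a..b}" "\<And>x. x \<in> {a..b} \<Longrightarrow> 0 \<le> q x"
    and "finite D" "\<And>u v. (u, v) \<in> D \<Longrightarrow> u \<le> v \<and> {u..v} \<subseteq> {a..b}"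
    and disj: "pairwise (\<lambda>I J. disjnt {fst I<..<snd I} {fst J<..<snd J}) D"
  shows "(\<Sum>(u, v)\<in>D. integral {u..v} q) \<le> integral {a..b} q"
proof -
  have sub: "q integrable_on {fst d..snd d}" if "d \<in> D" for d
    using integrable_on_subinterval[OF assms(1)] assms(4)[of "fst d" "snd d"] that by auto
  have "(q has_integral (\<Sum>d\<in>D. integral {fst d..snd d} q)) (\<Union>d\<in>D. {fst d<..<snd d})"
  proof (rule has_integral_UN[OF assms(3)])
    show "(q has_integral integral {fst d..snd d} q) {fst d<..<snd d}" if "d \<in> D" for d
      using integrable_integral[OF sub[OF that]] by (simp add: has_integral_Icc_iff_Ioo)
    show "pairwise (\<lambda>d e. negligible ({fst d<..<snd d} \<inter> {fst e<..<snd e})) D"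
      using disj by (rule pairwise_mono) (auto simp: disjnt_def)
  qed
  then have "(\<Sum>d\<in>D. integral {fst d..snd d} q) \<le> integral {a..b} q"
  proof (rule has_integral_subset_le[rotated])
    show "(q has_integral integral {a..b} q) {a..b}"
      using assms(1) by (rule integrable_integral)
    show "(\<Union>d\<in>D. {fst d<..<snd d}) \<subseteq> {a..b}"
      using assms(4) by fastforce
  qed (use assms(2) in auto)
  then show ?thesis by (simp add: case_prod_beta')
qed

lemma AC_on_integral:
  fixes f g :: "real \<Rightarrow> real"
  assumes g: "g absolutely_integrable_on {a..b}"
    and f: "\<And>x y. a \<le> x \<Longrightarrow> x \<le> y \<Longrightarrow> y \<le> b \<Longrightarrow> (g has_integral (f y - f x)) {x..y}"
  shows "AC_on {a..b} f"
  unfolding AC_on_def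
proof (intro allI impI)
  fix \<epsilon> :: real assume "\<epsilon> > 0"
  define h where "h k x = min \<bar>g x\<bar> (real k)" for k x
  have ag: "(\<lambda>x. \<bar>g x\<bar>) absolutely_integrable_on {a..b}"
    using set_integrable_abs[OF g] .
  have h_abs: "h k absolutely_integrable_on {a..b}" for k
  proof -
    have "(\<lambda>x. real k) absolutely_integrable_on {a..b}"
      by (intro absolutely_integrable_continuous_real continuous_intros)
    from absolutely_integrable_min_1[OF ag this] show ?thesis
      unfolding h_def .
  qed
  have agi: "(\<lambda>x. \<bar>g x\<bar>) integrable_on {a..b}"
    using ag set_lebesgue_integral_eq_integral(1) by blast
  have hi: "h k integrable_on {a..b}" for k
    using h_abs set_lebesgue_integral_eq_integral(1) by blast
  have "(\<lambda>k. integral {a..b} (h k)) \<longlonglongrightarrow> integral {a..b} (\<lambda>x. \<bar>g x\<bar>)"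
  proof (rule dominated_convergence(2))
    show "h k integrable_on {a..b}" for k by (rule hi)
    show "(\<lambda>x. \<bar>g x\<bar>) integrable_on {a..b}" by (rule agi)
    show "norm (h k x) \<le> \<bar>g x\<bar>" for k x by (simp add: h_def)
    show "(\<lambda>k. h k x) \<longlonglongrightarrow> \<bar>g x\<bar>" for x
    proof (rule tendsto_eventually)
      obtain n :: nat where n: "\<bar>g x\<bar> \<le> real n" using real_arch_simple by blast
      show "\<forall>\<^sub>F k in sequentially. h k x = \<bar>g x\<bar>"
        using eventually_ge_at_top[of n] by eventually_elim (use n in \<open>auto simp: h_def\<close>)
    qed
  qed
  then have "\<forall>\<^sub>F k in sequentially. integral {a..b} (\<lambda>x. \<bar>g x\<bar>) - \<epsilon> / 2 < integral {a..b} (h k)"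
    using order_tendstoD(1) \<open>\<epsilon> > 0\<close> by fastforce
  then obtain k where k: "integral {a..b} (\<lambda>x. \<bar>g x\<bar>) - \<epsilon> / 2 < integral {a..b} (h k)"
    by (auto simp: eventually_sequentially)
  let ?q = "\<lambda>x. \<bar>g x\<bar> - h k x"
  have qi: "?q integrable_on {a..b}" using agi hi by (rule integrable_diff)
  have q0: "0 \<le> ?q x" for x by (simp add: h_def)
  have qint: "integral {a..b} ?q < \<epsilon> / 2"
    using k by (simp add: integral_diff[OF agi hi])
  \<comment> \<open>The +1 keeps \<delta> positive when k = 0; k times \<delta> is still at most
    \<epsilon>/2.\<close>
  define \<delta> where "\<delta> = \<epsilon> / (2 * (real k + 1))"
  have "\<delta> > 0" using \<open>\<epsilon> > 0\<close> by (simp add: \<delta>_def)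
  have "(\<Sum>(u, v)\<in>D. \<bar>f v - f u\<bar>) < \<epsilon>"
    if D: "finite D" "\<forall>(u, v)\<in>D. u \<le> v \<and> {u..v} \<subseteq> {a..b}"
      "pairwise (\<lambda>I J. disjnt {fst I<..<snd I} {fst J<..<snd J}) D"
      "(\<Sum>(u, v)\<in>D. v - u) < \<delta>" for D
  proof -
    have "\<bar>f v - f u\<bar> \<le> integral {u..v} ?q + real k * (v - u)" if "(u, v) \<in> D" for u v
    proof -
      have uv: "u \<le> v" "{u..v} \<subseteq> {a..b}" using D(2) that by auto
      then have uv': "a \<le> u" "v \<le> b" by auto
      have gi: "g integrable_on {u..v}" and "integral {u..v} g = f v - f u"
        using f[OF uv'(1) uv(1) uv'(2)] by (auto simp: has_integral_iff)
      have agi': "(\<lambda>x. \<bar>g x\<bar>) integrable_on {u..v}" and qi': "?q integrable_on {u..v}"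
        and hi': "h k integrable_on {u..v}"
        using integrable_on_subinterval[OF agi uv(2)] integrable_on_subinterval[OF qi uv(2)]
          integrable_on_subinterval[OF hi uv(2)] .
      have "\<bar>f v - f u\<bar> = norm (integral {u..v} g)"
        using \<open>integral {u..v} g = f v - f u\<close> by simp
      also have "\<dots> \<le> integral {u..v} (\<lambda>x. \<bar>g x\<bar>)"
        by (rule integral_norm_bound_integral[OF gi agi']) simp
      also have "\<dots> = integral {u..v} ?q + integral {u..v} (h k)"
        using integral_add[OF qi' hi'] by simp
      also have "integral {u..v} (h k) \<le> integral {u..v} (\<lambda>x. real k)"
        by (rule integral_le[OF hi']) (auto simp: h_def)
      also have "\<dots> = real k * (v - u)" using uv(1) by simp
      finally show ?thesis by simp
    qed
    then have "(\<Sum>(u, v)\<in>D. \<bar>f v - f u\<bar>) \<le> (\<Sum>(u, v)\<in>D. integral {u..v} ?q + real k * (v - u))"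
      by (intro sum_mono) auto
    also have "\<dots> = (\<Sum>(u, v)\<in>D. integral {u..v} ?q) + real k * (\<Sum>(u, v)\<in>D. v - u)"
      by (simp add: case_prod_beta' sum.distrib sum_distrib_left)
    also have "(\<Sum>(u, v)\<in>D. integral {u..v} ?q) \<le> integral {a..b} ?q"
      by (rule sum_integral_disjoint_intervals_le[OF qi q0 D(1) _ D(3)]) (use D(2) in auto)
    also have "real k * (\<Sum>(u, v)\<in>D. v - u) \<le> real k * \<delta>"
      using D(4) by (intro mult_left_mono) auto
    also have "real k * \<delta> \<le> \<epsilon> / 2"
      using \<open>\<epsilon> > 0\<close> by (simp add: \<delta>_def field_simps)
    finally show ?thesis using qint by simp
  qed
  then show "\<exists>\<delta>>0. \<forall>D. finite D \<longrightarrow> (\<forall>(u, v)\<in>D. u \<le> v \<and> {u..v} \<subseteq> {a..b}) \<longrightarrow>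
      pairwise (\<lambda>I J. disjnt {fst I<..<snd I} {fst J<..<snd J}) D \<longrightarrow>
      (\<Sum>(u, v)\<in>D. v - u) < \<delta> \<longrightarrow> (\<Sum>(u, v)\<in>D. \<bar>f v - f u\<bar>) < \<epsilon>"
    using \<open>\<delta> > 0\<close> by blast
qed

lemma AC_on_C1:
  fixes f f' :: "real \<Rightarrow> real"
  assumes "\<And>x. x \<in> {a..b} \<Longrightarrow> (f has_real_derivative f' x) (at x within {a..b})"
    and "continuous_on {a..b} f'"
  shows "AC_on {a..b} f"
proof (rule AC_on_integral)
  show "f' absolutely_integrable_on {a..b}"
    using assms(2) by (rule absolutely_integrable_continuous_real)
  show "(f' has_integral (f y - f x)) {x..y}" if "a \<le> x" "x \<le> y" "y \<le> b" for x y
  proof (rule fundamental_theorem_of_calculus[OF that(2)])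
    show "(f has_vector_derivative f' z) (at z within {x..y})" if "z \<in> {x..y}" for z
      using DERIV_subset[OF assms(1)[of z], of "{x..y}"] that \<open>a \<le> x\<close> \<open>y \<le> b\<close>
      by (auto simp: has_real_derivative_iff_has_vector_derivative)
  qed
qed

lemma AC_on_mono: "AC_on S f \<Longrightarrow> T \<subseteq> S \<Longrightarrow> AC_on T f"
  unfolding AC_on_def
proof (intro allI impI)
  fix \<epsilon> :: real
  assume f: "\<forall>\<epsilon>>0. \<exists>\<delta>>0. \<forall>D. finite D \<longrightarrow> (\<forall>(a, b)\<in>D. a \<le> b \<and> {a..b} \<subseteq> S) \<longrightarrow>
      pairwise (\<lambda>I J. disjnt {fst I<..<snd I} {fst J<..<snd J}) D \<longrightarrow>
      (\<Sum>(a, b)\<in>D. b - a) < \<delta> \<longrightarrow> (\<Sum>(a, b)\<in>D. \<bar>f b - f a\<bar>) < \<epsilon>"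
    and "T \<subseteq> S" "\<epsilon> > 0"
  have "\<forall>(a, b)\<in>D. a \<le> b \<and> {a..b} \<subseteq> S" if "\<forall>(a, b)\<in>D. a \<le> b \<and> {a..b} \<subseteq> T" for D :: "(real \<times> real) set"
    using that \<open>T \<subseteq> S\<close> by fast
  with f \<open>\<epsilon> > 0\<close> show "\<exists>\<delta>>0. \<forall>D. finite D \<longrightarrow> (\<forall>(a, b)\<in>D. a \<le> b \<and> {a..b} \<subseteq> T) \<longrightarrow>
      pairwise (\<lambda>I J. disjnt {fst I<..<snd I} {fst J<..<snd J}) D \<longrightarrow>
      (\<Sum>(a, b)\<in>D. b - a) < \<delta> \<longrightarrow> (\<Sum>(a, b)\<in>D. \<bar>f b - f a\<bar>) < \<epsilon>"
    by meson
qed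

lemma AC_on_cong: "AC_on S f \<Longrightarrow> (\<And>x. x \<in> S \<Longrightarrow> f x = g x) \<Longrightarrow> AC_on S g"
proof -
  assume f: "AC_on S f" and eq: "\<And>x. x \<in> S \<Longrightarrow> f x = g x"
  have *: "(\<Sum>(a, b)\<in>D. \<bar>g b - g a\<bar>) = (\<Sum>(a, b)\<in>D. \<bar>f b - f a\<bar>)"
    if "\<forall>(a, b)\<in>D. a \<le> b \<and> {a..b} \<subseteq> S" for D :: "(real \<times> real) set"
    using that by (intro sum.cong refl) (auto simp: eq subset_iff)
  show ?thesis
    unfolding AC_on_def
  proof (intro allI impI)
    fix \<epsilon> :: real assume "\<epsilon> > 0"
    then obtain \<delta> where "\<delta> > 0" "\<And>D. finite D \<Longrightarrow> (\<forall>(a, b)\<in>D. a \<le> b \<and> {a..b} \<subseteq> S) \<Longrightarrow>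
      pairwise (\<lambda>I J. disjnt {fst I<..<snd I} {fst J<..<snd J}) D \<Longrightarrow>
      (\<Sum>(a, b)\<in>D. b - a) < \<delta> \<Longrightarrow> (\<Sum>(a, b)\<in>D. \<bar>f b - f a\<bar>) < \<epsilon>"
      using f unfolding AC_on_def by meson
    then show "\<exists>\<delta>>0. \<forall>D. finite D \<longrightarrow> (\<forall>(a, b)\<in>D. a \<le> b \<and> {a..b} \<subseteq> S) \<longrightarrow>
      pairwise (\<lambda>I J. disjnt {fst I<..<snd I} {fst J<..<snd J}) D \<longrightarrow>
      (\<Sum>(a, b)\<in>D. b - a) < \<delta> \<longrightarrow> (\<Sum>(a, b)\<in>D. \<bar>g b - g a\<bar>) < \<epsilon>"
      by (intro exI[of _ \<delta>]) (simp add: *)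
  qed
qed

lemma AC_on_mult:
  fixes f g :: "real \<Rightarrow> real"
  assumes "AC_on S f" "AC_on S g"
    and B: "0 < B" "\<And>x. x \<in> S \<Longrightarrow> \<bar>f x\<bar> \<le> B" "\<And>x. x \<in> S \<Longrightarrow> \<bar>g x\<bar> \<le> B"
  shows "AC_on S (\<lambda>x. f x * g x)"
  unfolding AC_on_def
proof (intro allI impI)
  fix \<epsilon> :: real assume "\<epsilon> > 0"
  then have e: "\<epsilon> / (2 * B) > 0" using B by simp
  obtain d1 where d1: "d1 > 0" "\<And>D. finite D \<Longrightarrow> (\<forall>(a, b)\<in>D. a \<le> b \<and> {a..b} \<subseteq> S) \<Longrightarrow>
      pairwise (\<lambda>I J. disjnt {fst I<..<snd I} {fst J<..<snd J}) D \<Longrightarrow>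
      (\<Sum>(a, b)\<in>D. b - a) < d1 \<Longrightarrow> (\<Sum>(a, b)\<in>D. \<bar>f b - f a\<bar>) < \<epsilon> / (2 * B)"
    using assms(1) e unfolding AC_on_def by meson
  obtain d2 where d2: "d2 > 0" "\<And>D. finite D \<Longrightarrow> (\<forall>(a, b)\<in>D. a \<le> b \<and> {a..b} \<subseteq> S) \<Longrightarrow>
      pairwise (\<lambda>I J. disjnt {fst I<..<snd I} {fst J<..<snd J}) D \<Longrightarrow>
      (\<Sum>(a, b)\<in>D. b - a) < d2 \<Longrightarrow> (\<Sum>(a, b)\<in>D. \<bar>g b - g a\<bar>) < \<epsilon> / (2 * B)"
    using assms(2) e unfolding AC_on_def by meson
  show "\<exists>\<delta>>0. \<forall>D. finite D \<longrightarrow> (\<forall>(a, b)\<in>D. a \<le> b \<and> {a..b} \<subseteq> S) \<longrightarrow>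
      pairwise (\<lambda>I J. disjnt {fst I<..<snd I} {fst J<..<snd J}) D \<longrightarrow>
      (\<Sum>(a, b)\<in>D. b - a) < \<delta> \<longrightarrow> (\<Sum>(a, b)\<in>D. \<bar>f b * g b - f a * g a\<bar>) < \<epsilon>"
  proof (intro exI[of _ "min d1 d2"] conjI allI impI)
    show "min d1 d2 > 0" using d1 d2 by simp
    fix D :: "(real \<times> real) set"
    assume D: "finite D" "\<forall>(a, b)\<in>D. a \<le> b \<and> {a..b} \<subseteq> S"
      "pairwise (\<lambda>I J. disjnt {fst I<..<snd I} {fst J<..<snd J}) D"
      "(\<Sum>(a, b)\<in>D. b - a) < min d1 d2"
    have "\<bar>f b * g b - f a * g a\<bar> \<le> B * \<bar>g b - g a\<bar> + B * \<bar>f b - f a\<bar>" if "(a, b) \<in> D" for a b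
    proof -
      have ab: "a \<in> S" "b \<in> S" using D(2) that by (auto simp: subset_iff)
      have "f b * g b - f a * g a = f b * (g b - g a) + g a * (f b - f a)"
        by (simp add: algebra_simps)
      then have "\<bar>f b * g b - f a * g a\<bar> \<le> \<bar>f b\<bar> * \<bar>g b - g a\<bar> + \<bar>g a\<bar> * \<bar>f b - f a\<bar>"
        by (metis abs_mult abs_triangle_ineq)
      also have "\<dots> \<le> B * \<bar>g b - g a\<bar> + B * \<bar>f b - f a\<bar>"
        using B(2)[OF ab(2)] B(3)[OF ab(1)] by (intro add_mono mult_right_mono) auto
      finally show ?thesis .
    qed
    then have "(\<Sum>(a, b)\<in>D. \<bar>f b * g b - f a * g a\<bar>)
        \<le> (\<Sum>(a, b)\<in>D. B * \<bar>g b - g a\<bar> + B * \<bar>f b - f a\<bar>)"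
      by (intro sum_mono) auto
    also have "\<dots> = B * (\<Sum>(a, b)\<in>D. \<bar>g b - g a\<bar>) + B * (\<Sum>(a, b)\<in>D. \<bar>f b - f a\<bar>)"
      by (simp add: case_prod_beta' sum.distrib sum_distrib_left)
    also have "\<dots> < B * (\<epsilon> / (2 * B)) + B * (\<epsilon> / (2 * B))"
      using d1(2)[OF D(1-3)] d2(2)[OF D(1-3)] D(4) B(1)
      by (intro add_strict_mono mult_strict_left_mono) auto
    also have "\<dots> = \<epsilon>" using B(1) by simp
    finally show "(\<Sum>(a, b)\<in>D. \<bar>f b * g b - f a * g a\<bar>) < \<epsilon>" .
  qed
qed

text \<open>Makes the one-sided time derivative at the arrival time \<open>s_inv s x\<close> unique,
  so that \<open>vector_derivative\<close> returns it.\<close>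

lemma at_within_Ici_not_bot: "t0 \<le> (t::real) \<Longrightarrow> at t within {t0..} \<noteq> bot"
proof -
  assume "t0 \<le> t"
  then have "at_right t \<le> at t within {t0..}" by (intro at_le) auto
  then show ?thesis
    using trivial_limit_at_right_real[of t] by (metis bot.extremum_uniqueI)
qed

lemma L_inf_continuous:
  assumes "S \<in> sets lebesgue" "continuous_on S f" "\<And>x. x \<in> S \<Longrightarrow> \<bar>f x\<bar> \<le> B"
  shows "L_inf S f"
  unfolding L_inf_def
proof
  show "f \<in> borel_measurable (lebesgue_on S)"
    using assms(2,1) by (rule continuous_imp_measurable_on_sets_lebesgue)
  show "\<exists>C. AE x in lebesgue_on S. \<bar>f x\<bar> \<le> C"
    using assms(3) by (intro exI[of _ B] AE_I2) (auto simp: space_restrict_space)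
qed

lemma set_lebesgue_integral_Ioo:
  fixes f :: "real \<Rightarrow> real"
  assumes "f absolutely_integrable_on {a..b}"
  shows "f absolutely_integrable_on {a<..<b}" "(LINT x:{a<..<b}|lebesgue. f x) = integral {a..b} f"
proof -
  show *: "f absolutely_integrable_on {a<..<b}"
    by (rule set_integrable_subset[OF assms]) auto
  show "(LINT x:{a<..<b}|lebesgue. f x) = integral {a..b} f"
    using set_lebesgue_integral_eq_integral(2)[OF *] by (simp add: integral_open_interval_real)
qed

section \<open>Test functions and weak derivatives\<close>

lemma test_function_has_derivative:
  assumes "test_function S \<phi>"
  shows "(\<phi> has_real_derivative deriv \<phi> x) (at x)"
proof -
  have "(deriv ^^ 0) \<phi> field_differentiable (at x)"
    using assms unfolding test_function_def by blast
  then show ?thesis by (simp add: field_differentiable_derivI)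
qed

lemma test_function_continuous_on: "test_function S \<phi> \<Longrightarrow> continuous_on T \<phi>"
  by (rule DERIV_continuous_on[where D = "deriv \<phi>"])
    (auto intro: has_field_derivative_at_within test_function_has_derivative)

lemma test_function_zero: "test_function S \<phi> \<Longrightarrow> x \<notin> S \<Longrightarrow> \<phi> x = 0"
  unfolding test_function_def by blast

text \<open>The support does not grow: the complement of the compact K is open, so off K the
  function is locally 0 and so is its derivative.\<close>

lemma test_function_deriv:
  assumes "test_function S \<phi>"
  shows "test_function S (deriv \<phi>)"
proof -
  obtain K where K: "compact K" "K \<subseteq> S" "\<And>x. x \<notin> K \<Longrightarrow> \<phi> x = 0"
    using assms unfolding test_function_def by blast
  have "deriv \<phi> x = 0" if "x \<notin> K" for x
  proof (rule DERIV_imp_deriv)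
    show "(\<phi> has_real_derivative 0) (at x)"
      by (rule has_field_derivative_transform_within_open[of "\<lambda>_. 0" _ _ "- K"])
        (use K that in \<open>auto intro: compact_imp_closed\<close>)
  qed
  moreover have "(deriv ^^ n) (deriv \<phi>) field_differentiable (at x)" for n x
  proof -
    have "(deriv ^^ Suc n) \<phi> field_differentiable (at x)"
      using assms unfolding test_function_def by blast
    then show ?thesis by (simp add: funpow_Suc_right del: funpow.simps)
  qed
  ultimately show ?thesis
    using K unfolding test_function_def by blast
qed

text \<open>\<open>f\<close> may be unbounded at the ends, as the second derivative is at the front:
  the fundamental theorem asks for continuity of \<open>F\<close> up to the ends and for derivatives
  inside only, and the boundary terms vanish with \<phi>.\<close>

lemma integral_test_function_by_parts:
  fixes F f :: "real \<Rightarrow> real"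
  assumes "a < b" "continuous_on {a..b} F"
    and F: "\<And>x. a < x \<Longrightarrow> x < b \<Longrightarrow> (F has_real_derivative f x) (at x)"
    and f: "f absolutely_integrable_on {a..b}" and \<phi>: "test_function {a<..<b} \<phi>"
  shows "(LINT x:{a<..<b}|lebesgue. F x * deriv \<phi> x) = - (LINT x:{a<..<b}|lebesgue. f x * \<phi> x)"
proof -
  have c: "continuous_on {a..b} \<phi>" "continuous_on {a..b} (deriv \<phi>)"
    using \<phi> test_function_continuous_on test_function_deriv by blast+
  have "((\<lambda>x. F x * deriv \<phi> x + f x * \<phi> x) has_integral (F b * \<phi> b - F a * \<phi> a)) {a..b}"
  proof (rule fundamental_theorem_of_calculus_interior)
    show "continuous_on {a..b} (\<lambda>x. F x * \<phi> x)" by (intro continuous_intros assms c)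
    show "((\<lambda>x. F x * \<phi> x) has_vector_derivative F x * deriv \<phi> x + f x * \<phi> x) (at x)"
      if "x \<in> {a<..<b}" for x
      unfolding has_real_derivative_iff_has_vector_derivative[symmetric]
      using that F[of x] test_function_has_derivative[OF \<phi>, of x]
      by (auto intro!: derivative_eq_intros)
  qed (use assms in auto)
  moreover have "\<phi> a = 0" "\<phi> b = 0" using test_function_zero[OF \<phi>] by auto
  ultimately have sum: "integral {a..b} (\<lambda>x. F x * deriv \<phi> x + f x * \<phi> x) = 0"
    by (simp add: integral_unique)
  have i1: "(\<lambda>x. F x * deriv \<phi> x) absolutely_integrable_on {a..b}"
    by (intro absolutely_integrable_continuous_real continuous_intros assms c)
  \<comment> \<open>\<open>f\<close> is merely integrable here, so the product is controlled by the
    boundedness of the continuous \<phi>.\<close>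
  have "(\<lambda>x. \<phi> x * f x) absolutely_integrable_on {a..b}"
  proof (rule absolutely_integrable_bounded_measurable_product_real)
    show "\<phi> \<in> borel_measurable (lebesgue_on {a..b})"
      by (rule continuous_imp_measurable_on_sets_lebesgue[OF c(1)]) simp
    show "bounded (\<phi> ` {a..b})"
      by (intro compact_imp_bounded compact_continuous_image c) simp
  qed (use f in auto)
  then have i2: "(\<lambda>x. f x * \<phi> x) absolutely_integrable_on {a..b}" by (simp add: mult.commute)
  show ?thesis
    using sum integral_add[OF set_lebesgue_integral_eq_integral(1)[OF i1] set_lebesgue_integral_eq_integral(1)[OF i2]]
    by (simp add: set_lebesgue_integral_Ioo(2)[OF i1] set_lebesgue_integral_Ioo(2)[OF i2])
qed

lemma sobolev_W1_2I:
  fixes f f' f'' :: "real \<Rightarrow> real"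
  assumes "a < b" and cont: "continuous_on {a..b} f" "continuous_on {a..b} f'"
    and f: "\<And>x. a < x \<Longrightarrow> x < b \<Longrightarrow> (f has_real_derivative f' x) (at x)"
    and f': "\<And>x. a < x \<Longrightarrow> x < b \<Longrightarrow> (f' has_real_derivative f'' x) (at x)"
    and f'': "f'' absolutely_integrable_on {a..b}"
  shows "sobolev_W1 2 {a<..<b} f"
proof -
  have i: "f absolutely_integrable_on {a..b}" "f' absolutely_integrable_on {a..b}"
    using cont by (auto intro: absolutely_integrable_continuous_real)
  have w1: "weak_derivative 1 {a<..<b} f f'"
    unfolding weak_derivative_def
    using integral_test_function_by_parts[OF assms(1) cont(1) f i(2)] by simp
  have w2: "weak_derivative 2 {a<..<b} f f''"
    unfolding weak_derivative_def
    using integral_test_function_by_parts[OF assms(1) cont(1) f i(2) test_function_deriv]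
      integral_test_function_by_parts[OF assms(1) cont(2) f' f'']
    by (simp add: numeral_2_eq_2)
  have "\<exists>g. g absolutely_integrable_on {a<..<b} \<and> weak_derivative j {a<..<b} f g" if "j \<in> {1..2}" for j
  proof -
    have "j = 1 \<or> j = 2" using that by auto
    then show ?thesis
      using w1 w2 set_lebesgue_integral_Ioo(1)[OF i(2)] set_lebesgue_integral_Ioo(1)[OF f''] by blast
  qed
  then show ?thesis
    unfolding sobolev_W1_def using set_lebesgue_integral_Ioo(1)[OF i(1)] by blast
qed

section \<open>The iterated kernels and the resolvent\<close>

locale fractional_order =
  fixes \<alpha> :: real
  assumes alpha_pos: "0 < \<alpha>" and alpha_less_1: "\<alpha> < 1"
begin

text \<open>The integrand of M_1 with its Gamma factor, formally minus the derivative of M_1(p,.).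
  For p > 0 and m \<ge> 0 it depends on m / p only. On the diagonal with p > 0 its value is 0
  instead of infinity, by the convention 0 powr r = 0.\<close>

definition kern :: "real \<Rightarrow> real \<Rightarrow> real" where
  "kern p m = (1 - p powr (- 2 / \<alpha>) * m powr (2 / \<alpha>)) powr (- \<alpha>) / Gamma (1 - \<alpha>)"

lemma Gamma_pos: "Gamma (1 - \<alpha>) > 0" "Gamma \<alpha> > 0"
  using alpha_pos alpha_less_1 by (auto intro: Gamma_real_pos)

lemma kern_eq:
  assumes "0 < p" "0 \<le> m"
  shows "kern p m = (1 - (m / p) powr (2 / \<alpha>)) powr (- \<alpha>) / Gamma (1 - \<alpha>)"
proof -
  have "p powr (- 2 / \<alpha>) * m powr (2 / \<alpha>) = (m / p) powr (2 / \<alpha>)"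
    using assms by (simp add: powr_divide powr_minus field_simps)
  then show ?thesis by (simp add: kern_def)
qed

lemma kern_0: "kern p 0 = 1 / Gamma (1 - \<alpha>)"
  by (simp add: kern_def)

lemma kern_nonneg: "0 \<le> kern p m"
  using Gamma_pos by (simp add: kern_def)

lemma kern_scale: "0 < l \<Longrightarrow> 0 < p \<Longrightarrow> 0 \<le> m \<Longrightarrow> kern (l * p) (l * m) = kern p m"
proof -
  assume a: "0 < l" "0 < p" "0 \<le> m"
  then have b: "0 < l * p" "0 \<le> l * m" "l * m / (l * p) = m / p" by simp_all
  show ?thesis unfolding kern_eq[OF b(1,2)] kern_eq[OF a(2,3)] b(3) by (rule refl)
qed

lemma kern_measurable: "(\<lambda>z. kern (fst z) (snd z)) \<in> borel_measurable borel"
  unfolding kern_def borel_prod[symmetric] by measurable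

lemma kern_measurable_compose:
  assumes "f \<in> borel_measurable S" "g \<in> borel_measurable S"
  shows "(\<lambda>x. kern (f x) (g x)) \<in> borel_measurable S"
  using measurable_compose[OF borel_measurable_Pair[OF assms] kern_measurable] by simp

text \<open>As 2 / \<alpha> > 1, a ratio in [0,1) does not grow under the power. This compares the
  kernel with (p - m)^(-\<alpha>), whose integrability rests on \<alpha> < 1.\<close>

lemma ratio_powr_bounds:
  assumes "0 < p" "0 \<le> m" "m < p"
  shows "(m / p) powr (2 / \<alpha>) < 1" "(p - m) / p \<le> 1 - (m / p) powr (2 / \<alpha>)"
proof -
  have "(m / p) powr (2 / \<alpha>) \<le> (m / p) powr 1"
    using assms alpha_pos alpha_less_1 by (intro powr_mono') auto
  also have "\<dots> = m / p" using assms by simp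
  finally have *: "(m / p) powr (2 / \<alpha>) \<le> m / p" .
  also have "m / p < 1" using assms by simp
  finally show "(m / p) powr (2 / \<alpha>) < 1" .
  have "(p - m) / p = 1 - m / p" using assms by (simp add: field_simps)
  with * show "(p - m) / p \<le> 1 - (m / p) powr (2 / \<alpha>)" by simp
qed

text \<open>The base lies in (0,1] and the exponent is negative. The diagonal is left out because
  \<open>kern\<close> is 0 there.\<close>

lemma kern_ge:
  assumes "0 \<le> m" "m < p"
  shows "1 / Gamma (1 - \<alpha>) \<le> kern p m"
proof -
  have p: "0 < p" using assms by simp
  have "1 = 1 powr (- \<alpha>)" by simp
  also have "\<dots> \<le> (1 - (m / p) powr (2 / \<alpha>)) powr (- \<alpha>)"
    using ratio_powr_bounds(1)[OF p assms] alpha_pos by (intro powr_mono2') auto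
  finally show ?thesis
    using Gamma_pos p assms by (simp add: kern_eq divide_right_mono)
qed

lemma kern_le:
  assumes "0 < p" "0 \<le> m" "m \<le> p"
  shows "kern p m \<le> p powr \<alpha> / Gamma (1 - \<alpha>) * (p - m) powr (- \<alpha>)"
proof (cases "m = p")
  case True
  then show ?thesis using assms by (simp add: kern_eq)
next
  case False
  then have m: "m < p" using assms by simp
  have "(1 - (m / p) powr (2 / \<alpha>)) powr (- \<alpha>) \<le> ((p - m) / p) powr (- \<alpha>)"
    using ratio_powr_bounds[OF assms(1,2) m] assms m alpha_pos by (intro powr_mono2') auto
  also have "\<dots> = p powr \<alpha> * (p - m) powr (- \<alpha>)"
    using assms m by (simp add: powr_divide powr_minus field_simps)
  finally show ?thesis
    using Gamma_pos assms by (simp add: kern_eq divide_right_mono)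
qed

lemma kern_integrable:
  assumes "0 \<le> y" "y \<le> p"
  shows "kern p integrable_on {y..p}"
proof (cases "p = 0")
  case False
  then have p: "0 < p" using assms by simp
  show ?thesis
  proof (rule integrable_on_Icc_bound[where g = "\<lambda>m. p powr \<alpha> / Gamma (1 - \<alpha>) * (p - m) powr (- \<alpha>)"])
    show "kern p \<in> borel_measurable borel"
      by (rule kern_measurable_compose[of "\<lambda>x. p" borel "\<lambda>x. x"]) auto
    show "(\<lambda>m. p powr \<alpha> / Gamma (1 - \<alpha>) * (p - m) powr (- \<alpha>)) integrable_on {y..p}"
      using has_integral_powr_right_end[of "-\<alpha>" y p] alpha_less_1 assms
      by (intro integrable_on_mult_right) auto
    show "\<bar>kern p m\<bar> \<le> p powr \<alpha> / Gamma (1 - \<alpha>) * (p - m) powr (- \<alpha>)" if "y \<le> m" "m \<le> p" for m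
      using kern_le[of p m] kern_nonneg[of p m] that assms p by simp
  qed
next
  case True
  with assms have "y = 0" by simp
  with True show ?thesis using integrable_on_refl[of "kern 0" 0] by simp
qed

text \<open>In the first argument the singularity is of the same order, with p^\<alpha> at most
  c^\<alpha>; at m = 0 the kernel is constant.\<close>

lemma kern_integrable_fst:
  assumes "0 \<le> m"
  shows "(\<lambda>p. kern p m) integrable_on {m..c}"
proof (cases "m = 0")
  case True
  then show ?thesis by (simp add: kern_0 integrable_continuous_real)
next
  case False
  then have m: "0 < m" using assms by simp
  show ?thesis
  proof (cases "m \<le> c")
    case True
    show ?thesis
    proof (rule integrable_on_Icc_bound[where g = "\<lambda>p. c powr \<alpha> / Gamma (1 - \<alpha>) * (p - m) powr (- \<alpha>)"])
      show "(\<lambda>p. kern p m) \<in> borel_measurable borel"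
        by (intro kern_measurable_compose) auto
      show "(\<lambda>p. c powr \<alpha> / Gamma (1 - \<alpha>) * (p - m) powr (- \<alpha>)) integrable_on {m..c}"
        using has_integral_powr_left_end[of "-\<alpha>" m c] alpha_less_1 True
        by (intro integrable_on_mult_right) auto
      show "\<bar>kern p m\<bar> \<le> c powr \<alpha> / Gamma (1 - \<alpha>) * (p - m) powr (- \<alpha>)" if "m \<le> p" "p \<le> c" for p
      proof -
        have "kern p m \<le> p powr \<alpha> / Gamma (1 - \<alpha>) * (p - m) powr (- \<alpha>)"
          using kern_le[of p m] that m by simp
        also have "\<dots> \<le> c powr \<alpha> / Gamma (1 - \<alpha>) * (p - m) powr (- \<alpha>)"
          using that m alpha_pos Gamma_pos
          by (intro mult_right_mono divide_right_mono powr_mono2) auto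
        finally show ?thesis using kern_nonneg by simp
      qed
    qed
  qed auto
qed

section \<open>The first kernel: bounds, homogeneity, continuity\<close>

lemma M1_has_integral:
  assumes "0 \<le> y" "y \<le> p"
  shows "(kern p has_integral M1 \<alpha> p y) {y..p}"
proof -
  let ?k = "\<lambda>\<mu>. (1 - p powr (- 2 / \<alpha>) * \<mu> powr (2 / \<alpha>)) powr (- \<alpha>)"
  have eq: "?k = (\<lambda>\<mu>. Gamma (1 - \<alpha>) * kern p \<mu>)"
    using Gamma_pos by (simp add: kern_def)
  have "?k integrable_on {y..p}"
    unfolding eq by (intro integrable_on_mult_right kern_integrable assms)
  then have "(LINT \<mu>:{y..p}|lebesgue. ?k \<mu>) = integral {y..p} ?k"
    by (rule set_integral_nonneg_eq_integral(2)) simp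
  also have "\<dots> = Gamma (1 - \<alpha>) * integral {y..p} (kern p)"
    unfolding eq by simp
  finally have "M1 \<alpha> p y = integral {y..p} (kern p)"
    using Gamma_pos by (simp add: M1_def)
  then show ?thesis using kern_integrable[OF assms] by (simp add: integrable_integral)
qed

lemma G_eq_M1: "G \<alpha> c y = M1 \<alpha> c y"
  by (simp add: G_def M1_def)

lemma M1_nonneg: "0 \<le> y \<Longrightarrow> y \<le> p \<Longrightarrow> 0 \<le> M1 \<alpha> p y"
  using has_integral_nonneg[OF M1_has_integral] kern_nonneg by blast

lemma M1_self: "0 \<le> p \<Longrightarrow> M1 \<alpha> p p = 0"
  using M1_has_integral[of p p] by (simp add: has_integral_unique[OF _ has_integral_refl(2)])

text \<open>Integrates \<open>kern_ge\<close>; the open interval avoids the diagonal, where the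
  pointwise bound fails.\<close>

lemma M1_ge:
  assumes "0 \<le> y" "y \<le> p"
  shows "(p - y) / Gamma (1 - \<alpha>) \<le> M1 \<alpha> p y"
proof (cases "y = p")
  case False
  then have "y < p" using assms by simp
  have c: "((\<lambda>x. 1 / Gamma (1 - \<alpha>)) has_integral ((p - y) / Gamma (1 - \<alpha>))) {y<..<p}"
    using has_integral_const_real[of "1 / Gamma (1 - \<alpha>)" y p] assms
    by (simp add: has_integral_Icc_iff_Ioo)
  have "(kern p has_integral M1 \<alpha> p y) {y<..<p}"
    using M1_has_integral[OF assms] by (simp add: has_integral_Icc_iff_Ioo)
  from has_integral_le[OF c this] show ?thesis
    using kern_ge assms by simp
qed (use assms M1_self in auto)

lemma M1_pos: "0 \<le> y \<Longrightarrow> y < p \<Longrightarrow> 0 < M1 \<alpha> p y"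
  using M1_ge[of y p] Gamma_pos by (smt (verit) divide_pos_pos)

text \<open>The kernel is homogeneous of degree 0, so substitution gives degree 1. For p > 0 this
  means M_1(p,y) = p M_1(1, y/p): a single function of one variable governs bounds and
  continuity.\<close>

lemma M1_scale:
  assumes "0 < l" "0 \<le> y" "y \<le> p"
  shows "M1 \<alpha> (l * p) (l * y) = l * M1 \<alpha> p y"
proof (cases "p = 0")
  case False
  then have p: "0 < p" using assms by simp
  have "(kern (l * p) has_integral M1 \<alpha> (l * p) (l * y)) (cbox (l * y) (l * p))"
    using M1_has_integral[of "l * y" "l * p"] assms by simp
  from has_integral_affinity[OF this, of l 0] assms
  have "((\<lambda>x. kern (l * p) (l * x)) has_integral (1 / l * M1 \<alpha> (l * p) (l * y)))
      ((\<lambda>x. (1 / l) * x) ` {l * y..l * p})"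
    by simp
  moreover have "(\<lambda>x. (1 / l) * x) ` {l * y..l * p} = {y..p}"
    using image_mult_atLeastAtMost[of "1 / l" "l * y" "l * p"] assms by simp
  ultimately have "((\<lambda>x. kern (l * p) (l * x)) has_integral (1 / l * M1 \<alpha> (l * p) (l * y))) {y..p}"
    by simp
  then have "(kern p has_integral (1 / l * M1 \<alpha> (l * p) (l * y))) {y..p}"
    by (rule has_integral_eq[rotated]) (use assms p in \<open>simp add: kern_scale\<close>)
  from has_integral_unique[OF this M1_has_integral] assms show ?thesis
    by (simp add: field_simps)
qed (use assms M1_self in auto)

lemma M1_le:
  assumes "0 \<le> y" "y \<le> p"
  shows "M1 \<alpha> p y \<le> p * M1 \<alpha> 1 0"
proof (cases "p = 0")
  case False
  then have p: "0 < p" using assms by simp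
  have "M1 \<alpha> p y \<le> M1 \<alpha> p 0"
    by (rule has_integral_subset_le[OF _ M1_has_integral M1_has_integral])
      (use assms kern_nonneg in auto)
  also have "\<dots> = p * M1 \<alpha> 1 0"
    using M1_scale[of p 0 1] p by simp
  finally show ?thesis .
qed (use assms M1_self in auto)

abbreviation W :: "(real \<times> real) set" where
  "W \<equiv> {(p, y). 0 \<le> y \<and> y \<le> p}"

text \<open>The singular diagonal rules out \<open>integral_moving_interval_continuous_on\<close>.
  For p > 0 homogeneity reduces the claim to the continuity of an indefinite integral; at the
  origin, where y / p has no limit, the bound M_1(p,y) \<le> p M_1(1,0) squeezes.\<close>

lemma M1_continuous_on: "continuous_on W (\<lambda>(p, y). M1 \<alpha> p y)"
proof -
  let ?K = "M1 \<alpha> 1 0"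
  have c1: "continuous_on {0..1} (M1 \<alpha> 1)"
  proof (rule continuous_on_eq)
    show "continuous_on {0..1} (\<lambda>x. integral {x..1} (kern 1))"
      by (intro indefinite_integral_continuous_1' kern_integrable) auto
    show "integral {x..1} (kern 1) = M1 \<alpha> 1 x" if "x \<in> {0..1}" for x
      using M1_has_integral[of x 1] that by (simp add: integral_unique)
  qed
  have "((\<lambda>(p, y). M1 \<alpha> p y) \<longlongrightarrow> M1 \<alpha> p y) (at (p, y) within W)" if "(p, y) \<in> W" for p y
  proof (cases "p = 0")
    case True
    have "((\<lambda>(p, y). M1 \<alpha> p y) \<longlongrightarrow> 0) (at (0, 0) within W)"
    proof (rule real_tendsto_sandwich[of "\<lambda>_. 0" _ _ "\<lambda>z. fst z * ?K"])
      show "\<forall>\<^sub>F z in at (0, 0) within W. 0 \<le> (case z of (p, y) \<Rightarrow> M1 \<alpha> p y)"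
        by (simp add: eventually_at_filter M1_nonneg case_prod_beta' always_eventually)
      show "\<forall>\<^sub>F z in at (0, 0) within W. (case z of (p, y) \<Rightarrow> M1 \<alpha> p y) \<le> fst z * ?K"
        by (simp add: eventually_at_filter M1_le case_prod_beta' always_eventually)
      have "((\<lambda>z. fst z * ?K) \<longlongrightarrow> fst (0::real, 0::real) * ?K) (at (0, 0) within W)"
        by (intro tendsto_intros)
      then show "((\<lambda>z. fst z * ?K) \<longlongrightarrow> 0) (at (0, 0) within W)" by simp
    qed auto
    with True that M1_self[of 0] show ?thesis by auto
  next
    case False
    let ?W = "{z. 0 \<le> snd z \<and> snd z \<le> fst z \<and> 0 < fst (z::real\<times>real)}"
    have p: "0 < p" using that False by auto
    have "continuous_on ?W (\<lambda>z. fst z * M1 \<alpha> 1 (snd z / fst z))"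
      by (intro continuous_intros continuous_on_compose2[OF c1]) auto
    then have "continuous_on ?W (\<lambda>(p, y). M1 \<alpha> p y)"
    proof (rule continuous_on_eq)
      show "fst z * M1 \<alpha> 1 (snd z / fst z) = (case z of (p, y) \<Rightarrow> M1 \<alpha> p y)" if "z \<in> ?W" for z
        using M1_scale[of "fst z" "snd z / fst z" 1] that by (auto simp: case_prod_beta')
    qed
    then have "((\<lambda>(p, y). M1 \<alpha> p y) \<longlongrightarrow> M1 \<alpha> p y) (at (p, y) within ?W)"
      using that p by (auto simp: continuous_on_def)
    moreover have "at (p, y) within ?W = at (p, y) within W"
    proof (rule at_within_nhd[of _ "{z. 0 < fst z}"])
      show "open {z :: real \<times> real. 0 < fst z}"
        by (intro open_Collect_less continuous_intros)
    qed (use p in auto)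
    ultimately show ?thesis by simp
  qed
  then show ?thesis by (auto simp: continuous_on_def)
qed

text \<open>The three clauses are proved together: continuity turns the Lebesgue integral of the
  recursion into a gauge integral, and in that form the recursion yields continuity and sign of the
  next kernel.\<close>

lemma M_regularity:
  "continuous_on W (\<lambda>(p, y). M \<alpha> (Suc n) p y) \<and>
   (\<forall>p y. 0 \<le> y \<longrightarrow> y \<le> p \<longrightarrow> 0 \<le> M \<alpha> (Suc n) p y) \<and>
   (\<forall>p y. 0 \<le> y \<longrightarrow> y \<le> p \<longrightarrow>
     M \<alpha> (Suc (Suc n)) p y = integral {y..p} (\<lambda>a. M1 \<alpha> a y * M \<alpha> (Suc n) p a))"
proof (induction n)
  have step: "M \<alpha> (Suc (Suc n)) p y = integral {y..p} (\<lambda>a. M1 \<alpha> a y * M \<alpha> (Suc n) p a)"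
    if "continuous_on W (\<lambda>(p, y). M \<alpha> (Suc n) p y)" "0 \<le> y" "y \<le> p" for n p y
  proof -
    have "continuous_on {y..p} (\<lambda>a. M1 \<alpha> a y * M \<alpha> (Suc n) p a)"
      by (intro continuous_intros continuous_on_W_fst continuous_on_W_snd M1_continuous_on that)
    from set_lebesgue_integral_eq_integral(2)[OF absolutely_integrable_continuous_real[OF this]]
    show ?thesis by simp
  qed
  {
    case 0
    show ?case using M1_continuous_on M1_nonneg step[of 0] by simp
  next
    case (Suc n)
    then have c: "continuous_on W (\<lambda>(p, y). M \<alpha> (Suc n) p y)" by blast
    have "continuous_on {(p, y, a). 0 \<le> y \<and> y \<le> a \<and> a \<le> p} (\<lambda>(p, y, a). M1 \<alpha> a y * M \<alpha> (Suc n) p a)"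
      unfolding case_prod_beta'
      by (intro continuous_on_mult continuous_on_W_compose[OF M1_continuous_on]
          continuous_on_W_compose[OF c] continuous_intros) auto
    from integral_moving_interval_continuous_on[OF this]
    have "continuous_on W (\<lambda>(p, y). M \<alpha> (Suc (Suc n)) p y)"
      by (rule continuous_on_eq) (use Suc in auto)
    moreover have "0 \<le> M \<alpha> (Suc (Suc n)) p y" if "0 \<le> y" "y \<le> p" for p y
    proof -
      have "0 \<le> integral {y..p} (\<lambda>a. M1 \<alpha> a y * M \<alpha> (Suc n) p a)"
      proof (rule integral_nonneg)
        show "(\<lambda>a. M1 \<alpha> a y * M \<alpha> (Suc n) p a) integrable_on {y..p}"
          by (intro integrable_continuous_real continuous_intros continuous_on_W_fst
              continuous_on_W_snd M1_continuous_on c that)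
        show "0 \<le> M1 \<alpha> a y * M \<alpha> (Suc n) p a" if "a \<in> {y..p}" for a
          using that \<open>0 \<le> y\<close> Suc.IH by (intro mult_nonneg_nonneg M1_nonneg) auto
      qed
      then show ?thesis using step[OF c that] by simp
    qed
    ultimately show ?case using step[of "Suc n"] by blast
  }
qed

lemmas M_continuous_on = M_regularity[THEN conjunct1]
  and M_nonneg = M_regularity[THEN conjunct2, THEN conjunct1, rule_format]
  and M_Suc = M_regularity[THEN conjunct2, THEN conjunct2, rule_format]

lemma M_pos: "0 \<le> y \<Longrightarrow> y < p \<Longrightarrow> 0 < M \<alpha> (Suc n) p y"
proof (induction n arbitrary: p y)
  case 0
  then show ?case by (simp add: M1_pos)
next
  case (Suc n)
  have "0 < integral {y..p} (\<lambda>a. M1 \<alpha> a y * M \<alpha> (Suc n) p a)"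
  proof (rule integral_pos_continuous[OF Suc.prems(2)])
    show "continuous_on {y..p} (\<lambda>a. M1 \<alpha> a y * M \<alpha> (Suc n) p a)"
      by (intro continuous_intros continuous_on_W_fst continuous_on_W_snd M1_continuous_on
          M_continuous_on Suc.prems)
    show "0 < M1 \<alpha> a y * M \<alpha> (Suc n) p a" if "y < a" "a < p" for a
      using that Suc by (intro mult_pos_pos M1_pos) auto
  qed
  then show ?case using Suc.prems M_Suc by simp
qed

text \<open>The Volterra estimate: M_1 is at most R M_1(1,0), and each further integration over
  [y,p] raises the power of p - y by one and divides by the new exponent, which produces the
  factorial.\<close>

lemma M_bound:
  assumes "0 \<le> y" "y \<le> p" "p \<le> R"
  shows "M \<alpha> (Suc n) p y \<le> (R * M1 \<alpha> 1 0) ^ Suc n * (p - y) ^ n / fact n"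
  using assms
proof (induction n arbitrary: y)
  let ?B = "R * M1 \<alpha> 1 0"
  have M1B: "M1 \<alpha> a y \<le> ?B" if "0 \<le> y" "y \<le> a" "a \<le> R" for a y
  proof -
    have "M1 \<alpha> a y \<le> a * M1 \<alpha> 1 0" using M1_le that by simp
    also have "\<dots> \<le> ?B" using that M1_nonneg[of 0 1] by (intro mult_right_mono) auto
    finally show ?thesis .
  qed
  {
    case 0
    then show ?case using M1B by simp
  next
    case (Suc n)
    have B: "0 \<le> ?B" using Suc.prems M1_nonneg[of 0 1] by simp
    have "((\<lambda>a. (p - a) powr real n) has_integral ((p - y) powr (real n + 1) / (real n + 1))) {y..p}"
      using has_integral_powr_right_end[of "real n" y p] Suc.prems by simp
    \<comment> \<open>At a = p and n = 0 the two powers differ, 0 powr 0 being 0 and 0 ^ 0 being 1;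
      the open interval avoids this point.\<close>
    then have "((\<lambda>a. (p - a) ^ n) has_integral ((p - y) powr (real n + 1) / (real n + 1))) {y<..<p}"
      unfolding has_integral_Icc_iff_Ioo
      by (rule has_integral_eq[rotated]) (simp add: powr_realpow)
    moreover have "(p - y) powr (real n + 1) = (p - y) ^ Suc n"
      using Suc.prems powr_realpow[of "p - y" "Suc n"]
      by (cases "y = p") (simp_all add: add.commute)
    ultimately have hi: "((\<lambda>a. (p - a) ^ n) has_integral ((p - y) ^ Suc n / (real n + 1))) {y..p}"
      by (simp add: has_integral_Icc_iff_Ioo)
    from has_integral_mult_right[OF this, of "?B * ?B ^ Suc n / fact n"]
    have hi': "((\<lambda>a. ?B * (?B ^ Suc n * (p - a) ^ n / fact n)) has_integral
        (?B ^ Suc (Suc n) * (p - y) ^ Suc n / fact (Suc n))) {y..p}"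
      by (simp add: field_simps)
    have ci: "(\<lambda>a. M1 \<alpha> a y * M \<alpha> (Suc n) p a) integrable_on {y..p}"
      by (intro integrable_continuous_real continuous_intros continuous_on_W_fst
          continuous_on_W_snd M1_continuous_on M_continuous_on Suc.prems)
    have "integral {y..p} (\<lambda>a. M1 \<alpha> a y * M \<alpha> (Suc n) p a)
        \<le> ?B ^ Suc (Suc n) * (p - y) ^ Suc n / fact (Suc n)"
    proof (rule has_integral_le[OF integrable_integral[OF ci] hi'])
      show "M1 \<alpha> a y * M \<alpha> (Suc n) p a \<le> ?B * (?B ^ Suc n * (p - a) ^ n / fact n)"
        if "a \<in> {y..p}" for a
        using that Suc M1B M_nonneg B by (intro mult_mono) auto
    qed
    then show ?case using M_Suc Suc.prems by simp
  }
qed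

text \<open>Associativity of the Volterra product: the recursion attaches the new factor M_1 at the
  lower argument y, here it sits at the upper argument p. The induction step is an exchange of
  integrals on a triangle. The second resolvent equation rests on this form.\<close>

lemma M_Suc_commuted:
  assumes "0 \<le> y" "y \<le> p"
  shows "M \<alpha> (Suc (Suc n)) p y = integral {y..p} (\<lambda>b. M1 \<alpha> p b * M \<alpha> (Suc n) b y)"
  using assms
proof (induction n arbitrary: y)
  case 0
  then show ?case using M_Suc[of y p 0] by (simp add: mult.commute)
next
  case (Suc n)
  let ?f = "\<lambda>b a. M1 \<alpha> a y * (M1 \<alpha> p b * M \<alpha> (Suc n) b a)"
  have I: "integral {y..b} (?f b) = M1 \<alpha> p b * M \<alpha> (Suc (Suc n)) b y" if "b \<in> {y..p}" for b
  proof -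
    have "integral {y..b} (?f b) = integral {y..b} (\<lambda>a. M1 \<alpha> p b * (M1 \<alpha> a y * M \<alpha> (Suc n) b a))"
      by (simp add: mult_ac)
    then show ?thesis using M_Suc[of y b n] that Suc.prems by simp
  qed
  have K: "integral {a..p} (\<lambda>b. ?f b a) = M1 \<alpha> a y * M \<alpha> (Suc (Suc n)) p a" if "a \<in> {y..p}" for a
    using Suc.IH[of a] that Suc.prems by simp
  have "((\<lambda>a. integral {a..p} (\<lambda>b. ?f b a)) has_integral
      integral {y..p} (\<lambda>b. integral {y..b} (?f b))) {y..p}"
  proof (rule triangle_swap_continuous)
    show "continuous_on {(b, a). y \<le> a \<and> a \<le> b \<and> b \<le> p} (\<lambda>(b, a). ?f b a)"
      unfolding case_prod_beta'
      by (intro continuous_on_mult continuous_on_W_compose[OF M1_continuous_on]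
          continuous_on_W_compose[OF M_continuous_on] continuous_intros) (use Suc.prems in auto)
    show "0 \<le> ?f b a" if "y \<le> a" "a \<le> b" "b \<le> p" for b a
      using that Suc.prems by (intro mult_nonneg_nonneg M1_nonneg M_nonneg) auto
    have "(\<lambda>b. M1 \<alpha> p b * M \<alpha> (Suc (Suc n)) b y) integrable_on {y..p}"
      by (intro integrable_continuous_real continuous_on_mult continuous_on_W_fst[OF M_continuous_on]
          continuous_on_W_snd[OF M1_continuous_on] Suc.prems)
    then show "(\<lambda>b. integral {y..b} (?f b)) integrable_on {y..p}"
      by (rule integrable_eq) (use I in auto)
  qed
  then have "integral {y..p} (\<lambda>a. integral {a..p} (\<lambda>b. ?f b a))
      = integral {y..p} (\<lambda>b. integral {y..b} (?f b))"
    by (rule integral_unique)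
  moreover have "integral {y..p} (\<lambda>a. integral {a..p} (\<lambda>b. ?f b a)) = M \<alpha> (Suc (Suc (Suc n))) p y"
    unfolding M_Suc[OF Suc.prems] by (rule integral_cong) (use K in auto)
  moreover have "integral {y..p} (\<lambda>b. integral {y..b} (?f b))
      = integral {y..p} (\<lambda>b. M1 \<alpha> p b * M \<alpha> (Suc (Suc n)) b y)"
    by (rule integral_cong) (use I in auto)
  ultimately show ?case by simp
qed

section \<open>The resolvent as the sum of the iterated kernels\<close>

lemma N_uniform_limit:
  assumes "0 < R"
  shows "uniform_limit {(p, y). 0 \<le> y \<and> y \<le> p \<and> p \<le> R}
    (\<lambda>k (p, y). \<Sum>i<k. M \<alpha> (Suc i) p y) (\<lambda>(p, y). N \<alpha> p y) sequentially"
proof -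
  let ?B = "R * M1 \<alpha> 1 0"
  have B: "0 \<le> ?B" using assms M1_nonneg[of 0 1] by simp
  let ?A = "{(p, y). 0 \<le> y \<and> y \<le> p \<and> p \<le> R}"
  \<comment> \<open>Weierstrass majorant: replacing p - y by R leaves the terms of an exponential
    series.\<close>
  have bd: "norm (M \<alpha> (Suc n) (fst z) (snd z)) \<le> ?B * ((?B * R) ^ n / fact n)" if z: "z \<in> ?A" for n z
  proof -
    obtain p y where z: "z = (p, y)" "0 \<le> y" "y \<le> p" "p \<le> R" using z by auto
    have "M \<alpha> (Suc n) p y \<le> ?B ^ Suc n * (p - y) ^ n / fact n"
      using M_bound z by blast
    also have "\<dots> \<le> ?B ^ Suc n * R ^ n / fact n"
      using z B by (intro divide_right_mono mult_left_mono power_mono) auto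
    also have "\<dots> = ?B * ((?B * R) ^ n / fact n)"
      by (simp add: power_mult_distrib)
    finally show ?thesis using M_nonneg z by simp
  qed
  have "summable (\<lambda>n. ?B * ((?B * R) ^ n / fact n))"
    using summable_exp_generic[of "?B * R"] by (intro summable_mult) (simp add: divide_inverse mult.commute)
  from Weierstrass_m_test[of ?A "\<lambda>n z. M \<alpha> (Suc n) (fst z) (snd z)", OF bd this] show ?thesis
    by (simp only: N_def case_prod_beta')
qed

lemma M_sums_N:
  assumes "0 \<le> y" "y \<le> p"
  shows "(\<lambda>n. M \<alpha> (Suc n) p y) sums N \<alpha> p y"
proof -
  have "(\<lambda>k. (\<lambda>(p, y). \<Sum>i<k. M \<alpha> (Suc i) p y) (p, y)) \<longlonglongrightarrow> (\<lambda>(p, y). N \<alpha> p y) (p, y)"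
    \<comment> \<open>The bound p + 1 is positive also for p = 0.\<close>
    by (rule tendsto_uniform_limitI[OF N_uniform_limit[of "p + 1"]]) (use assms in auto)
  then show ?thesis by (simp add: sums_def)
qed

lemma N_continuous_on: "continuous_on W (\<lambda>(p, y). N \<alpha> p y)"
proof -
  have "continuous_on {(p, y). 0 \<le> y \<and> y \<le> p \<and> p \<le> R} (\<lambda>(p, y). N \<alpha> p y)" if "0 < R" for R
  proof (rule uniform_limit_theorem[OF _ N_uniform_limit[OF that]])
    have "continuous_on {(p, y). 0 \<le> y \<and> y \<le> p \<and> p \<le> R} (\<lambda>(p, y). M \<alpha> (Suc i) p y)" for i
      by (rule continuous_on_subset[OF M_continuous_on]) auto
    then show "\<forall>\<^sub>F k in sequentially. continuous_on {(p, y). 0 \<le> y \<and> y \<le> p \<and> p \<le> R}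
        (\<lambda>(p, y). \<Sum>i<k. M \<alpha> (Suc i) p y)"
      unfolding case_prod_beta' by (intro always_eventually allI continuous_on_sum)
  qed simp
  note * = this
  have "((\<lambda>(p, y). N \<alpha> p y) \<longlongrightarrow> N \<alpha> p y) (at (p, y) within W)" if "(p, y) \<in> W" for p y
  proof -
    \<comment> \<open>The cut at p + 1 stays away from the point (p,y), so limits within the strip
      and within \<open>W\<close> agree.\<close>
    have "((\<lambda>(p, y). N \<alpha> p y) \<longlongrightarrow> N \<alpha> p y) (at (p, y) within {(q, y). 0 \<le> y \<and> y \<le> q \<and> q \<le> p + 1})"
      using *[of "p + 1"] that by (auto simp: continuous_on_def)
    moreover have "at (p, y) within {(q, y). 0 \<le> y \<and> y \<le> q \<and> q \<le> p + 1} = at (p, y) within W"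
    proof (rule at_within_nhd[of _ "{z. fst z < p + 1}"])
      show "open {z :: real \<times> real. fst z < p + 1}"
        by (intro open_Collect_less continuous_intros)
    qed auto
    ultimately show ?thesis by simp
  qed
  then show ?thesis by (auto simp: continuous_on_def)
qed

lemma N_nonneg: "0 \<le> y \<Longrightarrow> y \<le> p \<Longrightarrow> 0 \<le> N \<alpha> p y"
  using sums_le[OF _ sums_zero M_sums_N] M_nonneg by blast

lemma partial_sum_le_N:
  assumes "0 \<le> y" "y \<le> p"
  shows "(\<Sum>i<k. M \<alpha> (Suc i) p y) \<le> N \<alpha> p y"
  using sum_le_suminf[OF sums_summable[OF M_sums_N[OF assms]], of "{..<k}"] M_nonneg assms
    sums_unique[OF M_sums_N[OF assms]] by simp

lemma M1_le_N: "0 \<le> y \<Longrightarrow> y \<le> p \<Longrightarrow> M1 \<alpha> p y \<le> N \<alpha> p y"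
  using partial_sum_le_N[of y p 1] by simp

lemma N_pos: "0 \<le> y \<Longrightarrow> y < p \<Longrightarrow> 0 < N \<alpha> p y"
  using M1_le_N[of y p] M1_pos[of y p] by simp

lemma N_self: "0 \<le> p \<Longrightarrow> N \<alpha> p p = 0"
proof -
  assume p: "0 \<le> p"
  have "M \<alpha> (Suc n) p p = 0" for n
    using p M1_self M_Suc[of p p] by (cases n) auto
  then show ?thesis by (simp add: N_def)
qed

text \<open>Both equations are instances of N = M1 + M1 * N = M1 + N * M1 for the Volterra product.\<close>

lemma N_resolvent:
  assumes "0 \<le> y" "y \<le> c"
  shows "((\<lambda>a. M1 \<alpha> a y * N \<alpha> c a) has_integral (N \<alpha> c y - M1 \<alpha> c y)) {y..c}"
    and "((\<lambda>p. M1 \<alpha> c p * N \<alpha> p y) has_integral (N \<alpha> c y - M1 \<alpha> c y)) {y..c}"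
proof -
  \<comment> \<open>Termwise integration of a series of nonnegative terms against a nonnegative
    weight: the partial sums are dominated by w L. The two claims differ in the end at which the
    weight M_1 is attached.\<close>
  have general: "((\<lambda>a. w a * L a) has_integral (N \<alpha> c y - M1 \<alpha> c y)) {y..c}"
    if w: "continuous_on {y..c} w" "\<And>a. a \<in> {y..c} \<Longrightarrow> 0 \<le> w a"
      and L: "continuous_on {y..c} L" "\<And>n. continuous_on {y..c} (m n)"
      and m: "\<And>a n. a \<in> {y..c} \<Longrightarrow> 0 \<le> m n a" "\<And>a. a \<in> {y..c} \<Longrightarrow> (\<lambda>n. m n a) sums L a"
      and eq: "\<And>n. M \<alpha> (Suc (Suc n)) c y = integral {y..c} (\<lambda>a. w a * m n a)" for w L m
  proof -
    have i: "(\<lambda>a. w a * m n a) integrable_on {y..c}" for n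
      by (intro integrable_continuous_real continuous_intros w L)
    have "((\<lambda>a. w a * m n a) has_integral M \<alpha> (Suc (Suc n)) c y) {y..c}" for n
      unfolding eq by (intro integrable_integral i)
    then have hi: "((\<lambda>a. \<Sum>n<k. w a * m n a) has_integral (\<Sum>n<k. M \<alpha> (Suc (Suc n)) c y)) {y..c}" for k
      by (intro has_integral_sum) auto
    \<comment> \<open>The shifted series lacks its first term, which is M_1.\<close>
    have "(\<lambda>n. M \<alpha> (Suc (Suc n)) c y) sums (N \<alpha> c y - M1 \<alpha> c y)"
      using M_sums_N[OF assms] by (subst sums_Suc_iff) simp
    then have lim: "(\<lambda>k. \<Sum>n<k. M \<alpha> (Suc (Suc n)) c y) \<longlonglongrightarrow> N \<alpha> c y - M1 \<alpha> c y"
      by (simp add: sums_def)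
    have "(\<lambda>a. w a * L a) integrable_on {y..c}"
      by (intro integrable_continuous_real continuous_intros w L)
    from hi this _ _ lim show ?thesis
    proof (rule has_integral_dominated_convergence)
      show "\<forall>a\<in>{y..c}. norm (\<Sum>n<k. w a * m n a) \<le> w a * L a" for k
      proof
        fix a assume a: "a \<in> {y..c}"
        have "(\<Sum>n<k. m n a) \<le> L a"
          using sum_le_suminf[OF sums_summable[OF m(2)[OF a]], of "{..<k}"] m(1)[OF a]
            sums_unique[OF m(2)[OF a]] by simp
        moreover have "0 \<le> (\<Sum>n<k. m n a)" using m(1)[OF a] by (simp add: sum_nonneg)
        ultimately show "norm (\<Sum>n<k. w a * m n a) \<le> w a * L a"
          unfolding sum_distrib_left[symmetric] using w(2)[OF a]
          by (auto simp: abs_mult intro!: mult_left_mono)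
      qed
      show "\<forall>a\<in>{y..c}. (\<lambda>k. \<Sum>n<k. w a * m n a) \<longlonglongrightarrow> w a * L a"
        unfolding sum_distrib_left[symmetric] using m(2)[unfolded sums_def]
        by (intro ballI tendsto_mult_left)
    qed
  qed
  show "((\<lambda>a. M1 \<alpha> a y * N \<alpha> c a) has_integral (N \<alpha> c y - M1 \<alpha> c y)) {y..c}"
    by (rule general[of _ _ "\<lambda>n. M \<alpha> (Suc n) c"])
      (use assms in \<open>auto simp del: M.simps intro!: M_sums_N M_Suc M1_nonneg M_nonneg
        continuous_on_W_fst[OF M1_continuous_on] continuous_on_W_snd[OF M_continuous_on]
        continuous_on_W_snd[OF N_continuous_on]\<close>)
  show "((\<lambda>p. M1 \<alpha> c p * N \<alpha> p y) has_integral (N \<alpha> c y - M1 \<alpha> c y)) {y..c}"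
    by (rule general[of _ _ "\<lambda>n p. M \<alpha> (Suc n) p y"])
      (use assms in \<open>auto simp del: M.simps intro!: M_sums_N M_Suc_commuted M1_nonneg M_nonneg
        continuous_on_W_snd[OF M1_continuous_on] continuous_on_W_fst[OF M_continuous_on]
        continuous_on_W_fst[OF N_continuous_on]\<close>)
qed

section \<open>The representation by H and G, and the choice of the front constant\<close>

lemma H_eq:
  assumes "0 \<le> x" "x \<le> p"
  shows "H \<alpha> p x = 1 + integral {x..p} (N \<alpha> p)"
proof -
  have "continuous_on {x..p} (N \<alpha> p)"
    by (intro continuous_on_W_snd[OF N_continuous_on] assms)
  from set_lebesgue_integral_eq_integral(2)[OF absolutely_integrable_continuous_real[OF this]]
  show ?thesis by (simp add: H_def)
qed

lemma integral_N_moving_continuous_on: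
  "continuous_on W (\<lambda>(p, y). integral {y..p} (N \<alpha> p))"
proof (rule integral_moving_interval_continuous_on)
  show "continuous_on {(p, y, a). 0 \<le> y \<and> y \<le> a \<and> a \<le> p} (\<lambda>(p, y, a). N \<alpha> p a)"
    unfolding case_prod_beta'
    by (intro continuous_on_W_compose[OF N_continuous_on] continuous_intros) auto
qed

text \<open>G_c(p) = M_1(c,p) stands to the left of N(p,q), which is the order of factors in the
  second resolvent equation. After the exchange of integrals its right side N - M_1 appears, and the
  summand 1 of H supplies the missing integral of M_1.\<close>

lemma integral_H_G:
  assumes "0 \<le> y" "y \<le> c"
  shows "(LINT p:{y..c}|lebesgue. H \<alpha> p y * G \<alpha> c p) = integral {y..c} (N \<alpha> c)"
proof -
  let ?f = "\<lambda>p q. M1 \<alpha> c p * N \<alpha> p q"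
  have "((\<lambda>q. integral {q..c} (\<lambda>p. ?f p q)) has_integral
      integral {y..c} (\<lambda>p. integral {y..p} (?f p))) {y..c}"
  proof (rule triangle_swap_continuous)
    show "continuous_on {(p, q). y \<le> q \<and> q \<le> p \<and> p \<le> c} (\<lambda>(p, q). ?f p q)"
      unfolding case_prod_beta'
      by (intro continuous_on_mult continuous_on_W_compose[OF M1_continuous_on]
          continuous_on_W_compose[OF N_continuous_on] continuous_intros) (use assms in auto)
    show "0 \<le> ?f p q" if "y \<le> q" "q \<le> p" "p \<le> c" for p q
      using that assms by (intro mult_nonneg_nonneg M1_nonneg N_nonneg) auto
    show "(\<lambda>p. integral {y..p} (?f p)) integrable_on {y..c}"
      unfolding integral_mult_right
      by (intro integrable_continuous_real continuous_on_mult assms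
          continuous_on_W_snd[OF M1_continuous_on] continuous_on_W_fst[OF integral_N_moving_continuous_on])
  qed
  then have "((\<lambda>q. N \<alpha> c q - M1 \<alpha> c q) has_integral
      integral {y..c} (\<lambda>p. integral {y..p} (?f p))) {y..c}"
    by (rule has_integral_eq[rotated]) (use assms N_resolvent(2) in \<open>auto simp: integral_unique\<close>)
  moreover have Ni: "N \<alpha> c integrable_on {y..c}" and Mi: "M1 \<alpha> c integrable_on {y..c}"
    by (intro integrable_continuous_real continuous_on_W_snd[OF N_continuous_on]
        continuous_on_W_snd[OF M1_continuous_on] assms)+
  ultimately have *: "integral {y..c} (N \<alpha> c) =
      integral {y..c} (M1 \<alpha> c) + integral {y..c} (\<lambda>p. integral {y..p} (?f p))"
    using integral_diff[OF Ni Mi] by (simp add: has_integral_iff)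
  have cH: "continuous_on {y..c} (\<lambda>p. M1 \<alpha> c p + M1 \<alpha> c p * integral {y..p} (N \<alpha> p))"
    by (intro continuous_intros assms continuous_on_W_snd[OF M1_continuous_on]
        continuous_on_W_fst[OF integral_N_moving_continuous_on])
  have "(LINT p:{y..c}|lebesgue. H \<alpha> p y * G \<alpha> c p)
      = (LINT p:{y..c}|lebesgue. M1 \<alpha> c p + M1 \<alpha> c p * integral {y..p} (N \<alpha> p))"
    by (rule set_lebesgue_integral_cong)
      (use assms in \<open>auto simp: H_eq G_eq_M1 algebra_simps\<close>)
  also have "\<dots> = integral {y..c} (\<lambda>p. M1 \<alpha> c p + M1 \<alpha> c p * integral {y..p} (N \<alpha> p))"
    by (rule set_lebesgue_integral_eq_integral(2)[OF absolutely_integrable_continuous_real[OF cH]])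
  also have "\<dots> = integral {y..c} (M1 \<alpha> c) + integral {y..c} (\<lambda>p. M1 \<alpha> c p * integral {y..p} (N \<alpha> p))"
    by (intro integral_add Mi integrable_continuous_real continuous_intros assms
        continuous_on_W_snd[OF M1_continuous_on] continuous_on_W_fst[OF integral_N_moving_continuous_on])
  also have "\<dots> = integral {y..c} (N \<alpha> c)"
    using * by simp
  finally show ?thesis .
qed

lemma ex_front_constant:
  assumes "0 < \<gamma>"
  shows "\<exists>c>0. integral {0..c} (N \<alpha> c) = \<gamma>"
proof -
  let ?\<Psi> = "\<lambda>c. integral {0..c} (N \<alpha> c)"
  \<comment> \<open>Chosen with C^2 / (2 Gamma(1-\<alpha>)) = \<gamma>, so that the lower bound (C -
    q) / Gamma(1-\<alpha>) of N(C,q) integrates to \<gamma>.\<close>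
  define C where "C = sqrt (2 * \<gamma> * Gamma (1 - \<alpha>))"
  have C0: "0 \<le> C" using assms Gamma_pos by (simp add: C_def)
  have "((\<lambda>q. (C - q) / Gamma (1 - \<alpha>)) has_integral \<gamma>) {0..C}"
  proof -
    have "((\<lambda>q. (C - q) powr 1) has_integral ((C - 0) powr (1 + 1) / (1 + 1))) {0..C}"
      using C0 by (intro has_integral_powr_right_end) auto
    then have "((\<lambda>q. C - q) has_integral (C ^ 2 / 2)) {0..C}"
      using C0 by (auto elim!: has_integral_eq[rotated])
    from has_integral_divide[OF this, of "Gamma (1 - \<alpha>)"] show ?thesis
      using Gamma_pos assms by (simp add: C_def)
  qed
  moreover have "(N \<alpha> C has_integral ?\<Psi> C) {0..C}"
    by (intro integrable_integral integrable_continuous_real continuous_on_W_snd[OF N_continuous_on]) simp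
  moreover have "(C - q) / Gamma (1 - \<alpha>) \<le> N \<alpha> C q" if "q \<in> {0..C}" for q
    using M1_ge[of q C] M1_le_N[of q C] that by simp
  ultimately have "\<gamma> \<le> ?\<Psi> C" by (rule has_integral_le)
  moreover have "?\<Psi> 0 \<le> \<gamma>" using assms by simp
  moreover have "continuous_on {0..C} ?\<Psi>"
    by (rule continuous_on_W_fst[OF integral_N_moving_continuous_on]) simp
  ultimately obtain c where "0 \<le> c" "?\<Psi> c = \<gamma>"
    using IVT'[of ?\<Psi> 0 \<gamma> C] C0 by blast
  \<comment> \<open>Over the degenerate interval the integral is 0, which is below \<gamma>.\<close>
  moreover from this assms have "c \<noteq> 0" by auto
  ultimately show ?thesis by (intro exI[of _ c]) simp
qed

section \<open>Similarity variables and Abel integrals\<close>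

text \<open>\<open>(z / p) powr (2 / \<alpha>)\<close> is the time at which the curve x = p
  t^(\<alpha>/2) reaches z. The three forms translate between time, position and similarity
  variable.\<close>

lemma powr_time_le_iff:
  assumes "0 < z" "0 < p" "0 < \<tau>"
  shows "(z / p) powr (2 / \<alpha>) \<le> \<tau> \<longleftrightarrow> z \<le> p * \<tau> powr (\<alpha> / 2)"
    and "(z / p) powr (2 / \<alpha>) \<le> \<tau> \<longleftrightarrow> z * \<tau> powr (- \<alpha> / 2) \<le> p"
    and "(z / p) powr (2 / \<alpha>) < \<tau> \<longleftrightarrow> z < p * \<tau> powr (\<alpha> / 2)"
proof -
  have \<tau>: "\<tau> = (\<tau> powr (\<alpha> / 2)) powr (2 / \<alpha>)"
    using assms alpha_pos by (simp add: powr_powr)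
  have inv: "\<tau> powr (- \<alpha> / 2) = 1 / \<tau> powr (\<alpha> / 2)"
    using assms by (simp add: powr_minus_divide)
  have mono: "u powr (2 / \<alpha>) \<le> w powr (2 / \<alpha>) \<longleftrightarrow> u \<le> w" if "0 \<le> u" "0 \<le> w" for u w :: real
    using that alpha_pos powr_mono2[of "2 / \<alpha>" u w] powr_less_mono2[of "2 / \<alpha>" w u]
    by (cases "u \<le> w") auto
  have "(z / p) powr (2 / \<alpha>) \<le> (\<tau> powr (\<alpha> / 2)) powr (2 / \<alpha>) \<longleftrightarrow> z / p \<le> \<tau> powr (\<alpha> / 2)"
    using assms by (intro mono) auto
  then have *: "(z / p) powr (2 / \<alpha>) \<le> \<tau> \<longleftrightarrow> z / p \<le> \<tau> powr (\<alpha> / 2)"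
    using \<tau> by simp
  then show "(z / p) powr (2 / \<alpha>) \<le> \<tau> \<longleftrightarrow> z \<le> p * \<tau> powr (\<alpha> / 2)"
    using assms by (simp add: field_simps)
  then show "(z / p) powr (2 / \<alpha>) \<le> \<tau> \<longleftrightarrow> z * \<tau> powr (- \<alpha> / 2) \<le> p"
    using assms unfolding inv by (simp add: field_simps)
  have "(z / p) powr (2 / \<alpha>) < (\<tau> powr (\<alpha> / 2)) powr (2 / \<alpha>) \<longleftrightarrow> z / p < \<tau> powr (\<alpha> / 2)"
    using mono[of "\<tau> powr (\<alpha> / 2)" "z / p"] assms by (simp add: not_le[symmetric])
  then have "(z / p) powr (2 / \<alpha>) < \<tau> \<longleftrightarrow> z / p < \<tau> powr (\<alpha> / 2)"
    using \<tau> by simp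
  then show "(z / p) powr (2 / \<alpha>) < \<tau> \<longleftrightarrow> z < p * \<tau> powr (\<alpha> / 2)"
    using assms by (simp add: field_simps)
qed

lemma similarity_inverse:
  assumes "0 < z" "0 < p"
  shows "z * ((z / p) powr (2 / \<alpha>)) powr (- \<alpha> / 2) = p"
proof -
  have "((z / p) powr (2 / \<alpha>)) powr (- \<alpha> / 2) = p / z"
    using assms alpha_pos by (simp add: powr_powr powr_minus_divide)
  then show ?thesis using assms by simp
qed

text \<open>Change to the similarity variable y = x \<tau>^(-\<alpha>/2), whose speed is the weight
  in \<open>w\<close>. It decreases in time, so \<open>a\<close> goes to the upper end. Absolute
  integrability is transported as well, as an unbounded \<open>f\<close> such as the curvature
  requires.\<close>

lemma similarity_substitution:
  assumes "0 < x" "0 < a" "a \<le> b"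
    and f: "f absolutely_integrable_on {x * b powr (- \<alpha> / 2)..x * a powr (- \<alpha> / 2)}"
  defines "w \<equiv> \<lambda>\<tau>. \<alpha> / 2 * x * \<tau> powr (- \<alpha> / 2 - 1) * f (x * \<tau> powr (- \<alpha> / 2))"
  shows "w absolutely_integrable_on {a..b}"
    and "integral {a..b} w = integral {x * b powr (- \<alpha> / 2)..x * a powr (- \<alpha> / 2)} f"
proof -
  let ?g = "\<lambda>\<tau>. x * \<tau> powr (- \<alpha> / 2)"
  let ?g' = "\<lambda>\<tau>. - (\<alpha> / 2 * x * \<tau> powr (- \<alpha> / 2 - 1))"
  have der: "(?g has_field_derivative ?g' \<tau>) (at \<tau> within {a..b})" if "\<tau> \<in> {a..b}" for \<tau>
    using that assms by (auto intro!: derivative_eq_intros simp: field_simps)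
  have anti: "?g \<sigma> < ?g \<tau>" if "a \<le> \<tau>" "\<tau> < \<sigma>" for \<tau> \<sigma>
    using that assms alpha_pos by (intro mult_strict_left_mono powr_less_mono2_neg) auto
  have inj: "inj_on ?g {a..b}"
    by (rule linorder_inj_onI) (use anti in force)+
  have img: "?g ` {a..b} = {x * b powr (- \<alpha> / 2)..x * a powr (- \<alpha> / 2)}"
  proof (intro equalityI subsetI)
    fix y assume "y \<in> ?g ` {a..b}"
    then obtain \<tau> where "\<tau> \<in> {a..b}" "y = ?g \<tau>" by blast
    then show "y \<in> {x * b powr (- \<alpha> / 2)..x * a powr (- \<alpha> / 2)}"
      using anti[of a \<tau>] anti[of \<tau> b] by (cases "\<tau> = a"; cases "\<tau> = b") auto
  next
    fix y assume y: "y \<in> {x * b powr (- \<alpha> / 2)..x * a powr (- \<alpha> / 2)}"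
    have "0 < x * b powr (- \<alpha> / 2)" using assms by simp
    then have "0 < y" using y by auto
    \<comment> \<open>Inverse of the substitution: the time at which the similarity variable equals
      y.\<close>
    let ?\<tau> = "(x / y) powr (2 / \<alpha>)"
    have "0 < ?\<tau>" using \<open>0 < y\<close> assms by simp
    have y_eq: "?g ?\<tau> = y" using similarity_inverse assms \<open>0 < y\<close> by simp
    have "?\<tau> \<le> b"
      using powr_time_le_iff(2)[of x y b] y \<open>0 < y\<close> assms by simp
    moreover have "a \<le> ?\<tau>"
    proof (rule ccontr)
      assume "\<not> a \<le> ?\<tau>"
      then have "?g a < ?g ?\<tau>"
        using assms alpha_pos \<open>0 < ?\<tau>\<close> by (intro mult_strict_left_mono powr_less_mono2_neg) auto
      with y_eq y show False by simp
    qed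
    ultimately show "y \<in> ?g ` {a..b}" using y_eq by force
  qed
  have w: "w = (\<lambda>\<tau>. \<bar>?g' \<tau>\<bar> * f (?g \<tau>))"
    unfolding w_def using assms alpha_pos by (simp add: abs_mult)
  have "w absolutely_integrable_on {a..b} \<and> integral {a..b} w = integral (?g ` {a..b}) f"
    unfolding w by (subst has_absolute_integral_change_of_variables_1'[OF _ der inj])
      (use f img in auto)
  then show "w absolutely_integrable_on {a..b}"
    "integral {a..b} w = integral {x * b powr (- \<alpha> / 2)..x * a powr (- \<alpha> / 2)} f"
    using img by auto
qed

text \<open>In the position z = y \<tau>^(\<alpha>/2) the kernel becomes, up to a power of \<tau>,
  the power (\<tau> - \<sigma>(z))^(-\<alpha>) of the time elapsed since the arrival \<sigma>(z) =
  (z/p)^(2/\<alpha>). This form suits fractional integration in \<tau>.\<close>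

lemma M1_in_time:
  assumes "0 < p" "0 < a" "0 < \<tau>" "a \<le> p * \<tau> powr (\<alpha> / 2)"
  shows "((\<lambda>z. (\<tau> - (z / p) powr (2 / \<alpha>)) powr (- \<alpha>)) has_integral
    (Gamma (1 - \<alpha>) * \<tau> powr (- \<alpha> / 2) * M1 \<alpha> p (a * \<tau> powr (- \<alpha> / 2)))) {a..p * \<tau> powr (\<alpha> / 2)}"
proof -
  let ?r = "\<tau> powr (- \<alpha> / 2)"
  have r: "0 < ?r" "1 / ?r = \<tau> powr (\<alpha> / 2)"
    using assms by (auto simp: powr_minus_divide)
  have ap: "a * ?r \<le> p"
    using powr_time_le_iff(1,2)[of a p \<tau>] assms by simp
  have rr: "?r * \<tau> powr (\<alpha> / 2) = 1" using assms by (simp add: powr_add[symmetric])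
  then have ends: "?r * (p * \<tau> powr (\<alpha> / 2)) = p" by (simp add: mult_ac)
  have "(kern p has_integral M1 \<alpha> p (a * ?r)) {?r * a..?r * (p * \<tau> powr (\<alpha> / 2))}"
    unfolding ends using M1_has_integral[of "a * ?r" p] ap r assms by (simp add: mult.commute)
  from has_integral_scale[OF this r(1)]
  have "((\<lambda>z. kern p (?r * z)) has_integral (\<tau> powr (\<alpha> / 2) * M1 \<alpha> p (a * ?r)))
      {a..p * \<tau> powr (\<alpha> / 2)}"
    using r(2) by (metis (no_types, lifting) mult.commute times_divide_eq_right mult_1_right)
  from has_integral_mult_right[OF this, of "Gamma (1 - \<alpha>) * \<tau> powr (- \<alpha>)"]
  have "((\<lambda>z. Gamma (1 - \<alpha>) * \<tau> powr (- \<alpha>) * kern p (?r * z)) has_integral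
      (Gamma (1 - \<alpha>) * (\<tau> powr (- \<alpha>) * \<tau> powr (\<alpha> / 2)) * M1 \<alpha> p (a * ?r))) {a..p * \<tau> powr (\<alpha> / 2)}"
    by (simp add: mult_ac)
  also have "\<tau> powr (- \<alpha>) * \<tau> powr (\<alpha> / 2) = ?r"
    using assms by (simp add: powr_add[symmetric])
  finally show ?thesis
  proof (rule has_integral_eq[rotated])
    fix z assume z: "z \<in> {a..p * \<tau> powr (\<alpha> / 2)}"
    have zp: "(z / p) powr (2 / \<alpha>) \<le> \<tau>"
      using powr_time_le_iff(1)[of z p \<tau>] z assms by auto
    have "(?r * z / p) powr (2 / \<alpha>) = ?r powr (2 / \<alpha>) * (z / p) powr (2 / \<alpha>)"
      using z assms by (simp add: powr_mult[symmetric])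
    also have "?r powr (2 / \<alpha>) = 1 / \<tau>"
      unfolding powr_powr using assms alpha_pos by (simp add: powr_minus_divide)
    finally have e: "1 - (?r * z / p) powr (2 / \<alpha>) = (\<tau> - (z / p) powr (2 / \<alpha>)) / \<tau>"
      using assms by (simp add: field_simps)
    have "Gamma (1 - \<alpha>) * kern p (?r * z) = ((\<tau> - (z / p) powr (2 / \<alpha>)) / \<tau>) powr (- \<alpha>)"
    proof -
      have "0 \<le> ?r * z" using z assms by simp
      from kern_eq[OF assms(1) this] show ?thesis unfolding e using Gamma_pos by simp
    qed
    also have "\<dots> = (\<tau> - (z / p) powr (2 / \<alpha>)) powr (- \<alpha>) / \<tau> powr (- \<alpha>)"
      using zp assms by (simp add: powr_divide)
    finally show "Gamma (1 - \<alpha>) * \<tau> powr (- \<alpha>) * kern p (?r * z) = (\<tau> - (z / p) powr (2 / \<alpha>)) powr (- \<alpha>)"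
      using assms by (simp add: field_simps)
  qed
qed

text \<open>The exponents sum to -1, so the length t - \<sigma> cancels and every interval gives the
  same value B(1-\<alpha>,\<alpha>).\<close>

lemma has_integral_Beta_interval:
  assumes "\<sigma> < t"
  shows "((\<lambda>\<tau>. (t - \<tau>) powr (\<alpha> - 1) * (\<tau> - \<sigma>) powr (- \<alpha>)) has_integral
    (Gamma \<alpha> * Gamma (1 - \<alpha>))) {\<sigma>..t}"
proof -
  let ?d = "t - \<sigma>"
  have "((\<lambda>x. x powr ((1 - \<alpha>) - 1) * (1 - x) powr (\<alpha> - 1)) has_integral Beta (1 - \<alpha>) \<alpha>) (cbox 0 1)"
    using has_integral_Beta_real[of "1 - \<alpha>" \<alpha>] alpha_pos alpha_less_1 by simp
  from has_integral_affinity[OF this, of "1 / ?d" "- \<sigma> / ?d"] assms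
  have "((\<lambda>\<tau>. (\<tau> / ?d - \<sigma> / ?d) powr (- \<alpha>) * (1 - (\<tau> / ?d - \<sigma> / ?d)) powr (\<alpha> - 1)) has_integral
      (?d * Beta (1 - \<alpha>) \<alpha>)) ((\<lambda>x. ?d * x + \<sigma>) ` {0..1})"
    by (simp add: mult.commute)
  moreover have "(\<lambda>x. ?d * x + \<sigma>) ` {0..1} = {\<sigma>..t}"
    using image_affinity_atLeastAtMost[of ?d \<sigma> 0 1] assms by simp
  ultimately have "((\<lambda>\<tau>. (\<tau> / ?d - \<sigma> / ?d) powr (- \<alpha>) * (1 - (\<tau> / ?d - \<sigma> / ?d)) powr (\<alpha> - 1)) has_integral
      (?d * Beta (1 - \<alpha>) \<alpha>)) {\<sigma>..t}"
    by simp
  then have "((\<lambda>\<tau>. ?d powr 1 * ((t - \<tau>) powr (\<alpha> - 1) * (\<tau> - \<sigma>) powr (- \<alpha>))) has_integral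
      (?d * Beta (1 - \<alpha>) \<alpha>)) {\<sigma>..t}"
  proof (rule has_integral_eq[rotated])
    fix \<tau> assume \<tau>: "\<tau> \<in> {\<sigma>..t}"
    have e: "\<tau> / ?d - \<sigma> / ?d = (\<tau> - \<sigma>) / ?d" "1 - (\<tau> - \<sigma>) / ?d = (t - \<tau>) / ?d"
      using assms by (simp_all add: divide_simps)
    have "((\<tau> - \<sigma>) / ?d) powr (- \<alpha>) * ((t - \<tau>) / ?d) powr (\<alpha> - 1)
        = (t - \<tau>) powr (\<alpha> - 1) * (\<tau> - \<sigma>) powr (- \<alpha>) / (?d powr (- \<alpha>) * ?d powr (\<alpha> - 1))"
      using \<tau> assms by (simp add: powr_divide)
    also have "?d powr (- \<alpha>) * ?d powr (\<alpha> - 1) = 1 / ?d powr 1"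
      using assms by (simp add: powr_add[symmetric] powr_minus_divide[symmetric])
    finally show "(\<tau> / ?d - \<sigma> / ?d) powr (- \<alpha>) * (1 - (\<tau> / ?d - \<sigma> / ?d)) powr (\<alpha> - 1)
        = ?d powr 1 * ((t - \<tau>) powr (\<alpha> - 1) * (\<tau> - \<sigma>) powr (- \<alpha>))"
      unfolding e by (simp add: mult_ac)
  qed
  from has_integral_mult_right[OF this, of "1 / ?d"] assms show ?thesis
    by (simp add: Beta_def mult.commute)
qed

text \<open>The Riemann-Liouville integral of order \<open>\<alpha>\<close> of the rescaled kernel is affine in the
  position: after \<open>M1_in_time\<close> the two powers combine to a Beta integral.\<close>

lemma abel_integral_M1:
  assumes "0 < p" "0 < a" "0 < t" "a \<le> p * t powr (\<alpha> / 2)"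
  shows "((\<lambda>\<tau>. (t - \<tau>) powr (\<alpha> - 1) * (\<tau> powr (- \<alpha> / 2) * M1 \<alpha> p (a * \<tau> powr (- \<alpha> / 2))))
    has_integral (Gamma \<alpha> * (p * t powr (\<alpha> / 2) - a))) {(a / p) powr (2 / \<alpha>)..t}"
proof -
  let ?\<sigma> = "\<lambda>z. (z / p) powr (2 / \<alpha>)"
  let ?GG = "Gamma \<alpha> * Gamma (1 - \<alpha>)"
  \<comment> \<open>Integrated in \<tau> this gives a Beta constant for each z, integrated in z it
    gives the rescaled M_1; comparing both orders proves the claim.\<close>
  define f where "f z \<tau> = (if a \<le> z \<and> ?\<sigma> z \<le> \<tau> \<and> \<tau> \<le> t
    then (t - \<tau>) powr (\<alpha> - 1) * (\<tau> - ?\<sigma> z) powr (- \<alpha>) else 0)" for z \<tau>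
  \<comment> \<open>The right end is excluded: there the time interval shrinks to the point t and
    the integral is 0, not the Beta value.\<close>
  define I where "I z = (if z \<in> {a..<p * t powr (\<alpha> / 2)} then ?GG else 0)" for z
  define K where "K \<tau> = (if \<tau> \<in> {?\<sigma> a..t} then (t - \<tau>) powr (\<alpha> - 1) *
    (Gamma (1 - \<alpha>) * \<tau> powr (- \<alpha> / 2) * M1 \<alpha> p (a * \<tau> powr (- \<alpha> / 2))) else 0)" for \<tau>
  have "(K has_integral ?GG * (p * t powr (\<alpha> / 2) - a)) UNIV"
  proof (rule tonelli_has_integral[of f I])
    show "(\<lambda>z. f (fst z) (snd z)) \<in> borel_measurable borel"
      unfolding f_def borel_prod[symmetric] by measurable
    show "0 \<le> f x y" for x y by (simp add: f_def)
    show "(f z has_integral I z) UNIV" for z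
    proof (cases "a \<le> z \<and> z < p * t powr (\<alpha> / 2)")
      case True
      then have "?\<sigma> z < t" using powr_time_le_iff(3)[of z p t] assms by simp
      from has_integral_Beta_interval[OF this] True
      have "((\<lambda>\<tau>. if \<tau> \<in> {?\<sigma> z..t} then (t - \<tau>) powr (\<alpha> - 1) * (\<tau> - ?\<sigma> z) powr (- \<alpha>) else 0)
          has_integral I z) UNIV"
        by (subst has_integral_restrict_UNIV) (simp add: I_def)
      moreover have "f z = (\<lambda>\<tau>. if \<tau> \<in> {?\<sigma> z..t} then (t - \<tau>) powr (\<alpha> - 1) * (\<tau> - ?\<sigma> z) powr (- \<alpha>) else 0)"
        using True by (auto simp: f_def fun_eq_iff)
      ultimately show ?thesis by simp
    next
      case False
      have "f z \<tau> = 0" for \<tau>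
      proof (cases "a \<le> z \<and> ?\<sigma> z \<le> \<tau> \<and> \<tau> \<le> t")
        case True
        then have "\<not> ?\<sigma> z < t" using powr_time_le_iff(3)[of z p t] assms False by auto
        with True have "\<tau> = t" "\<tau> = ?\<sigma> z" by linarith+
        then show ?thesis by (simp add: f_def)
      qed (auto simp: f_def)
      then have "f z = (\<lambda>_. 0)" by auto
      then show ?thesis using False by (auto simp: I_def)
    qed
    show "((\<lambda>z. f z \<tau>) has_integral K \<tau>) UNIV" for \<tau>
    proof (cases "?\<sigma> a \<le> \<tau> \<and> \<tau> \<le> t")
      case True
      have "0 < ?\<sigma> a" using assms by simp
      then have \<tau>: "0 < \<tau>" using True by linarith
      then have "a \<le> p * \<tau> powr (\<alpha> / 2)" using powr_time_le_iff(1)[of a p \<tau>] assms True by simp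
      from has_integral_mult_right[OF M1_in_time[OF assms(1,2) \<tau> this], of "(t - \<tau>) powr (\<alpha> - 1)"]
      have "((\<lambda>z. if z \<in> {a..p * \<tau> powr (\<alpha> / 2)} then (t - \<tau>) powr (\<alpha> - 1) *
          (\<tau> - ?\<sigma> z) powr (- \<alpha>) else 0) has_integral K \<tau>) UNIV"
        using True by (subst has_integral_restrict_UNIV) (simp add: K_def)
      moreover have "(\<lambda>z. f z \<tau>) = (\<lambda>z. if z \<in> {a..p * \<tau> powr (\<alpha> / 2)} then (t - \<tau>) powr (\<alpha> - 1) *
          (\<tau> - ?\<sigma> z) powr (- \<alpha>) else 0)"
      proof
        show "f z \<tau> = (if z \<in> {a..p * \<tau> powr (\<alpha> / 2)} then (t - \<tau>) powr (\<alpha> - 1) *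
          (\<tau> - ?\<sigma> z) powr (- \<alpha>) else 0)" for z
          using powr_time_le_iff(1)[of z p \<tau>] assms True \<tau> by (auto simp: f_def)
      qed
      ultimately show ?thesis by simp
    next
      case False
      have "f z \<tau> = 0" for z
      proof (cases "a \<le> z")
        case True
        then have "?\<sigma> a \<le> ?\<sigma> z"
          using assms alpha_pos by (intro powr_mono2 divide_right_mono) auto
        with False show ?thesis by (auto simp: f_def)
      qed (simp add: f_def)
      then show ?thesis using False by (auto simp: K_def)
    qed
    have "((\<lambda>z. ?GG) has_integral ?GG * (p * t powr (\<alpha> / 2) - a)) {a..p * t powr (\<alpha> / 2)}"
      using has_integral_const_real[of ?GG a "p * t powr (\<alpha> / 2)"] assms by (simp add: mult.commute)
    then have "(I has_integral ?GG * (p * t powr (\<alpha> / 2) - a)) {a..p * t powr (\<alpha> / 2)}"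
      by (rule has_integral_spike_finite[of "{p * t powr (\<alpha> / 2)}", rotated 2]) (auto simp: I_def)
    then show "(I has_integral ?GG * (p * t powr (\<alpha> / 2) - a)) UNIV"
      by (rule has_integral_on_superset) (auto simp: I_def)
  qed
  then have "((\<lambda>\<tau>. (t - \<tau>) powr (\<alpha> - 1) *
      (Gamma (1 - \<alpha>) * \<tau> powr (- \<alpha> / 2) * M1 \<alpha> p (a * \<tau> powr (- \<alpha> / 2))))
      has_integral ?GG * (p * t powr (\<alpha> / 2) - a)) {?\<sigma> a..t}"
    unfolding K_def by (simp only: has_integral_restrict_UNIV)
  from has_integral_mult_right[OF this, of "1 / Gamma (1 - \<alpha>)"] Gamma_pos show ?thesis
    by (simp add: mult_ac)
qed

end

section \<open>The similarity profile\<close>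

locale front_profile = fractional_order +
  fixes c :: real
  assumes c_pos: "0 < c"
begin

text \<open>The negative slope of the profile, extended to the whole line so that it remains continuous.\<close>

definition slope :: "real \<Rightarrow> real" where
  "slope y = N \<alpha> c (max 0 (min c y))"

definition profile :: "real \<Rightarrow> real" where
  "profile y = integral {y..c} slope"

text \<open>Up to the factor t^(-\<alpha>), the Caputo derivative of the temperature at the
  similarity variable m.\<close>

definition memory :: "real \<Rightarrow> real" where
  "memory m = integral {m..c} (\<lambda>p. kern p m * slope p)"

text \<open>The source term plus the memory term: the candidate for the second derivative of the
  profile, which is minus the derivative of the slope.\<close>

definition curvature :: "real \<Rightarrow> real" where
  "curvature m = kern c m + memory m"

lemma slope_eq: "0 \<le> y \<Longrightarrow> y \<le> c \<Longrightarrow> slope y = N \<alpha> c y"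
  by (simp add: slope_def)

lemma slope_beyond: "c \<le> y \<Longrightarrow> slope y = 0"
  using c_pos by (simp add: slope_def N_self)

lemma slope_continuous_on: "continuous_on S slope"
  unfolding slope_def
  by (rule continuous_on_compose2[OF continuous_on_W_snd[OF N_continuous_on, of 0 c]])
    (use c_pos in \<open>auto intro!: continuous_intros\<close>)

lemma slope_nonneg: "0 \<le> slope y"
  using c_pos by (simp add: slope_def N_nonneg)

lemma slope_pos: "y < c \<Longrightarrow> 0 < slope y"
  using c_pos by (simp add: slope_def N_pos)

lemma slope_bounded: obtains V where "0 < V" "\<And>y. slope y \<le> V"
proof -
  have "compact (N \<alpha> c ` {0..c})"
    by (intro compact_continuous_image continuous_on_W_snd[OF N_continuous_on]) auto
  then have "bounded (N \<alpha> c ` {0..c})" by (rule compact_imp_bounded)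
  then obtain V where "\<forall>z\<in>N \<alpha> c ` {0..c}. norm z \<le> V" unfolding bounded_iff by blast
  then have V: "\<bar>N \<alpha> c y\<bar> \<le> V" if "y \<in> {0..c}" for y using that by auto
  have "slope y \<le> max V 1" for y
    using V[of "max 0 (min c y)"] c_pos by (simp add: slope_def)
  then show thesis by (intro that[of "max V 1"]) auto
qed

lemma slope_measurable: "slope \<in> borel_measurable borel"
  by (intro borel_measurable_continuous_onI slope_continuous_on)

lemma slope_integrable: "slope integrable_on {a..b}"
  by (intro integrable_continuous_real slope_continuous_on)

lemma profile_eq: "0 \<le> y \<Longrightarrow> profile y = integral {y..c} (N \<alpha> c)"
  unfolding profile_def by (rule integral_cong) (simp add: slope_eq)

lemma profile_c: "profile c = 0"
  by (simp add: profile_def)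

text \<open>The derivative is two-sided also at y = c: the slope vanishes beyond c, so near c the
  profile agrees with an integral whose upper limit c + 1 is out of the way.\<close>

lemma profile_deriv:
  assumes "y \<le> c"
  shows "(profile has_real_derivative - slope y) (at y)"
proof -
  have "((\<lambda>z. integral {z..c + 1} slope) has_real_derivative - slope y) (at y within {y - 1..c + 1})"
    by (rule integral_has_real_derivative'[OF slope_continuous_on]) (use assms in auto)
  moreover have "at y within {y - 1..c + 1} = at y"
    using assms by (intro at_within_Icc_at) auto
  ultimately have d: "((\<lambda>z. integral {z..c + 1} slope) has_real_derivative - slope y) (at y)"
    by simp
  have eq: "profile z = integral {z..c + 1} slope" if "z \<in> {..<c + 1}" for z
  proof (cases "z \<le> c")
    case True
    have "integral {c..c + 1} slope = integral {c..c + 1} (\<lambda>x. 0)"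
      by (rule integral_cong) (simp add: slope_beyond)
    then show ?thesis
      using Henstock_Kurzweil_Integration.integral_combine[OF True _ slope_integrable, of "c + 1"] by (simp add: profile_def)
  next
    case False
    have "integral {z..c + 1} slope = integral {z..c + 1} (\<lambda>x. 0)"
      by (rule integral_cong) (use False in \<open>simp add: slope_beyond\<close>)
    then show ?thesis using False by (simp add: profile_def)
  qed
  show ?thesis
    by (rule has_field_derivative_transform_within_open[OF d, of "{..<c + 1}"])
      (use assms eq in auto)
qed

lemma profile_continuous_on: "S \<subseteq> {..c} \<Longrightarrow> continuous_on S profile"
  by (rule DERIV_continuous_on[where D = "\<lambda>y. - slope y"])
    (auto intro: has_field_derivative_at_within profile_deriv)

lemma profile_pos: "y < c \<Longrightarrow> 0 < profile y"
  unfolding profile_def by (rule integral_pos_continuous) (auto intro: slope_continuous_on slope_pos)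

section \<open>The memory term and the curvature\<close>

lemma kern_slope_integrable:
  assumes "0 \<le> m"
  shows "(\<lambda>p. kern p m * slope p) integrable_on {m..d}"
proof -
  obtain V where V: "0 < V" "\<And>y. slope y \<le> V" using slope_bounded by blast
  have [measurable]: "(\<lambda>p. kern p m) \<in> borel_measurable borel"
    by (intro kern_measurable_compose) auto
  note slope_measurable[measurable]
  show ?thesis
  proof (rule integrable_on_Icc_bound[where g = "\<lambda>p. kern p m * V"])
    show "(\<lambda>p. kern p m * slope p) \<in> borel_measurable borel" by measurable
    show "(\<lambda>p. kern p m * V) integrable_on {m..d}"
      by (intro integrable_on_mult_left kern_integrable_fst assms)
    show "\<bar>kern p m * slope p\<bar> \<le> kern p m * V" for p
      using V(2)[of p] kern_nonneg[of p m] slope_nonneg[of p] by (simp add: abs_mult mult_left_mono)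
  qed
qed

lemma memory_nonneg: "0 \<le> m \<Longrightarrow> 0 \<le> memory m"
  unfolding memory_def
  by (intro integral_nonneg kern_slope_integrable) (auto simp: kern_nonneg slope_nonneg)

text \<open>Integrating \<open>kern p\<close> over [y,p] first gives M_1(p,y), and the first
  resolvent equation evaluates what remains.\<close>

lemma memory_has_integral:
  assumes "0 \<le> y" "y \<le> c"
  shows "(memory has_integral (slope y - M1 \<alpha> c y)) {y..c}"
proof (rule tonelli_triangle)
  let ?f = "\<lambda>p m. kern p m * slope p"
  have "(\<lambda>z. slope (fst z)) \<in> borel_measurable (borel \<Otimes>\<^sub>M borel)"
    by (rule measurable_compose[OF measurable_fst slope_measurable])
  then have [measurable]: "(\<lambda>z. ?f (fst z) (snd z)) \<in> borel_measurable (borel \<Otimes>\<^sub>M borel)"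
    by (intro borel_measurable_times kern_measurable[folded borel_prod])
  show "(\<lambda>z. if y \<le> snd z \<and> snd z \<le> fst z \<and> fst z \<le> c then ?f (fst z) (snd z) else 0)
      \<in> borel_measurable borel"
    unfolding borel_prod[symmetric] by measurable
  show "0 \<le> ?f p m" for p m by (simp add: kern_nonneg slope_nonneg)
  show "(?f p has_integral M1 \<alpha> p y * slope p) {y..p}" if "y \<le> p" for p
    by (intro has_integral_mult_left M1_has_integral assms that)
  show "((\<lambda>p. ?f p m) has_integral memory m) {m..c}" if "y \<le> m" for m
    unfolding memory_def by (intro integrable_integral kern_slope_integrable) (use that assms in auto)
  show "((\<lambda>p. M1 \<alpha> p y * slope p) has_integral (slope y - M1 \<alpha> c y)) {y..c}"
    using N_resolvent(1)[OF assms] slope_eq assms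
    by (auto elim!: has_integral_eq[rotated])
qed

lemma curvature_nonneg: "0 \<le> m \<Longrightarrow> 0 \<le> curvature m"
  by (simp add: curvature_def kern_nonneg memory_nonneg)

text \<open>Over [z,c] the integral of \<open>kern c\<close> is M_1(c,z), which the memory term
  subtracts again, leaving the slope; other intervals follow by additivity. The identity reaches up
  to c, although the curvature is unbounded there.\<close>

lemma curvature_has_integral:
  assumes "0 \<le> x" "x \<le> y" "y \<le> c"
  shows "(curvature has_integral (slope x - slope y)) {x..y}"
proof -
  have *: "(curvature has_integral slope z) {z..c}" if "0 \<le> z" "z \<le> c" for z
    using has_integral_add[OF M1_has_integral[OF that] memory_has_integral[OF that]]
    by (simp add: curvature_def[abs_def])
  have x: "(curvature has_integral slope x) {x..c}" and y: "(curvature has_integral slope y) {y..c}"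
    using * assms by auto
  have "curvature integrable_on {x..y}"
    using integrable_on_subinterval[OF has_integral_integrable[OF x], of x y] assms by auto
  moreover have "integral {x..y} curvature + integral {y..c} curvature = integral {x..c} curvature"
    using has_integral_integrable[OF x] assms by (intro Henstock_Kurzweil_Integration.integral_combine) auto
  ultimately show ?thesis
    using x y by (simp add: has_integral_iff)
qed

lemma curvature_absolutely_integrable:
  "0 \<le> x \<Longrightarrow> y \<le> c \<Longrightarrow> curvature absolutely_integrable_on {x..y}"
  by (rule set_integrable_subset[of _ "{0..c}"], rule nonnegative_absolutely_integrable_1)
    (use curvature_has_integral[of 0 c] c_pos curvature_nonneg in auto)

lemma memory_absolutely_integrable: "memory absolutely_integrable_on {0..c}"
  by (rule nonnegative_absolutely_integrable_1)
    (use memory_has_integral[of 0] c_pos memory_nonneg in auto)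

text \<open>With p = m q the singularity sits at q = 1 for every m. The upper limit c / m may be
  raised to a common B because the slope vanishes beyond c.\<close>

lemma memory_scaled:
  assumes "0 < m" "m \<le> c" "c / m \<le> B"
  shows "memory m = m * integral {1..B} (\<lambda>q. kern q 1 * slope (m * q))"
proof -
  let ?f = "\<lambda>p. kern p m * slope p"
  have mB: "c \<le> m * B" using assms by (simp add: field_simps)
  have "(?f has_integral integral {m..m * B} ?f) (cbox m (m * B))"
    using kern_slope_integrable[of m] assms(1) by (simp add: integrable_integral)
  from has_integral_affinity[OF this, of m 0] assms(1)
  have "((\<lambda>q. ?f (m * q)) has_integral (1 / m * integral {m..m * B} ?f))
      ((\<lambda>x. (1 / m) * x) ` {m..m * B})"
    by simp
  moreover have "(\<lambda>x. (1 / m) * x) ` {m..m * B} = {1..B}"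
    using image_mult_atLeastAtMost[of "1 / m" m "m * B"] assms by simp
  ultimately have "((\<lambda>q. ?f (m * q)) has_integral (1 / m * integral {m..m * B} ?f)) {1..B}"
    by simp
  then have "((\<lambda>q. kern q 1 * slope (m * q)) has_integral (1 / m * integral {m..m * B} ?f)) {1..B}"
    by (rule has_integral_eq[rotated]) (use assms kern_scale[of m _ 1] in auto)
  then have "integral {m..m * B} ?f = m * integral {1..B} (\<lambda>q. kern q 1 * slope (m * q))"
    using assms(1) by (simp add: integral_unique)
  moreover have "integral {c..m * B} ?f = integral {c..m * B} (\<lambda>p. 0)"
    by (rule integral_cong) (simp add: slope_beyond)
  moreover have "integral {m..c} ?f + integral {c..m * B} ?f = integral {m..m * B} ?f"
    using assms mB by (intro Henstock_Kurzweil_Integration.integral_combine kern_slope_integrable) auto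
  ultimately show ?thesis by (simp add: memory_def)
qed

text \<open>On [m0,c] the limit B = c / m0 serves all m, and dominated convergence applies with the
  majorant V times \<open>kern q 1\<close>. The common limit is lost as m0 tends to 0, hence the
  half-open interval.\<close>

lemma memory_continuous_on: "continuous_on {0<..c} memory"
proof -
  obtain V where V: "0 < V" "\<And>y. slope y \<le> V" using slope_bounded by blast
  have k: "(\<lambda>q. kern q 1) integrable_on {1..B}" for B
    by (rule kern_integrable_fst) simp
  have "continuous_on {m0..c} memory" if "0 < m0" for m0
  proof -
    let ?B = "c / m0"
    have i: "(\<lambda>q. kern q 1 * slope (m * q)) integrable_on {1..?B}" for m
    proof (rule integrable_on_Icc_bound[where g = "\<lambda>q. kern q 1 * V"])
      have [measurable]: "(\<lambda>p. kern p 1) \<in> borel_measurable borel"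
        by (intro kern_measurable_compose) auto
      note slope_measurable[measurable]
      show "(\<lambda>q. kern q 1 * slope (m * q)) \<in> borel_measurable borel" by measurable
      show "(\<lambda>q. kern q 1 * V) integrable_on {1..?B}" by (intro integrable_on_mult_left k)
      show "\<bar>kern q 1 * slope (m * q)\<bar> \<le> kern q 1 * V" for q
        using V(2)[of "m * q"] kern_nonneg[of q 1] slope_nonneg[of "m * q"]
        by (simp add: abs_mult mult_left_mono)
    qed
    have "continuous_on {m0..c} (\<lambda>m. integral {1..?B} (\<lambda>q. kern q 1 * slope (m * q)))"
      unfolding continuous_on_sequentially
    proof (intro allI ballI impI; unfold o_def)
      fix m :: "nat \<Rightarrow> real" and a
      assume "a \<in> {m0..c}" and "(\<forall>n. m n \<in> {m0..c}) \<and> m \<longlonglongrightarrow> a"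
      then have m: "m \<longlonglongrightarrow> a" by simp
      show "(\<lambda>n. integral {1..?B} (\<lambda>q. kern q 1 * slope (m n * q)))
          \<longlonglongrightarrow> integral {1..?B} (\<lambda>q. kern q 1 * slope (a * q))"
      proof (rule dominated_convergence(2)[OF i])
        show "(\<lambda>q. kern q 1 * V) integrable_on {1..?B}" by (intro integrable_on_mult_left k)
        show "norm (kern q 1 * slope (m n * q)) \<le> kern q 1 * V" for n q
          using V(2)[of "m n * q"] kern_nonneg[of q 1] slope_nonneg[of "m n * q"]
          by (simp add: abs_mult mult_left_mono)
        show "(\<lambda>n. kern q 1 * slope (m n * q)) \<longlonglongrightarrow> kern q 1 * slope (a * q)" for q
        proof (intro tendsto_mult_left)
          have "isCont slope (a * q)"
            using slope_continuous_on[of UNIV] by (simp add: continuous_on_eq_continuous_at)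
          then show "(\<lambda>n. slope (m n * q)) \<longlonglongrightarrow> slope (a * q)"
            by (rule isCont_tendsto_compose) (intro tendsto_mult_right m)
        qed
      qed
    qed
    then have "continuous_on {m0..c} (\<lambda>m. m * integral {1..?B} (\<lambda>q. kern q 1 * slope (m * q)))"
      by (intro continuous_intros)
    then show ?thesis
    proof (rule continuous_on_eq)
      show "m * integral {1..?B} (\<lambda>q. kern q 1 * slope (m * q)) = memory m" if "m \<in> {m0..c}" for m
        using memory_scaled[of m ?B] that \<open>0 < m0\<close> c_pos by (simp add: frac_le)
    qed
  qed
  note * = this
  have "(memory \<longlongrightarrow> memory m) (at m within {0<..c})" if "m \<in> {0<..c}" for m
  proof -
    have "(memory \<longlongrightarrow> memory m) (at m within {m / 2..c})"
      using *[of "m / 2"] that by (auto simp: continuous_on_def)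
    moreover have "at m within {m / 2..c} = at m within {0<..c}"
      by (rule at_within_nhd[of _ "{m / 2<..}"]) (use that in auto)
    ultimately show ?thesis by simp
  qed
  then show ?thesis by (auto simp: continuous_on_def)
qed

lemma curvature_continuous_on: "continuous_on {0<..<c} curvature"
proof -
  have "continuous_on {0<..<c} (\<lambda>m. (1 - (m / c) powr (2 / \<alpha>)) powr (- \<alpha>) / Gamma (1 - \<alpha>))"
  proof (intro continuous_intros ballI)
    show "1 - (m / c) powr (2 / \<alpha>) \<noteq> 0" if "m \<in> {0<..<c}" for m
      using ratio_powr_bounds(1)[of c m] that by auto
  qed (use Gamma_pos c_pos in auto)
  then have "continuous_on {0<..<c} (kern c)"
    by (rule continuous_on_eq) (use c_pos in \<open>auto simp: kern_eq\<close>)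
  moreover have "continuous_on {0<..<c} memory"
    by (rule continuous_on_subset[OF memory_continuous_on]) auto
  ultimately show ?thesis
    unfolding curvature_def[abs_def] by (intro continuous_intros)
qed

lemma slope_deriv:
  assumes "0 < y" "y < c"
  shows "(slope has_real_derivative - curvature y) (at y)"
proof -
  \<comment> \<open>A compact neighbourhood of y away from 0 and c. The curvature is continuous on
    it, so the fundamental theorem differentiates \<open>curvature_has_integral\<close>.\<close>
  define a b where "a = y / 2" and "b = (y + c) / 2"
  have ab: "0 < a" "a < y" "y < b" "b < c" using assms by (auto simp: a_def b_def)
  have "((\<lambda>z. slope b + integral {z..b} curvature) has_real_derivative - curvature y) (at y within {a..b})"
    using ab by (auto intro!: derivative_eq_intros integral_has_real_derivative'
        continuous_on_subset[OF curvature_continuous_on])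
  moreover have "at y within {a..b} = at y"
    using ab by (intro at_within_Icc_at) auto
  ultimately have d: "((\<lambda>z. slope b + integral {z..b} curvature) has_real_derivative - curvature y) (at y)"
    by simp
  show ?thesis
  proof (rule has_field_derivative_transform_within_open[OF d, of "{a<..<b}"])
    show "slope b + integral {z..b} curvature = slope z" if "z \<in> {a<..<b}" for z
      using curvature_has_integral[of z b] that ab by (simp add: integral_unique)
  qed (use ab in auto)
qed

text \<open>With p = x \<tau>^(-\<alpha>/2) and y = x t^(-\<alpha>/2) the ratio (y/p)^(2/\<alpha>)
  equals \<tau>/t, so the weight (t - \<tau>)^(-\<alpha>) is Gamma(1-\<alpha>) t^(-\<alpha>)
  \<open>kern p y\<close>. The remaining factors of \<open>w\<close> are the speed of the
  substitution and the slope at p.\<close>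

lemma caputo_in_time:
  assumes "0 < x" "0 < t" "x * t powr (- \<alpha> / 2) \<le> c"
  defines "w \<equiv> \<lambda>\<tau>. (t - \<tau>) powr (- \<alpha>) *
    (\<alpha> / 2 * x * \<tau> powr (- \<alpha> / 2 - 1) * slope (x * \<tau> powr (- \<alpha> / 2)))"
  shows "w absolutely_integrable_on {(x / c) powr (2 / \<alpha>)..t}"
    and "integral {(x / c) powr (2 / \<alpha>)..t} w
      = Gamma (1 - \<alpha>) * t powr (- \<alpha>) * memory (x * t powr (- \<alpha> / 2))"
proof -
  let ?y = "x * t powr (- \<alpha> / 2)"
  let ?t0 = "(x / c) powr (2 / \<alpha>)"
  let ?C = "Gamma (1 - \<alpha>) * t powr (- \<alpha>)"
  let ?f = "\<lambda>p. ?C * (kern p ?y * slope p)"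
  have t0: "0 < ?t0" "?t0 \<le> t" "x * ?t0 powr (- \<alpha> / 2) = c"
    using assms c_pos powr_time_le_iff(2)[of x c t] similarity_inverse[of x c] by auto
  have y: "0 < ?y" using assms by simp
  have fi: "?f integrable_on {?y..c}"
    using y by (intro integrable_on_mult_right kern_slope_integrable) auto
  have f: "?f absolutely_integrable_on {?y..x * ?t0 powr (- \<alpha> / 2)}"
    unfolding t0(3)
    using fi Gamma_pos by (intro nonnegative_absolutely_integrable_1) (auto simp: kern_nonneg slope_nonneg)
  note sub = similarity_substitution[OF \<open>0 < x\<close> t0(1,2) f]
  have eq: "\<alpha> / 2 * x * \<tau> powr (- \<alpha> / 2 - 1) * ?f (x * \<tau> powr (- \<alpha> / 2)) = w \<tau>"
    if \<tau>: "\<tau> \<in> {?t0..t}" for \<tau>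
  proof -
    have pos: "0 < \<tau>" "\<tau> \<le> t" using less_le_trans[OF t0(1), of \<tau>] \<tau> by auto
    have "?y / (x * \<tau> powr (- \<alpha> / 2)) = (\<tau> / t) powr (\<alpha> / 2)"
      using assms pos by (simp add: powr_divide powr_minus_divide)
    then have "(?y / (x * \<tau> powr (- \<alpha> / 2))) powr (2 / \<alpha>) = \<tau> / t"
      using assms pos alpha_pos by (simp add: powr_powr)
    then have "Gamma (1 - \<alpha>) * kern (x * \<tau> powr (- \<alpha> / 2)) ?y = (1 - \<tau> / t) powr (- \<alpha>)"
      using kern_eq[of "x * \<tau> powr (- \<alpha> / 2)" ?y] assms pos Gamma_pos by simp
    also have "1 - \<tau> / t = (t - \<tau>) / t" using assms by (simp add: field_simps)
    also have "\<dots> powr (- \<alpha>) = (t - \<tau>) powr (- \<alpha>) / t powr (- \<alpha>)"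
      using assms pos by (simp add: powr_divide)
    finally have "?C * kern (x * \<tau> powr (- \<alpha> / 2)) ?y = (t - \<tau>) powr (- \<alpha>)"
      using assms by (simp add: field_simps)
    then show ?thesis by (simp add: w_def mult_ac)
  qed
  show "w absolutely_integrable_on {?t0..t}"
    by (rule set_integrable_cong[THEN iffD1, OF refl refl eq sub(1)])
  have "integral {?t0..t} w
      = integral {?t0..t} (\<lambda>\<tau>. \<alpha> / 2 * x * \<tau> powr (- \<alpha> / 2 - 1) * ?f (x * \<tau> powr (- \<alpha> / 2)))"
    by (rule integral_cong) (simp only: eq)
  also have "\<dots> = integral {?y..c} ?f"
    using sub(2) unfolding t0(3) .
  finally have "integral {?t0..t} w = integral {?y..c} ?f" .
  then show "integral {?t0..t} w = ?C * memory ?y"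
    by (simp add: memory_def)
qed

text \<open>Integration by parts with (p - y) \<open>profile p\<close>, which vanishes at both ends.
  It turns a superposition of the affine functions p t^(\<alpha>/2) - a into an integral of the
  temperature.\<close>

lemma integral_profile:
  assumes "0 \<le> y" "y \<le> c"
  shows "((\<lambda>p. (p - y) * slope p) has_integral (integral {y..c} profile)) {y..c}"
proof -
  have "((\<lambda>p. profile p - (p - y) * slope p) has_integral
      ((c - y) * profile c - (y - y) * profile y)) {y..c}"
  proof (rule fundamental_theorem_of_calculus[OF assms(2)])
    show "((\<lambda>p. (p - y) * profile p) has_vector_derivative profile p - (p - y) * slope p)
        (at p within {y..c})" if "p \<in> {y..c}" for p
      unfolding has_real_derivative_iff_has_vector_derivative[symmetric]
      using that by (auto intro!: derivative_eq_intros has_field_derivative_at_within[OF profile_deriv])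
  qed
  then have "((\<lambda>p. profile p - (p - y) * slope p) has_integral 0) {y..c}"
    by (simp add: profile_c)
  moreover have "(profile has_integral integral {y..c} profile) {y..c}"
    by (intro integrable_integral integrable_continuous_real profile_continuous_on) auto
  ultimately have "((\<lambda>p. profile p - (profile p - (p - y) * slope p)) has_integral
      (integral {y..c} profile - 0)) {y..c}"
    by (rule has_integral_diff[rotated])
  then show ?thesis by simp
qed

text \<open>By the Volterra equation the difference of slope and M_1(c,.) is a superposition of the
  M_1(p,.) with weights \<open>slope p\<close>. After the exchange of integrals
  \<open>abel_integral_M1\<close> applies to each p, and a first moment of the slope
  remains.\<close>

lemma abel_integral_slope_remainder:
  assumes "0 < a" "0 < t" "a * t powr (- \<alpha> / 2) \<le> c"
  shows "((\<lambda>\<tau>. (t - \<tau>) powr (\<alpha> - 1) * (\<tau> powr (- \<alpha> / 2) *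
      (slope (a * \<tau> powr (- \<alpha> / 2)) - M1 \<alpha> c (a * \<tau> powr (- \<alpha> / 2)))))
    has_integral (Gamma \<alpha> * t powr (\<alpha> / 2) * integral {a * t powr (- \<alpha> / 2)..c} profile))
    {(a / c) powr (2 / \<alpha>)..t}"
proof -
  let ?y = "a * t powr (- \<alpha> / 2)"
  let ?\<sigma> = "\<lambda>p. (a / p) powr (2 / \<alpha>)"
  let ?m = "\<lambda>p \<tau>. (t - \<tau>) powr (\<alpha> - 1) * (\<tau> powr (- \<alpha> / 2) * M1 \<alpha> p (a * \<tau> powr (- \<alpha> / 2)))"
  define f where "f p \<tau> = (if ?y \<le> p \<and> p \<le> c \<and> ?\<sigma> p \<le> \<tau> \<and> \<tau> \<le> t then slope p * ?m p \<tau> else 0)" for p \<tau>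
  define I where "I p = (if p \<in> {?y..c} then slope p * (Gamma \<alpha> * (p * t powr (\<alpha> / 2) - a)) else 0)" for p
  define K where "K \<tau> = (if \<tau> \<in> {?\<sigma> c..t} then (t - \<tau>) powr (\<alpha> - 1) * (\<tau> powr (- \<alpha> / 2) *
      (slope (a * \<tau> powr (- \<alpha> / 2)) - M1 \<alpha> c (a * \<tau> powr (- \<alpha> / 2)))) else 0)" for \<tau>
  have y: "0 < ?y" using assms by simp
  have tt: "t powr (\<alpha> / 2) * t powr (- \<alpha> / 2) = 1"
    using assms by (simp add: powr_add[symmetric])
  have ay: "a = ?y * t powr (\<alpha> / 2)" using tt by (simp add: mult_ac)
  have region: "0 < p \<and> 0 < \<tau> \<and> a * \<tau> powr (- \<alpha> / 2) \<le> p"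
    if "?y \<le> p" "?\<sigma> p \<le> \<tau>" for p \<tau>
  proof -
    have p: "0 < p" using y that by linarith
    moreover have "0 < ?\<sigma> p" using p assms by simp
    then have "0 < \<tau>" using that by linarith
    ultimately show ?thesis using powr_time_le_iff(2)[of a p \<tau>] that assms by simp
  qed
  have "(K has_integral Gamma \<alpha> * t powr (\<alpha> / 2) * integral {?y..c} profile) UNIV"
  proof (rule tonelli_has_integral[of f I])
    \<comment> \<open>M_1 is known to be continuous on the closed set \<open>W\<close>; extension by
      0 makes it Borel on the plane.\<close>
    define M' where "M' z = indicator W z *\<^sub>R (\<lambda>(p, y). M1 \<alpha> p y) z" for z
    have "W = {z. 0 \<le> snd z} \<inter> {z. snd z \<le> fst z}" by auto
    then have "closed W" by (auto intro!: closed_Int closed_Collect_le continuous_intros)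
    then have "M' \<in> borel_measurable borel"
      unfolding M'_def by (intro borel_measurable_continuous_on_indicator M1_continuous_on borel_closed)
    then have M'[measurable]: "M' \<in> borel_measurable (borel \<Otimes>\<^sub>M borel)" by (simp add: borel_prod)
    note slope_measurable[measurable]
    have "(\<lambda>z. f (fst z) (snd z)) = (\<lambda>z. if ?y \<le> fst z \<and> fst z \<le> c \<and> ?\<sigma> (fst z) \<le> snd z \<and> snd z \<le> t
      then slope (fst z) * ((t - snd z) powr (\<alpha> - 1) * ((snd z) powr (- \<alpha> / 2) *
        M' (fst z, a * (snd z) powr (- \<alpha> / 2)))) else 0)"
    proof
      fix z
      have "M1 \<alpha> (fst z) (a * snd z powr (- \<alpha> / 2)) = M' (fst z, a * snd z powr (- \<alpha> / 2))"
        if "?y \<le> fst z" "?\<sigma> (fst z) \<le> snd z"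
      proof -
        have "(fst z, a * snd z powr (- \<alpha> / 2)) \<in> W"
          using region[OF that] assms by simp
        then show ?thesis by (simp add: M'_def)
      qed
      then show "f (fst z) (snd z) = (if ?y \<le> fst z \<and> fst z \<le> c \<and> ?\<sigma> (fst z) \<le> snd z \<and> snd z \<le> t
        then slope (fst z) * ((t - snd z) powr (\<alpha> - 1) * ((snd z) powr (- \<alpha> / 2) *
          M' (fst z, a * (snd z) powr (- \<alpha> / 2)))) else 0)"
        unfolding f_def by presburger
    qed
    also have "\<dots> \<in> borel_measurable (borel \<Otimes>\<^sub>M borel)" by measurable
    finally show "(\<lambda>z. f (fst z) (snd z)) \<in> borel_measurable borel" by (simp only: borel_prod)
    show "0 \<le> f p \<tau>" for p \<tau>
      using region[of p \<tau>] assms by (auto simp: f_def intro!: mult_nonneg_nonneg slope_nonneg M1_nonneg)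
    show "(f p has_integral I p) UNIV" for p
    proof (cases "p \<in> {?y..c}")
      case True
      then have p: "0 < p" using y by auto
      have "a \<le> p * t powr (\<alpha> / 2)"
        using True by (subst ay) (auto intro: mult_right_mono)
      from has_integral_mult_right[OF abel_integral_M1[OF p assms(1,2) this], of "slope p"]
      have "((\<lambda>\<tau>. if \<tau> \<in> {?\<sigma> p..t} then slope p * ?m p \<tau> else 0) has_integral I p) UNIV"
        using True by (subst has_integral_restrict_UNIV) (simp add: I_def)
      moreover have "f p = (\<lambda>\<tau>. if \<tau> \<in> {?\<sigma> p..t} then slope p * ?m p \<tau> else 0)"
        using True by (auto simp: f_def fun_eq_iff)
      ultimately show ?thesis by simp
    next
      case False
      then have "f p = (\<lambda>_. 0)" by (auto simp: f_def fun_eq_iff)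
      then show ?thesis using False by (auto simp: I_def)
    qed
    show "((\<lambda>p. f p \<tau>) has_integral K \<tau>) UNIV" for \<tau>
    proof (cases "\<tau> \<in> {?\<sigma> c..t}")
      case True
      have \<tau>: "0 < \<tau>" "a * \<tau> powr (- \<alpha> / 2) \<le> c"
        using region[of c \<tau>] assms True by auto
      let ?z = "a * \<tau> powr (- \<alpha> / 2)"
      have z: "0 < ?z" using \<tau> assms by simp
      have yz: "?y \<le> ?z"
        using True \<tau> assms alpha_pos by (intro mult_left_mono powr_mono2') auto
      have "((\<lambda>p. M1 \<alpha> p ?z * slope p) has_integral (slope ?z - M1 \<alpha> c ?z)) {?z..c}"
        using N_resolvent(1)[of ?z c] slope_eq z \<tau>
        by (auto elim!: has_integral_eq[rotated])
      from has_integral_mult_right[OF this, of "(t - \<tau>) powr (\<alpha> - 1) * \<tau> powr (- \<alpha> / 2)"]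
      have "((\<lambda>p. slope p * ?m p \<tau>) has_integral K \<tau>) {?z..c}"
        using True by (simp add: K_def mult_ac)
      then have "((\<lambda>p. if p \<in> {?z..c} then slope p * ?m p \<tau> else 0) has_integral K \<tau>) UNIV"
        by (simp only: has_integral_restrict_UNIV)
      moreover have "(\<lambda>p. f p \<tau>) = (\<lambda>p. if p \<in> {?z..c} then slope p * ?m p \<tau> else 0)"
      proof
        fix p
        show "f p \<tau> = (if p \<in> {?z..c} then slope p * ?m p \<tau> else 0)"
        proof (cases "?y \<le> p")
          case True
          then have "0 < p" using y by linarith
          then show ?thesis
            using powr_time_le_iff(2)[of a p \<tau>] assms \<tau> True \<open>\<tau> \<in> {?\<sigma> c..t}\<close> by (auto simp: f_def)
        qed (use yz in \<open>auto simp: f_def\<close>)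
      qed
      ultimately show ?thesis by simp
    next
      case False
      have "f p \<tau> = 0" for p
      proof (cases "?y \<le> p \<and> p \<le> c")
        case True
        then have "0 < p" using y by linarith
        then have "?\<sigma> c \<le> ?\<sigma> p"
          using assms alpha_pos True by (intro powr_mono2 divide_left_mono) auto
        with False show ?thesis by (auto simp: f_def)
      qed (auto simp: f_def)
      then show ?thesis using False by (auto simp: K_def)
    qed
    have "((\<lambda>p. (Gamma \<alpha> * t powr (\<alpha> / 2)) * ((p - ?y) * slope p)) has_integral
        (Gamma \<alpha> * t powr (\<alpha> / 2) * integral {?y..c} profile)) {?y..c}"
      using y assms by (intro has_integral_mult_right integral_profile) auto
    moreover have "p * t powr (\<alpha> / 2) - a = (p - ?y) * t powr (\<alpha> / 2)" for p
      by (simp only: left_diff_distrib ay[symmetric])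
    then have "(Gamma \<alpha> * t powr (\<alpha> / 2)) * ((p - ?y) * slope p)
        = slope p * (Gamma \<alpha> * (p * t powr (\<alpha> / 2) - a))" for p
      by (simp only: mult_ac)
    ultimately have "((\<lambda>p. slope p * (Gamma \<alpha> * (p * t powr (\<alpha> / 2) - a))) has_integral
        (Gamma \<alpha> * t powr (\<alpha> / 2) * integral {?y..c} profile)) {?y..c}"
      by (simp only:)
    then show "(I has_integral Gamma \<alpha> * t powr (\<alpha> / 2) * integral {?y..c} profile) UNIV"
      unfolding I_def by (simp only: has_integral_restrict_UNIV)
  qed
  then show ?thesis
    unfolding K_def by (simp only: has_integral_restrict_UNIV)
qed

text \<open>Conservation of energy in integrated form; differentiating it in time gives the Stefan condition.\<close>

lemma abel_integral_slope:
  assumes "0 < a" "0 < t" "a * t powr (- \<alpha> / 2) \<le> c"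
  shows "((\<lambda>\<tau>. (t - \<tau>) powr (\<alpha> - 1) * (\<tau> powr (- \<alpha> / 2) * slope (a * \<tau> powr (- \<alpha> / 2))))
    has_integral (Gamma \<alpha> * (c * t powr (\<alpha> / 2) - a +
      t powr (\<alpha> / 2) * integral {a * t powr (- \<alpha> / 2)..c} profile)))
    {(a / c) powr (2 / \<alpha>)..t}"
proof -
  have "a \<le> c * t powr (\<alpha> / 2)"
    using powr_time_le_iff(1,2)[of a c t] assms c_pos by simp
  from has_integral_add[OF abel_integral_M1[OF c_pos assms(1,2) this]
      abel_integral_slope_remainder[OF assms]]
  show ?thesis by (simp add: algebra_simps)
qed

section \<open>The solution of the Stefan problem\<close>

definition front :: "real \<Rightarrow> real" where
  "front t = c * t powr (\<alpha> / 2)"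

definition temp :: "real \<Rightarrow> real \<Rightarrow> real" where
  "temp x t = profile (x * t powr (- \<alpha> / 2))"

lemma powr_cancel: "0 < t \<Longrightarrow> t powr (\<alpha> / 2) * t powr (- \<alpha> / 2) = 1"
  by (simp add: powr_add[symmetric])

lemma le_front_iff:
  assumes "0 < t"
  shows "x \<le> front t \<longleftrightarrow> x * t powr (- \<alpha> / 2) \<le> c"
    and "x < front t \<longleftrightarrow> x * t powr (- \<alpha> / 2) < c"
proof -
  have "t powr (- \<alpha> / 2) = 1 / t powr (\<alpha> / 2)"
    using assms by (simp add: powr_minus_divide)
  then have *: "x * t powr (- \<alpha> / 2) = x / t powr (\<alpha> / 2)" by (simp only: mult_1_right times_divide_eq_right)
  show "x \<le> front t \<longleftrightarrow> x * t powr (- \<alpha> / 2) \<le> c" "x < front t \<longleftrightarrow> x * t powr (- \<alpha> / 2) < c"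
    unfolding * using assms by (simp_all add: front_def field_simps)
qed

lemma front_pos: "0 < t \<Longrightarrow> 0 < front t"
  using c_pos by (simp add: front_def)

lemma front_scaled: "0 < t \<Longrightarrow> front t * t powr (- \<alpha> / 2) = c"
  using powr_cancel[of t] by (simp add: front_def mult.assoc)

lemma front_0: "front 0 = 0"
  by (simp add: front_def)

lemma front_strict_mono: "0 \<le> a \<Longrightarrow> a < b \<Longrightarrow> front a < front b"
  using c_pos alpha_pos by (auto simp: front_def intro!: mult_strict_left_mono powr_less_mono2)

lemma front_inj: "inj_on front {0..}"
proof (rule linorder_inj_onI)
  show "front a \<noteq> front b" if "a < b" "a \<in> {0..}" for a b
    using front_strict_mono[of a b] that by simp
qed auto

lemma front_of_inv: "0 \<le> x \<Longrightarrow> front ((x / c) powr (2 / \<alpha>)) = x"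
  using c_pos alpha_pos by (simp add: front_def powr_powr)

lemma s_inv_front: "0 \<le> x \<Longrightarrow> s_inv front x = (x / c) powr (2 / \<alpha>)"
  unfolding s_inv_def by (rule inv_into_f_eq[OF front_inj]) (auto simp: front_of_inv)

lemma front_bij: "bij_betw front {0..} {0..}"
proof -
  have "front ` {0..} = {0..}"
  proof
    show "front ` {0..} \<subseteq> {0..}" using c_pos by (auto simp: front_def)
    show "{0..} \<subseteq> front ` {0..}"
    proof
      fix x :: real assume "x \<in> {0..}"
      then have "x = front ((x / c) powr (2 / \<alpha>))" by (simp add: front_of_inv)
      then show "x \<in> front ` {0..}" by (rule image_eqI) simp
    qed
  qed
  then show ?thesis using front_inj by (simp add: bij_betw_def)
qed

lemma s_inv_front_pos: "0 < x \<Longrightarrow> 0 < s_inv front x"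
  using c_pos by (simp add: s_inv_front)

lemma s_inv_front_le_iff:
  assumes "0 < x"
  shows "s_inv front x \<le> t \<longleftrightarrow> 0 < t \<and> x * t powr (- \<alpha> / 2) \<le> c"
proof (cases "0 < t")
  case True
  then show ?thesis using powr_time_le_iff(2)[of x c t] assms c_pos by (simp add: s_inv_front)
next
  case False
  then show ?thesis using s_inv_front_pos[OF assms] by simp
qed

lemma s_inv_front_scaled: "0 < x \<Longrightarrow> x * s_inv front x powr (- \<alpha> / 2) = c"
  using similarity_inverse[of x c] c_pos by (simp add: s_inv_front)

section \<open>Derivatives of front and temperature, and the differential equation\<close>

lemma front_has_derivative:
  "0 < t \<Longrightarrow> (front has_real_derivative (c * (\<alpha> / 2) * t powr (\<alpha> / 2 - 1))) (at t)"
  unfolding front_def[abs_def] by (auto intro!: derivative_eq_intros)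

lemma deriv_front: "0 < t \<Longrightarrow> deriv front t = c * (\<alpha> / 2) * t powr (\<alpha> / 2 - 1)"
  by (rule DERIV_imp_deriv) (rule front_has_derivative)

lemma temp_x_derivative:
  assumes "x * t powr (- \<alpha> / 2) \<le> c"
  shows "((\<lambda>y. temp y t) has_real_derivative - (t powr (- \<alpha> / 2) * slope (x * t powr (- \<alpha> / 2)))) (at x)"
  unfolding temp_def
  by (rule DERIV_cong[OF DERIV_chain2[where f = profile and g = "\<lambda>y. y * t powr (- \<alpha> / 2)", OF profile_deriv[OF assms]]])
    (auto intro!: derivative_eq_intros)

lemma u_x_temp:
  assumes "0 < t" "x \<in> {0..front t}"
  shows "x_diff front temp x t"
    and "u_x front temp x t = - (t powr (- \<alpha> / 2) * slope (x * t powr (- \<alpha> / 2)))"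
proof -
  have "x * t powr (- \<alpha> / 2) \<le> c" using le_front_iff(1) assms by simp
  note d = temp_x_derivative[OF this]
  show "x_diff front temp x t"
    unfolding x_diff_def real_differentiable_def
    using has_field_derivative_at_within[OF d] by blast
  show "u_x front temp x t = - (t powr (- \<alpha> / 2) * slope (x * t powr (- \<alpha> / 2)))"
    unfolding u_x_def
    by (rule vector_derivative_at_within_ivl)
      (use d assms front_pos[of t] in \<open>auto simp: has_real_derivative_iff_has_vector_derivative\<close>)
qed

lemma temp_t_derivative:
  assumes "0 < t" "x * t powr (- \<alpha> / 2) \<le> c"
  shows "((\<lambda>\<tau>. temp x \<tau>) has_real_derivative
    (\<alpha> / 2 * x * t powr (- \<alpha> / 2 - 1) * slope (x * t powr (- \<alpha> / 2)))) (at t)"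
  unfolding temp_def
  by (rule DERIV_cong[OF DERIV_chain2[where f = profile and g = "\<lambda>\<tau>. x * \<tau> powr (- \<alpha> / 2)", OF profile_deriv[OF assms(2)]]])
    (use assms in \<open>auto intro!: derivative_eq_intros\<close>)

lemma u_t_temp:
  assumes "0 < x" "s_inv front x \<le> t"
  shows "t_diff front temp x t"
    and "u_t front temp x t = \<alpha> / 2 * x * t powr (- \<alpha> / 2 - 1) * slope (x * t powr (- \<alpha> / 2))"
proof -
  have "0 < t" "x * t powr (- \<alpha> / 2) \<le> c" using s_inv_front_le_iff assms by auto
  note d = has_field_derivative_at_within[OF temp_t_derivative[OF this]]
  show "t_diff front temp x t"
    unfolding t_diff_def real_differentiable_def using d by blast
  show "u_t front temp x t = \<alpha> / 2 * x * t powr (- \<alpha> / 2 - 1) * slope (x * t powr (- \<alpha> / 2))"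
    unfolding u_t_def
    by (rule vector_derivative_within[OF at_within_Ici_not_bot])
      (use d assms in \<open>auto simp: has_real_derivative_iff_has_vector_derivative\<close>)
qed

lemma u_x_deriv_temp:
  assumes "0 < t" "0 < x" "x < front t"
  shows "((\<lambda>y. u_x front temp y t) has_real_derivative
    (t powr (- \<alpha>) * curvature (x * t powr (- \<alpha> / 2)))) (at x)"
proof -
  let ?r = "t powr (- \<alpha> / 2)"
  have y: "0 < x * ?r" "x * ?r < c" using le_front_iff(2)[of t x] assms by auto
  have rr: "?r * ?r = t powr (- \<alpha>)" using assms by (simp add: powr_add[symmetric])
  have d: "((\<lambda>y. - (?r * slope (y * ?r))) has_real_derivative (- (?r * (- curvature (x * ?r) * ?r)))) (at x)"
    by (intro DERIV_minus DERIV_cmult DERIV_chain2[where f = slope and g = "\<lambda>y. y * ?r", OF slope_deriv[OF y]])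
      (auto intro!: derivative_eq_intros)
  have "((\<lambda>y. u_x front temp y t) has_real_derivative (- (?r * (- curvature (x * ?r) * ?r)))) (at x)"
    by (rule has_field_derivative_transform_within_open[OF d, of "{0<..<front t}"])
      (use assms u_x_temp(2) in auto)
  also have "- (?r * (- curvature (x * ?r) * ?r)) = t powr (- \<alpha>) * curvature (x * ?r)"
    unfolding rr[symmetric] by simp
  finally show ?thesis .
qed

lemma caputo_temp:
  assumes "0 < t" "0 < x" "x < front t"
  shows "set_integrable lebesgue {s_inv front x..t} (caputo_integrand \<alpha> front temp x t)"
    and "caputo \<alpha> front temp x t = t powr (- \<alpha>) * memory (x * t powr (- \<alpha> / 2))"
proof -
  let ?w = "\<lambda>\<tau>. (t - \<tau>) powr (- \<alpha>) *
    (\<alpha> / 2 * x * \<tau> powr (- \<alpha> / 2 - 1) * slope (x * \<tau> powr (- \<alpha> / 2)))"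
  have y: "x * t powr (- \<alpha> / 2) \<le> c" using le_front_iff(2)[of t x] assms by simp
  have x: "s_inv front x = (x / c) powr (2 / \<alpha>)" using s_inv_front assms by simp
  have w: "?w absolutely_integrable_on {s_inv front x..t}"
    "integral {s_inv front x..t} ?w = Gamma (1 - \<alpha>) * t powr (- \<alpha>) * memory (x * t powr (- \<alpha> / 2))"
    using caputo_in_time[OF assms(2,1) y] unfolding x by blast+
  have eq: "?w \<tau> = caputo_integrand \<alpha> front temp x t \<tau>" if "\<tau> \<in> {s_inv front x..t}" for \<tau>
    using u_t_temp(2)[of x \<tau>] assms that by (simp add: caputo_integrand_def)
  show i: "set_integrable lebesgue {s_inv front x..t} (caputo_integrand \<alpha> front temp x t)"
    by (rule set_integrable_cong[THEN iffD1, OF refl refl eq w(1)])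
  have "integral {s_inv front x..t} (caputo_integrand \<alpha> front temp x t) = integral {s_inv front x..t} ?w"
    by (rule integral_cong) (simp only: eq)
  then show "caputo \<alpha> front temp x t = t powr (- \<alpha>) * memory (x * t powr (- \<alpha> / 2))"
    unfolding caputo_def set_lebesgue_integral_eq_integral(2)[OF i] w(2) using Gamma_pos by simp
qed

text \<open>Multiplied by t^(-\<alpha>), the two summands of the curvature become the source term
  and the Caputo derivative. For the source this is the identity 1 - (y/c)^(2/\<alpha>) = (t -
  \<open>s_inv front x\<close>) / t.\<close>

lemma temp_pde:
  assumes "0 < t" "0 < x" "x < front t"
  shows "caputo \<alpha> front temp x t
    = u_xx front temp x t - 1 / Gamma (1 - \<alpha>) * (t - s_inv front x) powr (- \<alpha>)"
proof -
  let ?y = "x * t powr (- \<alpha> / 2)"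
  have y: "0 < ?y" using assms by simp
  have "(?y / c) powr (2 / \<alpha>) = (x / c) powr (2 / \<alpha>) * (t powr (- \<alpha> / 2)) powr (2 / \<alpha>)"
    using assms c_pos by (simp add: powr_mult[symmetric])
  also have "(t powr (- \<alpha> / 2)) powr (2 / \<alpha>) = 1 / t"
    unfolding powr_powr using assms alpha_pos by (simp add: powr_minus_divide)
  finally have e: "1 - (?y / c) powr (2 / \<alpha>) = (t - s_inv front x) / t"
    using assms by (simp add: s_inv_front field_simps)
  have "s_inv front x \<le> t"
    using s_inv_front_le_iff[of x t] le_front_iff(2)[of t x] assms by simp
  then have "t powr (- \<alpha>) * ((t - s_inv front x) / t) powr (- \<alpha>) = (t - s_inv front x) powr (- \<alpha>)"
    using assms by (simp add: powr_divide)
  then have "t powr (- \<alpha>) * kern c ?y = 1 / Gamma (1 - \<alpha>) * (t - s_inv front x) powr (- \<alpha>)"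
    unfolding kern_eq[OF c_pos less_imp_le[OF y]] e by simp
  moreover have "u_xx front temp x t = t powr (- \<alpha>) * curvature ?y"
    unfolding u_xx_def by (rule DERIV_imp_deriv) (rule u_x_deriv_temp[OF assms])
  ultimately show ?thesis
    using caputo_temp(2)[OF assms] by (simp add: curvature_def distrib_left)
qed

section \<open>The flux and the Stefan condition\<close>

lemma flux_temp:
  assumes "0 < a" "s_inv front a \<le> t"
  shows "set_integrable lebesgue {s_inv front a..t} (flux_integrand \<alpha> front temp a t)"
    and "flux_integral \<alpha> front temp a t = - (Gamma \<alpha> * (c * t powr (\<alpha> / 2) - a +
      t powr (\<alpha> / 2) * integral {a * t powr (- \<alpha> / 2)..c} profile))"
proof -
  let ?w = "\<lambda>\<tau>. (t - \<tau>) powr (\<alpha> - 1) * (\<tau> powr (- \<alpha> / 2) * slope (a * \<tau> powr (- \<alpha> / 2)))"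
  let ?I = "Gamma \<alpha> * (c * t powr (\<alpha> / 2) - a + t powr (\<alpha> / 2) * integral {a * t powr (- \<alpha> / 2)..c} profile)"
  have t: "0 < t" "a * t powr (- \<alpha> / 2) \<le> c" using s_inv_front_le_iff assms by auto
  have "(?w has_integral ?I) {s_inv front a..t}"
    using abel_integral_slope[OF assms(1) t] assms(1) by (simp add: s_inv_front)
  then have hi: "((\<lambda>\<tau>. - ?w \<tau>) has_integral - ?I) {s_inv front a..t}"
    and w: "?w absolutely_integrable_on {s_inv front a..t}"
    by (auto intro!: has_integral_neg nonnegative_absolutely_integrable_1 slope_nonneg mult_nonneg_nonneg)
  have eq: "- ?w \<tau> = flux_integrand \<alpha> front temp a t \<tau>" if \<tau>: "\<tau> \<in> {s_inv front a..t}" for \<tau>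
  proof -
    have "0 < \<tau>" "a * \<tau> powr (- \<alpha> / 2) \<le> c" using s_inv_front_le_iff assms \<tau> by auto
    then show ?thesis
      using u_x_temp(2)[of \<tau> a] le_front_iff(1)[of \<tau> a] assms by (simp add: flux_integrand_def)
  qed
  have "set_integrable lebesgue {s_inv front a..t} (\<lambda>\<tau>. (- 1) * ?w \<tau>)"
    by (intro set_integrable_mult_right w)
  then have w': "set_integrable lebesgue {s_inv front a..t} (\<lambda>\<tau>. - ?w \<tau>)" by simp
  show i: "set_integrable lebesgue {s_inv front a..t} (flux_integrand \<alpha> front temp a t)"
    by (rule set_integrable_cong[THEN iffD1, OF refl refl eq w'])
  have "(flux_integrand \<alpha> front temp a t has_integral - ?I) {s_inv front a..t}"
    using hi by (rule has_integral_eq[rotated]) (rule eq)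
  then show "flux_integral \<alpha> front temp a t = - ?I"
    unfolding flux_integral_def set_lebesgue_integral_eq_integral(2)[OF i] by (rule integral_unique)
qed

lemma integral_profile_deriv:
  assumes "y < c"
  shows "((\<lambda>z. integral {z..c} profile) has_real_derivative - profile y) (at y)"
proof -
  have "((\<lambda>z. integral {z..c} profile) has_real_derivative - profile y) (at y within {y - 1..c})"
    by (rule integral_has_real_derivative') (use assms in \<open>auto intro: profile_continuous_on\<close>)
  moreover have "at y within {y - 1..c} = at y"
    using assms by (intro at_within_Icc_at) auto
  ultimately show ?thesis by simp
qed

text \<open>The time derivative of the closed form in \<open>flux_temp\<close>. It is defined and
  continuous also at a = \<open>front t\<close>, which \<open>flux_temp_deriv\<close> does not
  reach, so the limit in the Stefan condition can be read off there.\<close>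

definition flux_rate :: "real \<Rightarrow> real \<Rightarrow> real" where
  "flux_rate t a = - (Gamma \<alpha> * (c * (\<alpha> / 2 * t powr (\<alpha> / 2 - 1)) +
    (\<alpha> / 2 * t powr (\<alpha> / 2 - 1) * integral {a * t powr (- \<alpha> / 2)..c} profile +
     t powr (\<alpha> / 2) * (profile (a * t powr (- \<alpha> / 2)) * (a * (\<alpha> / 2 * t powr (- \<alpha> / 2 - 1)))))))"

lemma flux_temp_deriv:
  assumes "0 < t" "0 < a" "a < front t"
  shows "((\<lambda>r. flux_integral \<alpha> front temp a r) has_real_derivative flux_rate t a) (at t)"
proof -
  let ?\<Phi> = "\<lambda>z. integral {z..c} profile"
  let ?Q = "\<lambda>r. - (Gamma \<alpha> * (c * r powr (\<alpha> / 2) - a + r powr (\<alpha> / 2) * ?\<Phi> (a * r powr (- \<alpha> / 2))))"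
  have y: "a * t powr (- \<alpha> / 2) < c" using le_front_iff(2)[of t a] assms by simp
  have d\<Phi>: "((\<lambda>r. ?\<Phi> (a * r powr (- \<alpha> / 2))) has_real_derivative
      (profile (a * t powr (- \<alpha> / 2)) * (a * (\<alpha> / 2 * t powr (- \<alpha> / 2 - 1))))) (at t)"
    by (rule DERIV_cong[OF DERIV_chain2[where f = ?\<Phi> and g = "\<lambda>r. a * r powr (- \<alpha> / 2)", OF integral_profile_deriv[OF y]]])
      (use assms in \<open>auto intro!: derivative_eq_intros\<close>)
  have dp: "((\<lambda>r. r powr (\<alpha> / 2)) has_real_derivative (\<alpha> / 2 * t powr (\<alpha> / 2 - 1))) (at t)"
    using assms by (auto intro!: derivative_eq_intros)
  have d: "(?Q has_real_derivative flux_rate t a) (at t)"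
    unfolding flux_rate_def
    by (rule DERIV_cong[OF DERIV_minus[OF DERIV_cmult[OF DERIV_add[OF DERIV_diff[OF DERIV_cmult[OF dp]
      DERIV_const] DERIV_mult[OF dp d\<Phi>]]]]]) (simp add: algebra_simps)
  show ?thesis
  \<comment> \<open>The closed form holds from the arrival time at \<open>a\<close> onwards; as a <
    \<open>front t\<close>, the time t lies strictly after it.\<close>
  proof (rule has_field_derivative_transform_within_open[OF d, of "{s_inv front a<..}"])
    have "s_inv front a \<noteq> t" using s_inv_front_scaled[OF assms(2)] y by auto
    moreover have "s_inv front a \<le> t" using s_inv_front_le_iff[of a t] y assms by simp
    ultimately show "t \<in> {s_inv front a<..}" by simp
    show "?Q r = flux_integral \<alpha> front temp a r" if "r \<in> {s_inv front a<..}" for r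
      using flux_temp(2)[of a r] assms that by simp
  qed simp
qed

text \<open>At a = \<open>front t\<close> the similarity variable is c: the integral of the profile
  is over a point and \<open>profile c\<close> is 0, so only the derivative of the front
  survives.\<close>

lemma flux_rate_tendsto:
  assumes "0 < t"
  shows "(flux_rate t \<longlongrightarrow> - (Gamma \<alpha> * deriv front t)) (at_left (front t))"
proof -
  have sub: "x * t powr (- \<alpha> / 2) \<in> {0..c}" if "x \<in> {0..front t}" for x
    using le_front_iff(1)[of t x] assms that by auto
  have "continuous_on {0..c} (\<lambda>z. integral {z..c} profile)"
    by (intro indefinite_integral_continuous_1' integrable_continuous_real profile_continuous_on) auto
  then have 1: "continuous_on {0..front t} (\<lambda>a. integral {a * t powr (- \<alpha> / 2)..c} profile)"
    by (rule continuous_on_compose2) (use sub in \<open>auto intro!: continuous_intros\<close>)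
  have "continuous_on {0..c} profile" by (rule profile_continuous_on) auto
  then have 2: "continuous_on {0..front t} (\<lambda>a. profile (a * t powr (- \<alpha> / 2)))"
    by (rule continuous_on_compose2) (use sub in \<open>auto intro!: continuous_intros\<close>)
  have "continuous_on {0..front t} (flux_rate t)"
    unfolding flux_rate_def[abs_def] by (intro continuous_intros 1 2)
  then have "(flux_rate t \<longlongrightarrow> flux_rate t (front t)) (at (front t) within {0..front t})"
    using front_pos[OF assms] by (auto simp: continuous_on_def)
  moreover have "at (front t) within {0..front t} = at_left (front t)"
    using front_pos[OF assms] by (rule at_within_Icc_at_left)
  moreover have "flux_rate t (front t) = - (Gamma \<alpha> * deriv front t)"
    unfolding flux_rate_def front_scaled[OF assms] deriv_front[OF assms] by (simp add: profile_c)
  ultimately show ?thesis by simp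
qed

lemma stefan_condition:
  assumes "0 < t"
  shows "((\<lambda>a. deriv (\<lambda>r. flux_integral \<alpha> front temp a r) t) \<longlongrightarrow> - (Gamma \<alpha> * deriv front t))
    (at_left (front t))"
proof (rule Lim_transform_eventually[OF flux_rate_tendsto[OF assms]])
  have "\<forall>\<^sub>F a in at_left (front t). a \<in> {0<..<front t}"
    using front_pos[OF assms] by (rule eventually_at_left_real)
  then show "\<forall>\<^sub>F a in at_left (front t). flux_rate t a = deriv (\<lambda>r. flux_integral \<alpha> front temp a r) t"
  proof eventually_elim
    case (elim a)
    then show ?case using DERIV_imp_deriv[OF flux_temp_deriv[OF assms, of a]] by simp
  qed
qed

lemma temp_stefan_solution: "stefan_solution \<alpha> (profile 0) temp front"
  unfolding stefan_solution_def
proof (intro conjI allI impI ballI)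
  show "front 0 = 0" by (rule front_0)
  show "bij_betw front {0..} {0..}" by (rule front_bij)
  show "continuous_on {(x, t). 0 < t \<and> 0 \<le> x \<and> x \<le> front t} (\<lambda>(x, t). temp x t)"
    unfolding temp_def case_prod_beta'
    by (rule continuous_on_compose2[OF profile_continuous_on[of "{..c}"]])
      (auto intro!: continuous_intros simp: le_front_iff(1))
  show "x_diff front temp x t" if "0 < t" "x \<in> {0..front t}" for x t
    using u_x_temp(1) that by blast
  show "t_diff front temp x t" if "0 < x" "s_inv front x \<le> t" for x t
    using u_t_temp(1) that by blast
  show "case z of (x, t) \<Rightarrow> (\<lambda>y. u_x front temp y t) field_differentiable (at x) \<and>
      set_integrable lebesgue {s_inv front x..t} (caputo_integrand \<alpha> front temp x t) \<and>
      caputo \<alpha> front temp x t =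
        u_xx front temp x t - 1 / Gamma (1 - \<alpha>) * (t - s_inv front x) powr (- \<alpha>)"
    if "z \<in> Udom front" for z
  proof -
    obtain x t where z: "z = (x, t)" "0 < t" "0 < x" "x < front t"
      using \<open>z \<in> _\<close> by (auto simp: Udom_def)
    show ?thesis
      using u_x_deriv_temp[OF z(2-4)] caputo_temp(1)[OF z(2-4)] temp_pde[OF z(2-4)]
      by (auto simp: z(1) field_differentiable_def)
  qed
  show "temp (front t) t = 0" if "0 < t" for t
    unfolding temp_def front_scaled[OF that] by (rule profile_c)
  show "temp 0 t = profile 0" for t
    by (simp add: temp_def)
  show "front field_differentiable (at t)" if "0 < t" for t
    using front_has_derivative[OF that] by (auto simp: field_differentiable_def)
  show "set_integrable lebesgue {s_inv front a..t} (flux_integrand \<alpha> front temp a t)"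
    if "0 < t" "a \<in> {0<..<front t}" for a t
    using flux_temp(1)[of a t] s_inv_front_le_iff[of a t] le_front_iff(2)[of t a] that by simp
  show "(\<lambda>r. flux_integral \<alpha> front temp a r) field_differentiable (at t)"
    if "0 < t" "a \<in> {0<..<front t}" for a t
    using flux_temp_deriv[of t a] that by (auto simp: field_differentiable_def)
  show "\<exists>L. ((\<lambda>a. deriv (\<lambda>r. flux_integral \<alpha> front temp a r) t) \<longlongrightarrow> L) (at_left (front t)) \<and>
      deriv front t = - (1 / Gamma \<alpha>) * L" if "0 < t" for t
    using stefan_condition[OF that] Gamma_pos by (intro exI[of _ "- (Gamma \<alpha> * deriv front t)"]) simp
qed

section \<open>Representation, positivity and scaling\<close>

lemma temp_representation:
  assumes "0 < t" "0 \<le> x" "x \<le> front t"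
  shows "temp x t = (LINT p:{x * t powr (- \<alpha> / 2)..c}|lebesgue.
    H \<alpha> p (x * t powr (- \<alpha> / 2)) * G \<alpha> c p)"
proof -
  have y: "0 \<le> x * t powr (- \<alpha> / 2)" "x * t powr (- \<alpha> / 2) \<le> c"
    using le_front_iff(1)[of t x] assms by auto
  show ?thesis
    unfolding temp_def integral_H_G[OF y] by (rule profile_eq[OF y(1)])
qed

lemma temp_pos: "0 < t \<Longrightarrow> x < front t \<Longrightarrow> 0 < temp x t"
  unfolding temp_def using le_front_iff(2)[of t x] by (intro profile_pos) blast

text \<open>The similarity variable is invariant, since (l^(2a/\<alpha>))^(-\<alpha>/2) =
  l^(-a).\<close>

lemma temp_scaling:
  assumes "0 < l" "0 < t"
  shows "temp x t = temp (l powr a * x) (l powr (2 * a / \<alpha>) * t)"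
proof -
  have "(l powr (2 * a / \<alpha>) * t) powr (- \<alpha> / 2) = l powr (- a) * t powr (- \<alpha> / 2)"
    using assms alpha_pos by (simp add: powr_mult powr_powr)
  moreover have "l powr a * l powr (- a) = 1" using assms by (simp add: powr_add[symmetric])
  then have "l powr a * x * (l powr (- a) * t powr (- \<alpha> / 2)) = x * t powr (- \<alpha> / 2)"
    by (metis (no_types, opaque_lifting) mult.assoc mult.commute mult_1_right)
  ultimately show ?thesis by (simp only: temp_def)
qed

lemma temp_x_derivative_front:
  assumes "0 < t"
  shows "((\<lambda>x. temp x t) has_real_derivative 0) (at (front t) within {0..front t})"
proof -
  have "((\<lambda>x. temp x t) has_real_derivative - (t powr (- \<alpha> / 2) * slope c)) (at (front t))"
    using temp_x_derivative[of "front t" t] unfolding front_scaled[OF assms] by simp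
  then show ?thesis
    using slope_beyond[of c] by (simp add: has_field_derivative_at_within)
qed

section \<open>Regularity in space and time\<close>

lemma scaled_absolutely_integrable:
  fixes f :: "real \<Rightarrow> real"
  assumes "0 < t" "f absolutely_integrable_on {0..c}" "\<And>y. 0 \<le> y \<Longrightarrow> y \<le> c \<Longrightarrow> 0 \<le> f y"
  shows "(\<lambda>x. f (x * t powr (- \<alpha> / 2))) absolutely_integrable_on {0..front t}"
proof (rule nonnegative_absolutely_integrable_1)
  let ?r = "t powr (- \<alpha> / 2)"
  have "(f has_integral integral {0..c} f) {?r * 0..?r * front t}"
    using set_lebesgue_integral_eq_integral(1)[OF assms(2)] front_scaled[OF assms(1)]
    by (simp add: integrable_integral mult.commute)
  from has_integral_scale[OF this] assms(1) show "(\<lambda>x. f (x * ?r)) integrable_on {0..front t}"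
    by (auto simp: mult.commute)
  show "0 \<le> f (x * ?r)" if "x \<in> {0..front t}" for x
    using that assms le_front_iff(1)[of t x] by auto
qed

text \<open>The second derivative t^(-\<alpha>) \<open>curvature\<close> is unbounded near the front
  but integrable, which is all that \<open>sobolev_W1_2I\<close> asks of it.\<close>

lemma temp_sobolev:
  assumes "0 < t"
  shows "sobolev_W1 2 {0<..<front t} (\<lambda>x. temp x t)"
proof (rule sobolev_W1_2I[OF front_pos[OF assms]])
  let ?r = "t powr (- \<alpha> / 2)"
  have sub: "(\<lambda>x. x * ?r) ` {0..front t} \<subseteq> {..c}"
    by (intro image_subsetI) (simp only: atLeastAtMost_iff atMost_iff le_front_iff(1)[OF assms])
  show "continuous_on {0..front t} (\<lambda>x. temp x t)"
    unfolding temp_def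
    by (rule continuous_on_compose2[OF profile_continuous_on[of "{..c}"] _ sub])
      (auto intro!: continuous_intros)
  have "continuous_on {0..front t} (\<lambda>x. slope (x * ?r))"
    by (rule continuous_on_compose2[OF slope_continuous_on[of UNIV]]) (auto intro!: continuous_intros)
  then have "continuous_on {0..front t} (\<lambda>x. - (?r * slope (x * ?r)))"
    by (intro continuous_intros)
  then show "continuous_on {0..front t} (\<lambda>x. u_x front temp x t)"
    by (rule continuous_on_eq) (use u_x_temp(2)[OF assms] in auto)
  show "((\<lambda>x. temp x t) has_real_derivative u_x front temp x t) (at x)" if "0 < x" "x < front t" for x
    using temp_x_derivative[of x t] u_x_temp(2)[OF assms, of x] le_front_iff(1)[of t x] assms that by simp
  show "((\<lambda>y. u_x front temp y t) has_real_derivative t powr (- \<alpha>) * curvature (x * ?r)) (at x)"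
    if "0 < x" "x < front t" for x
    using u_x_deriv_temp assms that by blast
  show "(\<lambda>x. t powr (- \<alpha>) * curvature (x * ?r)) absolutely_integrable_on {0..front t}"
    using scaled_absolutely_integrable[OF assms curvature_absolutely_integrable[of 0 c]] curvature_nonneg
    by (auto intro: set_integrable_mult_right)
qed

lemma u_t_temp_continuous_on:
  assumes "0 < x"
  shows "continuous_on {s_inv front x..} (u_t front temp x)"
proof -
  have "continuous_on {s_inv front x..}
      (\<lambda>t. \<alpha> / 2 * x * t powr (- \<alpha> / 2 - 1) * slope (x * t powr (- \<alpha> / 2)))"
    by (intro continuous_intros continuous_on_compose2[OF slope_continuous_on[of UNIV]])
      (use s_inv_front_pos[OF assms] in auto)
  then show ?thesis
    by (rule continuous_on_eq) (use u_t_temp(2)[OF assms] in auto)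
qed

lemma u_x_temp_in_time:
  assumes "0 < x" "s_inv front x \<le> t"
  shows "x_diff front temp x t"
    and "u_x front temp x t = - (t powr (- \<alpha> / 2)) * slope (x * t powr (- \<alpha> / 2))"
proof -
  have "0 < t" "x \<in> {0..front t}"
    using s_inv_front_le_iff[of x t] le_front_iff(1)[of t x] assms by auto
  from u_x_temp[OF this] show "x_diff front temp x t"
    "u_x front temp x t = - (t powr (- \<alpha> / 2)) * slope (x * t powr (- \<alpha> / 2))"
    by (simp_all only: mult_minus_left)
qed

lemma u_x_temp_L_inf:
  assumes "0 < x"
  shows "L_inf {s_inv front x<..} (u_x front temp x)"
proof -
  let ?t0 = "s_inv front x"
  obtain V where V: "0 < V" "\<And>y. slope y \<le> V" using slope_bounded by blast
  have t0: "0 < ?t0" using s_inv_front_pos[OF assms] .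
  have "continuous_on {?t0<..} (\<lambda>t. - (t powr (- \<alpha> / 2)) * slope (x * t powr (- \<alpha> / 2)))"
    by (intro continuous_intros continuous_on_compose2[OF slope_continuous_on[of UNIV]])
      (use t0 in auto)
  then have c: "continuous_on {?t0<..} (u_x front temp x)"
    by (rule continuous_on_eq) (use u_x_temp_in_time(2)[OF assms] in auto)
  show ?thesis
  proof (rule L_inf_continuous[OF _ c])
    show "\<bar>u_x front temp x t\<bar> \<le> ?t0 powr (- \<alpha> / 2) * V" if "t \<in> {?t0<..}" for t
    proof -
      have "t powr (- \<alpha> / 2) \<le> ?t0 powr (- \<alpha> / 2)"
        using that t0 alpha_pos by (intro powr_mono2') auto
      then have "t powr (- \<alpha> / 2) * slope (x * t powr (- \<alpha> / 2)) \<le> ?t0 powr (- \<alpha> / 2) * V"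
        using V slope_nonneg by (intro mult_mono) auto
      then show ?thesis
        using u_x_temp_in_time(2)[OF assms, of t] that slope_nonneg by (simp add: abs_mult)
    qed
  qed simp
qed

text \<open>The curvature is unbounded near c, so the slope, followed along a fixed x, has an
  unbounded time derivative near the arrival time and is out of reach of \<open>AC_on_C1\<close>.
  Its density comes from the similarity substitution in \<open>curvature_has_integral\<close>; the
  power of \<tau> is smooth on the interval and enters through \<open>AC_on_mult\<close>.\<close>

lemma u_x_temp_AC_time:
  assumes "0 < x"
  shows "AC_on {s_inv front x..T} (u_x front temp x)"
proof -
  let ?t0 = "s_inv front x"
  let ?g = "\<lambda>\<tau>. \<alpha> / 2 * x * \<tau> powr (- \<alpha> / 2 - 1) * curvature (x * \<tau> powr (- \<alpha> / 2))"
  obtain V where V: "0 < V" "\<And>y. slope y \<le> V" using slope_bounded by blast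
  have t0: "0 < ?t0" using s_inv_front_pos[OF assms] .
  have cur: "curvature absolutely_integrable_on {x * b powr (- \<alpha> / 2)..x * a powr (- \<alpha> / 2)}"
    if "?t0 \<le> a" for a b
    using that s_inv_front_le_iff[of x a] assms
    by (intro curvature_absolutely_integrable) auto
  have 1: "AC_on {?t0..T} (\<lambda>\<tau>. slope (x * \<tau> powr (- \<alpha> / 2)))"
  proof (rule AC_on_integral)
    show "?g absolutely_integrable_on {?t0..T}"
    proof (cases "?t0 \<le> T")
      case True
      then show ?thesis using similarity_substitution(1)[OF assms t0 True cur] by simp
    qed (simp add: set_integrable_def)
    fix a b assume ab: "?t0 \<le> a" "a \<le> b" "b \<le> T"
    then have a: "0 < a" using t0 by linarith
    have gi: "?g integrable_on {a..b}"
      using set_lebesgue_integral_eq_integral(1)[OF similarity_substitution(1)[OF assms a ab(2) cur[OF ab(1)]]] .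
    have "x * a powr (- \<alpha> / 2) \<le> c" using s_inv_front_le_iff[OF assms] ab(1) by blast
    moreover have "x * b powr (- \<alpha> / 2) \<le> x * a powr (- \<alpha> / 2)"
      using a ab assms alpha_pos by (intro mult_left_mono powr_mono2') auto
    moreover have "0 \<le> x * b powr (- \<alpha> / 2)" using assms by simp
    ultimately have e: "integral {x * b powr (- \<alpha> / 2)..x * a powr (- \<alpha> / 2)} curvature
        = slope (x * b powr (- \<alpha> / 2)) - slope (x * a powr (- \<alpha> / 2))"
      by (intro integral_unique curvature_has_integral)
    have "integral {a..b} ?g = slope (x * b powr (- \<alpha> / 2)) - slope (x * a powr (- \<alpha> / 2))"
      by (rule trans[OF similarity_substitution(2)[OF assms a ab(2) cur[OF ab(1)]] e])
    then show "(?g has_integral slope (x * b powr (- \<alpha> / 2)) - slope (x * a powr (- \<alpha> / 2))) {a..b}"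
      using integrable_integral[OF gi] by (simp only:)
  qed
  have 2: "AC_on {?t0..T} (\<lambda>\<tau>. - (\<tau> powr (- \<alpha> / 2)))"
  proof (rule AC_on_C1)
    show "((\<lambda>\<tau>. - (\<tau> powr (- \<alpha> / 2))) has_real_derivative \<alpha> / 2 * \<tau> powr (- \<alpha> / 2 - 1)) (at \<tau> within {?t0..T})"
      if "\<tau> \<in> {?t0..T}" for \<tau>
      using that t0 by (auto intro!: derivative_eq_intros)
    show "continuous_on {?t0..T} (\<lambda>\<tau>. \<alpha> / 2 * \<tau> powr (- \<alpha> / 2 - 1))"
      using t0 by (auto intro!: continuous_intros)
  qed
  have "AC_on {?t0..T} (\<lambda>\<tau>. - (\<tau> powr (- \<alpha> / 2)) * slope (x * \<tau> powr (- \<alpha> / 2)))"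
  \<comment> \<open>\<open>AC_on_mult\<close> takes one bound for both factors; the sum of the
    separate bounds serves.\<close>
  proof (rule AC_on_mult[OF 2 1, of "V + ?t0 powr (- \<alpha> / 2)"])
    show "0 < V + ?t0 powr (- \<alpha> / 2)" using V by (simp add: add_pos_nonneg)
    show "\<bar>- (\<tau> powr (- \<alpha> / 2))\<bar> \<le> V + ?t0 powr (- \<alpha> / 2)" if "\<tau> \<in> {?t0..T}" for \<tau>
    proof -
      have "\<tau> powr (- \<alpha> / 2) \<le> ?t0 powr (- \<alpha> / 2)"
        using that t0 alpha_pos by (intro powr_mono2') auto
      then show ?thesis using V(1) by simp
    qed
    show "\<bar>slope (x * \<tau> powr (- \<alpha> / 2))\<bar> \<le> V + ?t0 powr (- \<alpha> / 2)" for \<tau>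
      using V(2)[of "x * \<tau> powr (- \<alpha> / 2)"] slope_nonneg[of "x * \<tau> powr (- \<alpha> / 2)"]
        powr_ge_zero[of ?t0 "- \<alpha> / 2"] by linarith
  qed
  then show ?thesis
    by (rule AC_on_cong) (use u_x_temp_in_time(2)[OF assms] in auto)
qed

text \<open>Integrability of the curvature up to c gives absolute continuity up to the front itself;
  the shorter intervals of (A2) are restrictions.\<close>

lemma u_x_temp_AC_space:
  assumes "0 < t"
  shows "AC_on {0..front t} (\<lambda>x. u_x front temp x t)"
proof -
  let ?r = "t powr (- \<alpha> / 2)"
  have r: "0 < ?r" using assms by simp
  have le: "x * ?r \<le> c" if "x \<le> front t" for x using le_front_iff(1)[OF assms] that by simp
  have "AC_on {0..front t} (\<lambda>x. - (?r * slope (x * ?r)))"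
  proof (rule AC_on_integral)
    show "(\<lambda>x. ?r * ?r * curvature (x * ?r)) absolutely_integrable_on {0..front t}"
      using scaled_absolutely_integrable[OF assms curvature_absolutely_integrable[of 0 c]] curvature_nonneg
      by (auto intro: set_integrable_mult_right)
    fix x y assume xy: "0 \<le> x" "x \<le> y" "y \<le> front t"
    have "(curvature has_integral (slope (x * ?r) - slope (y * ?r))) {?r * x..?r * y}"
      using curvature_has_integral[of "x * ?r" "y * ?r"] xy le[of y] r by (simp add: mult.commute)
    note scaled = has_integral_mult_right[OF has_integral_scale[OF this r], of "?r * ?r"]
    have eq: "(\<lambda>x. ?r * ?r * curvature (x * ?r)) = (\<lambda>x. ?r * ?r * curvature (?r * x))"
      by (simp add: mult.commute)
    have alg: "- (r * B) - - (r * A) = r * r * ((A - B) / r)" if "0 < r" for r A B :: real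
      using that by (simp add: field_simps)
    show "((\<lambda>x. ?r * ?r * curvature (x * ?r)) has_integral
        (- (?r * slope (y * ?r)) - - (?r * slope (x * ?r)))) {x..y}"
      unfolding eq alg[OF r] by (rule scaled)
  qed
  then show ?thesis
    by (rule AC_on_cong) (use u_x_temp(2)[OF assms] in auto)
qed

lemma u_t_temp_integrable:
  assumes "0 < t"
  shows "(\<lambda>x. u_t front temp x t) absolutely_integrable_on {0<..<front t}"
proof -
  have "continuous_on {0..front t} (\<lambda>x. \<alpha> / 2 * x * t powr (- \<alpha> / 2 - 1) * slope (x * t powr (- \<alpha> / 2)))"
    by (intro continuous_intros continuous_on_compose2[OF slope_continuous_on[of UNIV]]) auto
  then have i: "(\<lambda>x. \<alpha> / 2 * x * t powr (- \<alpha> / 2 - 1) * slope (x * t powr (- \<alpha> / 2)))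
      absolutely_integrable_on {0<..<front t}"
    by (intro set_lebesgue_integral_Ioo(1) absolutely_integrable_continuous_real)
  have eq: "\<alpha> / 2 * x * t powr (- \<alpha> / 2 - 1) * slope (x * t powr (- \<alpha> / 2)) = u_t front temp x t"
    if "x \<in> {0<..<front t}" for x
    using u_t_temp(2)[of x t] s_inv_front_le_iff[of x t] le_front_iff(2)[of t x] assms that by simp
  show ?thesis
    by (rule set_integrable_cong[THEN iffD1, OF refl refl eq i])
qed

lemma caputo_temp_integrable:
  assumes "0 < t"
  shows "(\<lambda>x. caputo \<alpha> front temp x t) absolutely_integrable_on {0<..<front t}"
proof -
  have "(\<lambda>x. t powr (- \<alpha>) * memory (x * t powr (- \<alpha> / 2))) absolutely_integrable_on {0..front t}"
    using scaled_absolutely_integrable[OF assms memory_absolutely_integrable] memory_nonneg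
    by (auto intro: set_integrable_mult_right)
  then have i: "(\<lambda>x. t powr (- \<alpha>) * memory (x * t powr (- \<alpha> / 2))) absolutely_integrable_on {0<..<front t}"
    by (rule set_lebesgue_integral_Ioo(1))
  have eq: "t powr (- \<alpha>) * memory (x * t powr (- \<alpha> / 2)) = caputo \<alpha> front temp x t"
    if "x \<in> {0<..<front t}" for x
    using caputo_temp(2)[OF assms, of x] that by simp
  show ?thesis
    by (rule set_integrable_cong[THEN iffD1, OF refl refl eq i])
qed

section \<open>Verification of (A1) to (A3)\<close>

lemma front_A1: "A1 front T"
  unfolding A1_def
proof (intro ballI conjI)
  fix t assume "t \<in> {0<..<T}"
  then have t: "0 < t" by simp
  show "front field_differentiable (at t)"
    using front_has_derivative[OF t] unfolding field_differentiable_def by blast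
  show "0 < deriv front t"
    unfolding deriv_front[OF t] using t c_pos alpha_pos by simp
qed

text \<open>The derivative is unbounded at 0, as \<alpha>/2 - 1 < 0, but integrable. The fundamental
  theorem with interior derivatives and continuity at 0 supplies the integral identity.\<close>

lemma front_AC: "AC_on {0..T} front"
proof (rule AC_on_integral)
  let ?g = "\<lambda>t. c * (\<alpha> / 2) * t powr (\<alpha> / 2 - 1)"
  have g: "(?g has_integral (front y - front x)) {x..y}" if "0 \<le> x" "x \<le> y" for x y
  proof (rule fundamental_theorem_of_calculus_interior[OF that(2)])
    show "continuous_on {x..y} front"
      unfolding front_def[abs_def] using that alpha_pos
      by (intro continuous_on_mult continuous_on_const continuous_on_powr' continuous_on_id) auto
    show "(front has_vector_derivative ?g t) (at t)" if "t \<in> {x<..<y}" for t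
      using front_has_derivative[of t] that \<open>0 \<le> x\<close>
      by (simp add: has_real_derivative_iff_has_vector_derivative)
  qed
  show "(?g has_integral (front y - front x)) {x..y}" if "0 \<le> x" "x \<le> y" "y \<le> T" for x y
    using g that by blast
  show "?g absolutely_integrable_on {0..T}"
  proof (cases "0 \<le> T")
    case True
    show ?thesis
      by (rule nonnegative_absolutely_integrable_1)
        (use g[of 0 T] True c_pos alpha_pos in auto)
  qed (simp add: set_integrable_def)
qed

lemma temp_A2: "A2 temp front T"
  unfolding A2_def
proof (intro conjI ballI)
  show "AC_on {0..T} front" by (rule front_AC)
  show "x_diff front temp x t" if "x \<in> {0<..<front T}" "t \<in> {s_inv front x..T}" for x t
    using u_x_temp_in_time(1) that by simp
  show "AC_on {s_inv front x..T} (u_x front temp x)" if "x \<in> {0<..<front T}" for x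
    using u_x_temp_AC_time that by simp
  show "x_diff front temp x t" if "t \<in> {0<..<T}" "\<epsilon> \<in> {0<..<front t}" "x \<in> {0..front t - \<epsilon>}" for t \<epsilon> x
    using u_x_temp(1) that by simp
  show "AC_on {0..front t - \<epsilon>} (\<lambda>x. u_x front temp x t)" if "t \<in> {0<..<T}" "\<epsilon> \<in> {0<..<front t}" for t \<epsilon>
    by (rule AC_on_mono[OF u_x_temp_AC_space]) (use that in auto)
  show "t_diff front temp x t" if "t \<in> {0<..<T}" "x \<in> {0<..<front t}" for t x
    using u_t_temp(1)[of x t] s_inv_front_le_iff[of x t] le_front_iff(2)[of t x] that by simp
  show "(\<lambda>x. u_t front temp x t) absolutely_integrable_on {0<..<front t}" if "t \<in> {0<..<T}" for t
    using u_t_temp_integrable that by simp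
qed

lemma temp_A3: "A3 \<alpha> temp front T"
  unfolding A3_def
proof (intro conjI ballI)
  show "L_inf {\<epsilon>..T} (deriv front)" if "\<epsilon> \<in> {0<..<T}" for \<epsilon>
  proof -
    have "continuous_on {\<epsilon>..T} (\<lambda>t. c * (\<alpha> / 2) * t powr (\<alpha> / 2 - 1))"
      using that by (intro continuous_intros) auto
    then have cd: "continuous_on {\<epsilon>..T} (deriv front)"
      by (rule continuous_on_eq) (use that deriv_front in auto)
    show ?thesis
    proof (rule L_inf_continuous[OF _ cd])
      show "\<bar>deriv front t\<bar> \<le> c * (\<alpha> / 2) * \<epsilon> powr (\<alpha> / 2 - 1)" if "t \<in> {\<epsilon>..T}" for t
      proof -
        \<comment> \<open>The exponent is negative, so the largest value on the interval is taken at
          \<epsilon>.\<close>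
        have "t powr (\<alpha> / 2 - 1) \<le> \<epsilon> powr (\<alpha> / 2 - 1)"
          using that \<open>\<epsilon> \<in> _\<close> alpha_less_1 by (intro powr_mono2') auto
        then have "c * (\<alpha> / 2) * t powr (\<alpha> / 2 - 1) \<le> c * (\<alpha> / 2) * \<epsilon> powr (\<alpha> / 2 - 1)"
          using c_pos alpha_pos by (intro mult_left_mono) auto
        moreover have "0 < t" using that \<open>\<epsilon> \<in> _\<close> by simp
        ultimately show ?thesis
          using c_pos alpha_pos by (simp only: deriv_front) (simp add: abs_mult)
      qed
    qed simp
  qed
  show "set_integrable lebesgue {s_inv front x..t} (caputo_integrand \<alpha> front temp x t)"
    if "t \<in> {0<..<T}" "x \<in> {0<..<front t}" for t x
    using caputo_temp(1) that by simp
  show "(\<lambda>x. caputo \<alpha> front temp x t) absolutely_integrable_on {0<..<front t}" if "t \<in> {0<..<T}" for t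
    using caputo_temp_integrable that by simp
qed

end

theorem theorem2:
  fixes \<alpha> \<gamma> :: real
  assumes "0 < \<alpha>" and "\<alpha> < 1" and "0 < \<gamma>"
  shows "(\<exists>c1>0. \<exists>(u :: real \<Rightarrow> real \<Rightarrow> real) (s :: real \<Rightarrow> real).
      stefan_solution \<alpha> \<gamma> u s \<and>
      (\<forall>t\<ge>0. s t = c1 * t powr (\<alpha> / 2)) \<and>
      (\<forall>(x, t)\<in>Udom s. u x t =
         (LINT p:{x * t powr (- \<alpha> / 2)..c1}|lebesgue.
            H \<alpha> p (x * t powr (- \<alpha> / 2)) * G \<alpha> c1 p)) \<and>
      (\<forall>(x, t)\<in>Udom s. u x t > 0) \<and>
      (\<forall>a>0. \<forall>l>0. \<forall>t>0. \<forall>x\<in>{0..s t}.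
         u x t = u (l powr a * x) (l powr (2 * a / \<alpha>) * t)) \<and>
      (\<forall>t>0. ((\<lambda>x. u x t) has_real_derivative 0) (at (s t) within {0..s t})) \<and>
      (\<forall>t>0. sobolev_W1 2 {0<..<s t} (\<lambda>x. u x t)) \<and>
      (\<forall>x>0. (\<forall>t\<ge>s_inv s x. t_diff s u x t) \<and> continuous_on {s_inv s x..} (u_t s u x)) \<and>
      (\<forall>x>0. L_inf {s_inv s x<..} (u_x s u x) \<and>
             (\<forall>T>s_inv s x. AC_on {s_inv s x..T} (u_x s u x))) \<and>
      (\<forall>t>0. (\<lambda>x. u_t s u x t) absolutely_integrable_on {0<..<s t} \<and>
             (\<lambda>x. caputo \<alpha> s u x t) absolutely_integrable_on {0<..<s t}) \<and>
      (\<forall>T>0. A1 s T \<and> A2 u s T \<and> A3 \<alpha> u s T)) \<and>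
    (\<forall>R>0. uniform_limit {(p, y). 0 \<le> y \<and> y \<le> p \<and> p \<le> R}
       (\<lambda>k (p, y). \<Sum>n=1..k. M \<alpha> n p y) (\<lambda>(p, y). N \<alpha> p y) sequentially) \<and>
    (\<forall>p y. 0 \<le> y \<and> y < p \<longrightarrow> (\<forall>n\<ge>1. M \<alpha> n p y > 0) \<and> N \<alpha> p y > 0)"
    (is "?solution \<and> ?convergence \<and> ?positivity")
proof (intro conjI)
  interpret fractional_order \<alpha> by unfold_locales (use assms in auto)
  show ?solution
  proof -
    obtain c where c: "0 < c" "integral {0..c} (N \<alpha> c) = \<gamma>"
      using ex_front_constant[OF assms(3)] by blast
    interpret front_profile \<alpha> c by unfold_locales (rule c)
    have \<gamma>: "profile 0 = \<gamma>" using profile_eq[of 0] c by simp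
    show ?thesis
    proof (intro exI[of _ c] exI[of _ temp] exI[of _ front] conjI allI impI ballI)
      show "0 < c" by (rule c)
      show "stefan_solution \<alpha> \<gamma> temp front" using temp_stefan_solution \<gamma> by simp
      show "front t = c * t powr (\<alpha> / 2)" for t by (rule front_def)
      show "case z of (x, t) \<Rightarrow> temp x t = (LINT p:{x * t powr (- \<alpha> / 2)..c}|lebesgue.
          H \<alpha> p (x * t powr (- \<alpha> / 2)) * G \<alpha> c p)" if "z \<in> Udom front" for z
        using that temp_representation by (auto simp: Udom_def)
      show "case z of (x, t) \<Rightarrow> 0 < temp x t" if "z \<in> Udom front" for z
        using that temp_pos by (auto simp: Udom_def)
      show "temp x t = temp (l powr a * x) (l powr (2 * a / \<alpha>) * t)" if "0 < l" "0 < t" for a l t x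
        using that by (rule temp_scaling)
    qed (simp_all add: temp_x_derivative_front temp_sobolev u_t_temp u_t_temp_continuous_on
        u_x_temp_L_inf u_x_temp_AC_time u_t_temp_integrable caputo_temp_integrable
        front_A1 temp_A2 temp_A3)
  qed
  show ?convergence
  proof (intro allI impI)
    fix R :: real assume "0 < R"
    from N_uniform_limit[OF this]
    show "uniform_limit {(p, y). 0 \<le> y \<and> y \<le> p \<and> p \<le> R}
       (\<lambda>k (p, y). \<Sum>n=1..k. M \<alpha> n p y) (\<lambda>(p, y). N \<alpha> p y) sequentially"
      \<comment> \<open>Index shift: the sum over 1..k is the sum of the terms with index
        \<open>Suc i\<close> over i < k.\<close>
      by (simp only: One_nat_def sum.atLeast1_atMost_eq)
  qed
  show ?positivity
  proof (intro allI impI conjI)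
    fix p y :: real assume "0 \<le> y \<and> y < p"
    then show "0 < N \<alpha> p y" using N_pos by blast
    fix n :: nat assume "1 \<le> n"
    then show "0 < M \<alpha> n p y" using M_pos[of y p "n - 1"] \<open>0 \<le> y \<and> y < p\<close> by (cases n) auto
  qed
qed

end
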